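(* Let $\vec{p},\vec{q}\in[1,\infty)^{n}$ and $\vec{\alpha}\in\mathbb{R}^n$. Then the dual space $[\dot{E}^{\vec{\alpha},\vec{p}}_{\vec{q}}(\mathbb{R}^n)]^{*}$ of $\dot{E}^{\vec{\alpha},\vec{p}}_{\vec{q}}(\mathbb{R}^n)$ is $\dot{E}^{-\vec{\alpha},\vec{p}'}_{\vec{q}'}(\mathbb{R}^n)$ in the following sense: (i) For any $g\in\dot{E}^{-\vec{\alpha},\vec{p}'}_{\vec{q}'}(\mathbb{R}^n)$, the linear functional $$J_{g}:\ f\mapsto J_{g}(f):=\int_{\mathbb{R}^n}f(x)g(x)\,dx$$ is bounded on $\dot{E}^{\vec{\alpha},\vec{p}}_{\vec{q}}(\mathbb{R}^n)$. (ii) Conversely, any continuous linear functional on $\dot{E}^{\vec{\alpha},\vec{p}}_{\vec{q}}(\mathbb{R}^n)$ is of the form $J_g$ for a unique $g\in\dot{E}^{-\vec{\alpha},\vec{p}'}_{\vec{q}'}(\mathbb{R}^n)$. Moreover, $\|g\|_{\dot{E}^{-\vec{\alpha},\vec{p}'}_{\vec{q}'}(\mathbb{R}^n)}=\|J_{g}\|_{[\dot{E}^{\vec{\alpha},\vec{p}}_{\vec{q}}(\mathbb{R}^n)]^{*}}$.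
   Context: $\mathscr{M}(\mathbb{R}^n)$ is the set of all measurable functions on $\mathbb{R}^n$ (functions equal almost everywhere are identified). For $k\in\mathbb{Z}$ let $R_k:=(-2^{k},2^{k})\setminus(-2^{k-1},2^{k-1})\subset\mathbb{R}$. For $p,q\in(0,\infty]$, $\alpha\in\mathbb{R}$, and measurable $h$ on $\mathbb{R}$, let $\|h\|_{\dot{K}^{\alpha,p}_{q}(\mathbb{R})}:=[\sum_{k\in\mathbb{Z}}2^{kp\alpha}\|h\mathbf{1}_{R_k}\|_{L^q(\mathbb{R})}^p]^{1/p}$, with the usual modifications when $p=\infty$ or $q=\infty$. For $\vec{p}=(p_1,\ldots,p_n),\vec{q}=(q_1,\ldots,q_n)\in(0,\infty]^n$ and $\vec{\alpha}=(\alpha_1,\ldots,\alpha_n)\in\mathbb{R}^n$, the mixed-norm Herz space $\dot{E}^{\vec{\alpha},\vec{p}}_{\vec{q}}(\mathbb{R}^n)$ is the set of all $f\in\mathscr{M}(\mathbb{R}^n)$ such that $$\|f\|_{\dot{E}^{\vec{\alpha},\vec{p}}_{\vec{q}}(\mathbb{R}^n)}:=\Big\|\cdots\|f\|_{\dot{K}^{\alpha_1,p_1}_{q_1}(\mathbb{R})}\cdots\Big\|_{\dot{K}^{\alpha_n,p_n}_{q_n}(\mathbb{R})}<\infty,$$ i.e. the norm obtained by taking successively the $\dot{K}^{\alpha_1,p_1}_{q_1}(\mathbb{R})$-norm in $x_1$, the $\dot{K}^{\alpha_2,p_2}_{q_2}(\mathbb{R})$-norm in $x_2$, ..., and the $\dot{K}^{\alpha_n,p_n}_{q_n}(\mathbb{R})$-norm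 in $x_n$. For $\vec{p}\in[1,\infty]^n$, $\vec{p}'=(p_1',\ldots,p_n')$ with $1/p_i+1/p_i'=1$ for each $i$. The dual space of a Banach space is the space of its continuous linear functionals with the operator norm. *)

theory Defs
  imports "HOL-Analysis.Analysis" "HOL-Probability.Essential_Supremum"
begin

(* Norms are taken of [0,\<infinity>]-valued functions and are themselves [0,\<infinity>]-valued, so that they
   can be iterated; an integrability exponent in (0,\<infinity>] is a nonzero ennreal. *)

text \<open>Powers of extended nonnegative numbers; only meaningful for exponents \<open>r > 0\<close>.\<close>

definition epowr :: "ennreal \<Rightarrow> real \<Rightarrow> ennreal" where
  "epowr x r = (if x = \<infinity> then \<infinity> else ennreal (enn2real x powr r))"

definition Lq_norm :: "ennreal \<Rightarrow> (real \<Rightarrow> ennreal) \<Rightarrow> ennreal" where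
  "Lq_norm q h =
     (if q = \<infinity> then esssup lebesgue h
      else epowr (\<integral>\<^sup>+t. epowr (h t) (enn2real q) \<partial>lebesgue) (1 / enn2real q))"

definition dyadic_shell :: "int \<Rightarrow> real set" where
  "dyadic_shell k = {- (2 powi k)<..<2 powi k} - {- (2 powi (k - 1))<..<2 powi (k - 1)}"

definition herz_norm :: "real \<Rightarrow> ennreal \<Rightarrow> ennreal \<Rightarrow> (real \<Rightarrow> ennreal) \<Rightarrow> ennreal" where
  "herz_norm \<alpha> p q h =
     (let a = (\<lambda>k. Lq_norm q (\<lambda>t. h t * indicator (dyadic_shell k) t)) in
      if p = \<infinity> then (SUP k::int. ennreal (2 powr (of_int k * \<alpha>)) * a k)
      else epowr (\<Sum>\<^sub>\<infinity>k::int. ennreal (2 powr (of_int k * enn2real p * \<alpha>)) * epowr (a k) (enn2real p))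
             (1 / enn2real p))"

text \<open>
  The coordinates of \<open>\<real>\<^sup>n\<close> are indexed by a finite linearly ordered type \<open>'n\<close>, whose
  least element plays the role of 1. Taking a norm in coordinate \<open>i\<close> yields a function that no
  longer depends on coordinate \<open>i\<close>; after all coordinates have been treated in increasing order
  the result is constant, and it is read off at 0.
\<close>

definition partial_herz_norm ::
  "real^'n \<Rightarrow> ennreal^'n \<Rightarrow> ennreal^'n \<Rightarrow> 'n \<Rightarrow> (real^'n \<Rightarrow> ennreal) \<Rightarrow> real^'n \<Rightarrow> ennreal" where
  "partial_herz_norm \<alpha> p q i F =
     (\<lambda>x. herz_norm (\<alpha> $ i) (p $ i) (q $ i) (\<lambda>t. F (\<chi> j. if j = i then t else x $ j)))"

definition mixed_herz_norm ::
  "real^'n::{finite,linorder} \<Rightarrow> ennreal^'n::{finite,linorder} \<Rightarrow> ennreal^'n::{finite,linorder} \<Rightarrow> (real^'n::{finite,linorder} \<Rightarrow> 'a::real_normed_vector) \<Rightarrow> ennreal" where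
  "mixed_herz_norm \<alpha> p q f =
     fold (partial_herz_norm \<alpha> p q) (sorted_list_of_set UNIV) (\<lambda>x. ennreal (norm (f x))) 0"

text \<open>
  Elements are represented by Lebesgue measurable functions; two of them are the same element
  iff they agree almost everywhere. By Fubini's theorem the intermediate functions in
  \<open>mixed_herz_norm\<close> have measurable sections, and respect equality almost everywhere, up to a
  null set of the remaining coordinates, which the outer norms do not see.
\<close>

definition mixed_herz_space ::
  "real^'n::{finite,linorder} \<Rightarrow> ennreal^'n::{finite,linorder} \<Rightarrow> ennreal^'n::{finite,linorder} \<Rightarrow> (real^'n::{finite,linorder} \<Rightarrow> 'a::real_normed_vector) set" where
  "mixed_herz_space \<alpha> p q =
     {f. f \<in> borel_measurable lebesgue \<and> mixed_herz_norm \<alpha> p q f < \<infinity>}"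

text \<open>
  Scalars range over \<open>'a::{real_normed_field,euclidean_space}\<close>, i.e. the real or the complex
  field (these are the only finite-dimensional real normed fields). A functional is a map on
  representatives. Continuity or boundedness of a linear functional forces it to take equal
  values on functions that agree almost everywhere, because their difference has norm 0, so it
  is a functional on the equivalence classes.
\<close>

definition linear_functional_on ::
  "('b \<Rightarrow> 'a::real_normed_field) set \<Rightarrow> (('b \<Rightarrow> 'a) \<Rightarrow> 'a) \<Rightarrow> bool" where
  "linear_functional_on E \<Lambda> \<longleftrightarrow>
     (\<forall>f\<in>E. \<forall>h\<in>E. \<Lambda> (\<lambda>x. f x + h x) = \<Lambda> f + \<Lambda> h) \<and>
     (\<forall>c. \<forall>f\<in>E. \<Lambda> (\<lambda>x. c * f x) = c * \<Lambda> f)"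

definition herz_continuous ::
  "real^'n::{finite,linorder} \<Rightarrow> ennreal^'n::{finite,linorder} \<Rightarrow> ennreal^'n::{finite,linorder} \<Rightarrow> ((real^'n::{finite,linorder} \<Rightarrow> 'a::real_normed_field) \<Rightarrow> 'a) \<Rightarrow> bool" where
  "herz_continuous \<alpha> p q \<Lambda> \<longleftrightarrow>
     (\<forall>f\<in>mixed_herz_space \<alpha> p q. \<forall>\<epsilon>>0. \<exists>\<delta>>0. \<forall>h\<in>mixed_herz_space \<alpha> p q.
        mixed_herz_norm \<alpha> p q (\<lambda>x. h x - f x) < ennreal \<delta> \<longrightarrow> norm (\<Lambda> h - \<Lambda> f) < \<epsilon>)"

definition herz_bounded ::
  "real^'n::{finite,linorder} \<Rightarrow> ennreal^'n::{finite,linorder} \<Rightarrow> ennreal^'n::{finite,linorder} \<Rightarrow> ((real^'n::{finite,linorder} \<Rightarrow> 'a::real_normed_field) \<Rightarrow> 'a) \<Rightarrow> bool" where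
  "herz_bounded \<alpha> p q \<Lambda> \<longleftrightarrow>
     (\<exists>C. \<forall>f\<in>mixed_herz_space \<alpha> p q. norm (\<Lambda> f) \<le> C * enn2real (mixed_herz_norm \<alpha> p q f))"

definition herz_dual_norm ::
  "real^'n::{finite,linorder} \<Rightarrow> ennreal^'n::{finite,linorder} \<Rightarrow> ennreal^'n::{finite,linorder} \<Rightarrow> ((real^'n::{finite,linorder} \<Rightarrow> 'a::real_normed_field) \<Rightarrow> 'a) \<Rightarrow> ennreal" where
  "herz_dual_norm \<alpha> p q \<Lambda> =
     (SUP f\<in>{f \<in> mixed_herz_space \<alpha> p q. mixed_herz_norm \<alpha> p q f \<le> 1}. ennreal (norm (\<Lambda> f)))"

definition pairing ::
  "(real^'n \<Rightarrow> 'a::{real_normed_field,euclidean_space}) \<Rightarrow> (real^'n \<Rightarrow> 'a) \<Rightarrow> 'a" where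
  "pairing g f = (LINT x|lebesgue. f x * g x)"

end

theory Submission
  imports Defs
begin

text \<open>
  Duality for one Herz norm is duality for two nested Lebesgue norms: the norm on the line is a
  weighted sequence norm over the dyadic shells of Lebesgue norms on the shells. The mixed norm
  applies such norms to one coordinate after the other, so that all its properties follow by
  induction over the list of coordinates, the coordinates not yet treated being parameters. The
  point is that the one-dimensional facts hold with measurable dependence on parameters.

  Boundedness of \<open>J\<^sub>g\<close> is Hoelder's inequality, iterated (\<open>fold_Holder\<close>). Its sharpness
  (\<open>fold_duality\<close>) comes from extremal functions: by Tonelli's theorem, the product of an extremal
  function for \<open>g\<close> in the first coordinate and one for the resulting norm in the other coordinates
  is almost extremal for the mixed norm. Monotone convergence lets the extremal functions be
  replaced by sequences, which covers infinite norms and suprema that are not attained.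
  Multiplying by a factor of modulus 1 then gives the equality of norms.

  For the converse, a continuous functional is bounded and splits into finitely many real
  functionals on real-valued functions. Let \<open>w\<close> be strictly positive with finite norm. As all exponents
  are finite, dominated convergence holds for the norm, and \<open>A \<mapsto> \<Lambda> (w 1\<^sub>A)\<close> is a bounded signed measure
  that vanishes on null sets. Its Radon--Nikodym density, divided by \<open>w\<close>, represents \<open>\<Lambda>\<close> on simple
  multiples of \<open>w\<close> and, by dominated convergence, on every function whose product with the density is
  integrable. Testing against such functions and duality bound the norm of the density, and then
  Hoelder's inequality makes the product integrable for all functions of the space.
\<close>

section \<open>Powers of extended nonnegative reals\<close>

lemma epowr_ennreal [simp]: "0 \<le> x \<Longrightarrow> epowr (ennreal x) r = ennreal (x powr r)"
  by (simp add: epowr_def)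

lemma epowr_top [simp]: "epowr \<infinity> r = \<infinity>" "epowr top r = \<infinity>"
  by (simp_all add: epowr_def)

lemma epowr_0 [simp]: "epowr 0 r = 0"
  by (simp add: epowr_def)

lemma epowr_1 [simp]: "epowr 1 r = 1"
  by (simp add: epowr_def)

lemma epowr_one [simp]: "epowr x 1 = x"
  by (cases x) auto

lemma epowr_epowr: "epowr (epowr x a) b = epowr x (a * b)"
  by (cases x) (auto simp: powr_powr)

lemma epowr_eq_0_iff [simp]: "epowr x r = 0 \<longleftrightarrow> x = 0"
  by (cases x) (auto simp: less_le)

lemma epowr_eq_top_iff [simp]: "epowr x r = top \<longleftrightarrow> x = top"
  by (cases x) auto

lemma epowr_less_top_iff [simp]: "epowr x r < top \<longleftrightarrow> x < top"
  by (simp add: less_top[symmetric])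

lemma epowr_mono: "0 \<le> r \<Longrightarrow> x \<le> y \<Longrightarrow> epowr x r \<le> epowr y r"
  by (cases x; cases y) (auto simp: powr_mono2 top_unique)

lemma epowr_mult: "0 < r \<Longrightarrow> epowr (x * y) r = epowr x r * epowr y r"
  by (cases x; cases y)
     (auto simp: powr_mult ennreal_mult[symmetric] ennreal_mult_top ennreal_top_mult)

lemma epowr_inverse: "0 < r \<Longrightarrow> epowr (epowr x r) (1 / r) = x" "0 < r \<Longrightarrow> epowr (epowr x (1 / r)) r = x"
  by (simp_all add: epowr_epowr)

lemma epowr_add: "epowr x a * epowr x b = epowr x (a + b)"
  by (cases x) (auto simp: powr_add ennreal_mult[symmetric] )

text \<open>
  A power with positive exponent is an order automorphism of the extended half-line; hence it
  commutes with suprema and infima.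
\<close>

lemma epowr_le_iff:
  assumes "0 < r"
  shows "epowr x r \<le> y \<longleftrightarrow> x \<le> epowr y (1 / r)" "y \<le> epowr x r \<longleftrightarrow> epowr y (1 / r) \<le> x"
  using assms epowr_mono[of r] epowr_mono[of "1 / r"] epowr_inverse[of r]
  by (metis less_imp_le zero_less_divide_1_iff)+

lemma epowr_SUP:
  assumes "0 < r" shows "epowr (SUP i\<in>I. f i) r = (SUP i\<in>I. epowr (f i) r)"
proof -
  have "epowr (SUP i\<in>I. f i) r \<le> z \<longleftrightarrow> (SUP i\<in>I. epowr (f i) r) \<le> z" for z
    by (simp add: SUP_le_iff epowr_le_iff(1)[OF assms])
  then show ?thesis by (meson order_antisym order_refl)
qed

lemma epowr_INF:
  assumes "0 < r" shows "epowr (INF i\<in>I. f i) r = (INF i\<in>I. epowr (f i) r)"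
proof -
  have "z \<le> epowr (INF i\<in>I. f i) r \<longleftrightarrow> z \<le> (INF i\<in>I. epowr (f i) r)" for z
    by (simp add: le_INF_iff epowr_le_iff(2)[OF assms])
  then show ?thesis by (meson order_antisym order_refl)
qed

lemma borel_measurable_epowr [measurable (raw)]:
  assumes [measurable]: "f \<in> borel_measurable M"
  shows "(\<lambda>x. epowr (f x) r) \<in> borel_measurable M"
  unfolding epowr_def by measurable

section \<open>Lebesgue norms with exponents in the extended half-line\<close>

text \<open>
  The underlying measure will be Lebesgue measure for the norms on the shells and counting measure
  on the integers for the sum over the shells.
\<close>

definition Lp :: "'m measure \<Rightarrow> ennreal \<Rightarrow> ('m \<Rightarrow> ennreal) \<Rightarrow> ennreal" where
  "Lp M r h =
     (if r = \<infinity> then esssup M h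
      else epowr (\<integral>\<^sup>+t. epowr (h t) (enn2real r) \<partial>M) (1 / enn2real r))"

definition conjugate :: "ennreal \<Rightarrow> ennreal \<Rightarrow> bool" where
  "conjugate r s \<longleftrightarrow> 1 / r + 1 / s = 1"

lemma conjugate_sym: "conjugate r s \<Longrightarrow> conjugate s r"
  by (simp add: conjugate_def add.commute)

lemma divide_eq_1_imp: "1 / s = 1 \<Longrightarrow> s = 1" for s :: ennreal
proof (cases s)
  case (real r)
  then show "1 / s = 1 \<Longrightarrow> s = 1"
    by (cases "r = 0") (auto simp: divide_ennreal less_le ennreal_divide_zero simp flip: ennreal_1)
qed simp

lemma conjugate_cases:
  assumes "conjugate r s"
  obtains "r = 1" "s = \<infinity>" | "r = \<infinity>" "s = 1"
    | a b where "r = ennreal a" "s = ennreal b" "1 < a" "1 < b" "1 / a + 1 / b = 1"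
proof -
  have eq: "1 / r + 1 / s = 1" using assms by (simp add: conjugate_def)
  have nz: "r \<noteq> 0" "s \<noteq> 0"
    using eq by (auto simp: ennreal_divide_zero)
  consider "r = \<infinity>" | "s = \<infinity>" | a b where "r = ennreal a" "s = ennreal b" "0 < a" "0 < b"
    using nz by (cases r; cases s) (auto simp: less_le)
  then show thesis
  proof cases
    case 1
    then have "1 / s = 1" using eq by simp
    then have "s = 1" by (rule divide_eq_1_imp)
    with 1 show thesis using that by blast
  next
    case 2
    then have "1 / r = 1" using eq by simp
    then have "r = 1" by (rule divide_eq_1_imp)
    with 2 show thesis using that by blast
  next
    case (3 a b)
    then have "ennreal (1 / a + 1 / b) = ennreal 1"
      using eq by (simp add: divide_ennreal flip: ennreal_1 ennreal_plus)
    then have e: "1 / a + 1 / b = 1"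
      using 3 by (subst (asm) ennreal_inj) auto
    then have "1 / a < 1" "1 / b < 1" using 3 by (smt (verit) divide_pos_pos)+
    then have "1 < a" "1 < b" using 3 by (auto simp: field_simps)
    with 3 e show thesis using that by blast
  qed
qed

lemma conjugate_ge_1:
  assumes "conjugate r s" shows "1 \<le> r"
  using assms by (cases rule: conjugate_cases) auto

lemma Lp_ennreal: "0 \<le> a \<Longrightarrow> Lp M (ennreal a) h = epowr (\<integral>\<^sup>+t. epowr (h t) a \<partial>M) (1 / a)"
  by (simp add: Lp_def)

lemma Lp_top: "Lp M \<infinity> h = esssup M h" "Lp M top h = esssup M h"
  by (simp_all add: Lp_def)

lemma Lp_1: "Lp M 1 h = (\<integral>\<^sup>+t. h t \<partial>M)"
  by (simp add: Lp_def)

lemma ge_1_cases: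
  fixes r :: ennreal assumes "1 \<le> r" obtains "r = \<infinity>" | a where "r = ennreal a" "1 \<le> a"
  using assms by (cases r) auto

lemma Lp_mono:
  assumes "1 \<le> r" "f \<in> borel_measurable M" and le: "\<And>t. t \<in> space M \<Longrightarrow> f t \<le> g t"
  shows "Lp M r f \<le> Lp M r g"
  using assms(1)
proof (cases rule: ge_1_cases)
  case 1 then show ?thesis using assms by (auto simp: Lp_top intro: esssup_AE_mono)
next
  case (2 a)
  then show ?thesis by (auto simp: Lp_ennreal intro!: epowr_mono nn_integral_mono le)
qed

lemma measurable_iff_AE_completion:
  fixes f g :: "_ \<Rightarrow> ennreal"
  assumes "AE t in completion M. f t = g t"
  shows "f \<in> borel_measurable (completion M) \<longleftrightarrow> g \<in> borel_measurable (completion M)"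
proof -
  have "g \<in> borel_measurable (completion M)"
    if f: "f \<in> borel_measurable (completion M)" and ae: "AE t in completion M. f t = g t" for f g :: "_ \<Rightarrow> ennreal"
  proof (rule measurableI)
    fix A :: "ennreal set" assume A: "A \<in> sets borel"
    show "g -` A \<inter> space (completion M) \<in> sets (completion M)"
    proof (rule completion.in_sets_AE)
      show "f -` A \<inter> space (completion M) \<in> sets (completion M)"
        using f A by (rule measurable_sets)
      show "AE x in completion M. (x \<in> f -` A \<inter> space (completion M)) = (x \<in> g -` A \<inter> space (completion M))"
        using ae by eventually_elim auto
    qed auto
  qed auto
  moreover have "AE t in completion M. g t = f t" using assms by eventually_elim simp
  ultimately show ?thesis using assms by blast
qed

text \<open>
  Sections of a Lebesgue measurable function may fail to be measurable, so that nothing of the kind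
  is assumed here. For the essential supremum, whose value depends on measurability, completeness
  of the measure makes both functions measurable or neither.
\<close>

lemma Lp_completion_cong_AE:
  fixes f g :: "_ \<Rightarrow> ennreal"
  assumes "AE t in completion M. f t = g t"
  shows "Lp (completion M) r f = Lp (completion M) r g"
proof (cases "r = \<infinity>")
  case True
  show ?thesis
  proof (cases "f \<in> borel_measurable (completion M)")
    case True
    then have "g \<in> borel_measurable (completion M)"
      using assms measurable_iff_AE_completion by blast
    with True assms show ?thesis using \<open>r = \<infinity>\<close> by (auto simp: Lp_def intro: esssup_AE_cong)
  next
    case False
    then have "g \<notin> borel_measurable (completion M)"
      using assms measurable_iff_AE_completion by blast
    with False \<open>r = \<infinity>\<close> show ?thesis by (simp add: Lp_def esssup_non_measurable)
  qed
next
  case False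
  have "(\<integral>\<^sup>+t. epowr (f t) (enn2real r) \<partial>completion M) = (\<integral>\<^sup>+t. epowr (g t) (enn2real r) \<partial>completion M)"
    using assms by (intro nn_integral_cong_AE) auto
  with False show ?thesis by (simp add: Lp_def)
qed

lemma Lp_completion:
  assumes "f \<in> borel_measurable M"
  shows "Lp (completion M) r f = Lp M r f"
  using assms by (simp add: Lp_def nn_integral_completion esssup_eq_AE measurable_completion AE_completion_iff)

lemma Lp_count_space_top: "Lp (count_space UNIV) \<infinity> f = (SUP k. f k)"
  unfolding Lp_top
proof (rule antisym)
  show "esssup (count_space UNIV) f \<le> (SUP k. f k)"
    by (intro esssup_I) (auto intro: SUP_upper)
  show "(SUP k. f k) \<le> esssup (count_space UNIV) f"
    using esssup_AE[of f "count_space UNIV"] by (auto intro!: SUP_least simp: AE_count_space)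
qed

text \<open>
  The factor may be infinite. This matters when it is the value of another function at a fixed
  point of the remaining coordinates.
\<close>

lemma Lp_cmult_le:
  assumes r: "1 \<le> r" and [measurable]: "f \<in> borel_measurable M"
  shows "Lp M r (\<lambda>t. c * f t) \<le> c * Lp M r f"
  using r
proof (cases rule: ge_1_cases)
  case 1
  have "AE t in M. c * f t \<le> c * esssup M f"
    using esssup_AE[of f M] by (auto elim!: eventually_mono intro: mult_left_mono)
  then show ?thesis unfolding 1 Lp_top by (intro esssup_I) auto
next
  case (2 a)
  then show ?thesis
    by (simp add: Lp_ennreal epowr_mult nn_integral_cmult epowr_inverse)
qed

lemma Lp_monotone_convergence:
  assumes r: "1 \<le> r" and [measurable]: "\<And>n. f n \<in> borel_measurable M" and inc: "incseq f"
  shows "Lp M r (\<lambda>t. SUP n. f n t) = (SUP n. Lp M r (f n))"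
proof (rule antisym)
  show "Lp M r (\<lambda>t. SUP n. f n t) \<le> (SUP n. Lp M r (f n))"
    using r
  proof (cases rule: ge_1_cases)
    case 1
    have "AE t in M. \<forall>n. f n t \<le> esssup M (f n)"
      by (subst AE_all_countable) (auto intro: esssup_AE)
    then have "AE t in M. (SUP n. f n t) \<le> (SUP n. esssup M (f n))"
      by (auto elim!: eventually_mono intro!: SUP_mono)
    then show ?thesis unfolding 1 Lp_top by (intro esssup_I) auto
  next
    case (2 a)
    then have "incseq (\<lambda>n t. epowr (f n t) a)"
      using inc by (auto simp: incseq_def le_fun_def intro!: epowr_mono)
    then show ?thesis using 2
      by (simp add: Lp_ennreal epowr_SUP nn_integral_monotone_convergence_SUP)
  qed
  show "(SUP n. Lp M r (f n)) \<le> Lp M r (\<lambda>t. SUP n. f n t)"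
    by (intro SUP_least Lp_mono r) (auto intro: SUP_upper)
qed

lemma Lp_decreasing_to_0:
  assumes r: "1 \<le> r" "r < \<infinity>" and [measurable]: "\<And>n. f n \<in> borel_measurable M"
    and dec: "decseq f" and fin: "Lp M r (f 0) < \<infinity>"
    and lim: "\<And>t. f 0 t < \<infinity> \<Longrightarrow> (INF n. f n t) = 0"
  shows "(INF n. Lp M r (f n)) = 0"
proof -
  obtain a where a: "r = ennreal a" "1 \<le> a" using r by (auto elim: ge_1_cases)
  have fin': "(\<integral>\<^sup>+t. epowr (f 0 t) a \<partial>M) < \<infinity>"
    using fin a by (simp add: Lp_ennreal less_top[symmetric])
  then have "AE t in M. epowr (f 0 t) a \<noteq> \<infinity>"
    by (intro nn_integral_PInf_AE) auto
  then have 0: "AE t in M. (INF n. epowr (f n t) a) = 0"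
    using lim a by (auto elim!: eventually_mono simp: epowr_INF[symmetric] less_top)
  have "(INF n. \<integral>\<^sup>+t. epowr (f n t) a \<partial>M) = (\<integral>\<^sup>+t. (INF n. epowr (f n t) a) \<partial>M)"
    using dec a fin' by (intro nn_integral_monotone_convergence_INF_decseq[symmetric, where i=0])
      (auto simp: monotone_def le_fun_def intro!: epowr_mono)
  also have "\<dots> = 0"
    using 0 by (subst nn_integral_0_iff_AE) auto
  finally show ?thesis
    using a by (simp add: Lp_ennreal epowr_INF[symmetric])
qed

section \<open>Hoelder's inequality and its sharpness\<close>

lemma mult_inverse_cancel_ennreal:
  fixes x :: ennreal
  assumes "x \<noteq> 0" "x \<noteq> top"
  shows "x * inverse x = 1" "inverse x * x = 1"
proof -
  show "x * inverse x = 1"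
    using assms by (cases x) (auto simp: inverse_ennreal ennreal_mult[symmetric] less_le)
  then show "inverse x * x = 1" by (simp add: mult.commute)
qed

lemma inverse_mult_le_1_ennreal: "inverse x * x \<le> 1" for x :: ennreal
  by (cases "x = 0 \<or> x = top") (auto simp: mult_inverse_cancel_ennreal)

lemma epowr_inverse_mult_le_1:
  assumes "0 < a" "n \<noteq> top"
  shows "epowr (inverse (epowr n (1 / a))) a * n \<le> 1"
proof (cases "n = 0")
  case False
  have "epowr (inverse (epowr n (1 / a))) a * n = epowr (inverse (epowr n (1 / a)) * epowr n (1 / a)) a"
    using assms by (simp add: epowr_mult epowr_inverse)
  also have "\<dots> = 1" using assms False by (simp add: mult_inverse_cancel_ennreal)
  finally show ?thesis by simp
qed simp

lemma epowr_conjugate: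
  assumes "1 / a + 1 / b = 1" "n \<noteq> top"
  shows "epowr n (1 / b) = inverse (epowr n (1 / a)) * n"
proof (cases "n = 0")
  case False
  have "epowr n (1 / a) * epowr n (1 / b) = n"
    using assms by (simp add: epowr_add)
  then have "inverse (epowr n (1 / a)) * n = (inverse (epowr n (1 / a)) * epowr n (1 / a)) * epowr n (1 / b)"
    by (simp add: mult.assoc)
  then show ?thesis using assms False by (simp add: mult_inverse_cancel_ennreal)
qed simp

lemma Young_ennreal:
  assumes ab: "1 < a" "1 < b" "1 / a + 1 / b = 1"
  shows "x * y \<le> ennreal (1 / a) * epowr x a + ennreal (1 / b) * epowr y b"
proof (cases "x = top \<or> y = top")
  case True
  then show ?thesis using ab by (auto simp: ennreal_mult_top)
next
  case False
  then obtain u v where "x = ennreal u" "y = ennreal v" "0 \<le> u" "0 \<le> v"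
    by (metis ennreal_cases)
  with Youngs_inequality[OF ab, of u v] ab show ?thesis
    by (simp add: ennreal_mult[symmetric] ennreal_plus[symmetric] del: ennreal_plus)
qed

lemma Lp_Holder:
  assumes "conjugate r s" and [measurable]: "f \<in> borel_measurable M" "g \<in> borel_measurable M"
  shows "(\<integral>\<^sup>+t. f t * g t \<partial>M) \<le> Lp M r f * Lp M s g"
  using assms(1)
proof (cases rule: conjugate_cases)
  case 1
  have "AE t in M. f t * g t \<le> f t * esssup M g"
    using esssup_AE[of g M] by (auto elim!: eventually_mono intro: mult_left_mono)
  then have "(\<integral>\<^sup>+t. f t * g t \<partial>M) \<le> (\<integral>\<^sup>+t. f t * esssup M g \<partial>M)"
    by (rule nn_integral_mono_AE)
  then show ?thesis by (simp add: 1 Lp_1 Lp_top nn_integral_multc)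
next
  case 2
  have "AE t in M. f t * g t \<le> esssup M f * g t"
    using esssup_AE[of f M] by (auto elim!: eventually_mono intro: mult_right_mono)
  then have "(\<integral>\<^sup>+t. f t * g t \<partial>M) \<le> (\<integral>\<^sup>+t. esssup M f * g t \<partial>M)"
    by (rule nn_integral_mono_AE)
  then show ?thesis by (simp add: 2 Lp_1 Lp_top nn_integral_cmult)
next
  case (3 a b)
  note ab = \<open>1 < a\<close> \<open>1 < b\<close> \<open>1 / a + 1 / b = 1\<close>
  let ?A = "\<integral>\<^sup>+t. epowr (f t) a \<partial>M" and ?B = "\<integral>\<^sup>+t. epowr (g t) b \<partial>M"
  let ?u = "epowr ?A (1 / a)" and ?v = "epowr ?B (1 / b)"
  have uv: "Lp M r f = ?u" "Lp M s g = ?v" using 3 by (simp_all add: Lp_ennreal)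
  consider "?A = 0 \<or> ?B = 0" | "?A \<noteq> 0" "?B \<noteq> 0" "?A = top \<or> ?B = top"
    | "?A \<noteq> 0" "?A \<noteq> top" "?B \<noteq> 0" "?B \<noteq> top" by blast
  then show ?thesis
  proof cases
    case 1
    then have "(AE t in M. f t = 0) \<or> (AE t in M. g t = 0)"
      by (simp add: nn_integral_0_iff_AE)
    then have "AE t in M. f t * g t = 0" by (auto elim: eventually_mono)
    then have "(\<integral>\<^sup>+t. f t * g t \<partial>M) = 0" by (subst nn_integral_0_iff_AE) auto
    then show ?thesis by simp
  next
    case 2
    then have "?u * ?v = top" by (auto simp: ennreal_mult_eq_top_iff)
    then show ?thesis by (simp add: uv)
  next
    case 3
    then have fin: "?u \<noteq> 0" "?u \<noteq> top" "?v \<noteq> 0" "?v \<noteq> top" by auto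
    have normalised: "(\<integral>\<^sup>+t. epowr (inverse U * k t) c \<partial>M) = 1"
      if "U = epowr (\<integral>\<^sup>+t. epowr (k t) c \<partial>M) (1 / c)" "U \<noteq> 0" "U \<noteq> top" "1 < c"
        and [measurable]: "k \<in> borel_measurable M" for U c k
    proof -
      have "(\<integral>\<^sup>+t. epowr (inverse U * k t) c \<partial>M) = epowr (inverse U) c * epowr U c"
        using that(1,4) by (simp add: epowr_mult nn_integral_cmult epowr_inverse)
      also have "\<dots> = 1"
        using that(2-4) by (simp add: epowr_mult[symmetric] mult_inverse_cancel_ennreal)
      finally show ?thesis .
    qed
    have norm: "(\<integral>\<^sup>+t. epowr (inverse ?u * f t) a \<partial>M) = 1" "(\<integral>\<^sup>+t. epowr (inverse ?v * g t) b \<partial>M) = 1"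
      using fin ab by (intro normalised; simp)+
    have canc: "?u * inverse ?u = 1" "?v * inverse ?v = 1"
      using fin by (simp_all add: mult_inverse_cancel_ennreal)
    have "(\<integral>\<^sup>+t. f t * g t \<partial>M) = (\<integral>\<^sup>+t. (?u * ?v) * ((inverse ?u * f t) * (inverse ?v * g t)) \<partial>M)"
    proof (intro nn_integral_cong)
      fix t
      have "(?u * ?v) * ((inverse ?u * f t) * (inverse ?v * g t)) =
          (?u * inverse ?u) * (?v * inverse ?v) * (f t * g t)"
        by (simp only: ac_simps)
      then show "f t * g t = (?u * ?v) * ((inverse ?u * f t) * (inverse ?v * g t))"
        by (simp only: canc) simp
    qed
    also have "\<dots> = (?u * ?v) * (\<integral>\<^sup>+t. (inverse ?u * f t) * (inverse ?v * g t) \<partial>M)"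
      by (subst nn_integral_cmult) auto
    also have "\<dots> \<le> (?u * ?v) * (\<integral>\<^sup>+t. ennreal (1 / a) * epowr (inverse ?u * f t) a
                                  + ennreal (1 / b) * epowr (inverse ?v * g t) b \<partial>M)"
      by (intro mult_left_mono nn_integral_mono Young_ennreal ab) simp
    also have "\<dots> = (?u * ?v) * (ennreal (1 / a) + ennreal (1 / b))"
      by (subst nn_integral_add) (auto simp: nn_integral_cmult norm)
    also have "ennreal (1 / a) + ennreal (1 / b) = 1"
      using ab by (simp flip: ennreal_plus)
    finally show ?thesis by (simp add: uv)
  qed
qed

text \<open>
  Suprema pass through norms only along increasing sequences. To obtain one, \<open>F' m (x, _)\<close> is chosen
  among \<open>F 0 (x, _)\<close>, ..., \<open>F m (x, _)\<close> so as to make the pairing with \<open>G\<close> largest; deciding this takes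
  finitely many comparisons of measurable functions of \<open>x\<close>.
\<close>

lemma running_maximum_extremizers:
  fixes F :: "nat \<Rightarrow> 'n \<times> 'm \<Rightarrow> ennreal" and G :: "'n \<times> 'm \<Rightarrow> ennreal"
  assumes M: "sigma_finite_measure M"
    and F [measurable]: "\<And>m. F m \<in> borel_measurable (N \<Otimes>\<^sub>M M)"
    and G [measurable]: "G \<in> borel_measurable (N \<Otimes>\<^sub>M M)"
  obtains F' :: "nat \<Rightarrow> 'n \<times> 'm \<Rightarrow> ennreal"
  where "\<And>m. F' m \<in> borel_measurable (N \<Otimes>\<^sub>M M)"
    and "\<And>m x. \<exists>j. (\<lambda>t. F' m (x, t)) = (\<lambda>t. F j (x, t))"
    and "\<And>x. incseq (\<lambda>m. \<integral>\<^sup>+t. F' m (x, t) * G (x, t) \<partial>M)"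
    and "\<And>x. (SUP m. \<integral>\<^sup>+t. F' m (x, t) * G (x, t) \<partial>M) = (SUP m. \<integral>\<^sup>+t. F m (x, t) * G (x, t) \<partial>M)"
proof -
  interpret sigma_finite_measure M by (rule M)
  let ?J = "\<lambda>f x. \<integral>\<^sup>+t. f (x, t) * G (x, t) \<partial>M"
  define F' where "F' = rec_nat (F 0) (\<lambda>m f y. if ?J f (fst y) < ?J (F (Suc m)) (fst y) then F (Suc m) y else f y)"
  have F'0: "F' 0 = F 0" by (simp add: F'_def)
  have F'S: "F' (Suc m) = (\<lambda>y. if ?J (F' m) (fst y) < ?J (F (Suc m)) (fst y) then F (Suc m) y else F' m y)" for m
    unfolding F'_def by simp
  have [measurable]: "F' m \<in> borel_measurable (N \<Otimes>\<^sub>M M)" for m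
    by (induction m) (simp_all add: F'0 F'S)
  have ex: "\<exists>j. (\<lambda>t. F' m (x, t)) = (\<lambda>t. F j (x, t))" for m x
  proof (induction m)
    case 0 then show ?case by (auto simp: F'0)
  next
    case (Suc m)
    show ?case
    proof (cases "?J (F' m) x < ?J (F (Suc m)) x")
      case True then show ?thesis by (intro exI[of _ "Suc m"]) (simp add: F'S)
    next
      case False then show ?thesis using Suc by (simp add: F'S)
    qed
  qed
  have J: "?J (F' (Suc m)) x = max (?J (F' m) x) (?J (F (Suc m)) x)" for m x
    by (cases "?J (F' m) x < ?J (F (Suc m)) x") (auto simp: F'S max_def)
  show thesis
  proof (rule that[of F'])
    show "incseq (\<lambda>m. ?J (F' m) x)" for x
      by (rule incseq_SucI) (simp only: J max.cobounded1)
    show "(SUP m. ?J (F' m) x) = (SUP m. ?J (F m) x)" for x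
    proof (rule antisym)
      show "(SUP m. ?J (F' m) x) \<le> (SUP m. ?J (F m) x)"
      proof (rule SUP_least)
        fix m
        obtain j where j: "(\<lambda>t. F' m (x, t)) = (\<lambda>t. F j (x, t))" using ex by blast
        have "?J (F' m) x = ?J (F j) x" using fun_cong[OF j] by simp
        then show "?J (F' m) x \<le> (SUP m. ?J (F m) x)" by (simp only:) (rule SUP_upper, simp)
      qed
      show "(SUP m. ?J (F m) x) \<le> (SUP m. ?J (F' m) x)"
      proof (rule SUP_mono)
        fix m
        have "?J (F m) x \<le> ?J (F' m) x" by (cases m) (simp_all only: J F'0 max.cobounded2 order_refl)
        then show "\<exists>k\<in>UNIV. ?J (F m) x \<le> ?J (F' k) x" by blast
      qed
    qed
  qed (use ex in auto)
qed

text \<open>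
  The converse of Hoelder's inequality, with measurable dependence on a parameter. A sequence is
  needed because the norm may be infinite, and because for \<open>s = \<infinity>\<close> it need not be attained.
\<close>

lemma Lp_extremizers:
  fixes G :: "'n \<times> 'm \<Rightarrow> ennreal"
  assumes M: "sigma_finite_measure M" and rs: "conjugate r s"
    and G [measurable]: "G \<in> borel_measurable (N \<Otimes>\<^sub>M M)"
  obtains F :: "nat \<Rightarrow> 'n \<times> 'm \<Rightarrow> ennreal"
  where "\<And>m. F m \<in> borel_measurable (N \<Otimes>\<^sub>M M)"
    and "\<And>m x. x \<in> space N \<Longrightarrow> Lp M r (\<lambda>t. F m (x, t)) \<le> 1"
    and "\<And>x. incseq (\<lambda>m. \<integral>\<^sup>+t. F m (x, t) * G (x, t) \<partial>M)"
    and "\<And>x. x \<in> space N \<Longrightarrow>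
      (SUP m. \<integral>\<^sup>+t. F m (x, t) * G (x, t) \<partial>M) = Lp M s (\<lambda>t. G (x, t))"
proof -
  interpret sigma_finite_measure M by (rule M)
  \<comment> \<open>Monotonicity can be arranged afterwards, and one half of the last clause is Hoelder's inequality.\<close>
  note witness = that
  have main: thesis
    if E: "\<And>m. E m \<in> borel_measurable (N \<Otimes>\<^sub>M M)"
      and le1: "\<And>m x. x \<in> space N \<Longrightarrow> Lp M r (\<lambda>t. E m (x, t)) \<le> 1"
      and ge: "\<And>x. x \<in> space N \<Longrightarrow>
        Lp M s (\<lambda>t. G (x, t)) \<le> (SUP m. \<integral>\<^sup>+t. E m (x, t) * G (x, t) \<partial>M)"
    for E :: "nat \<Rightarrow> 'n \<times> 'm \<Rightarrow> ennreal"
  proof (rule running_maximum_extremizers[OF M E G])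
    fix F :: "nat \<Rightarrow> 'n \<times> 'm \<Rightarrow> ennreal"
    assume F [measurable]: "\<And>m. F m \<in> borel_measurable (N \<Otimes>\<^sub>M M)"
      and F_E: "\<And>m x. \<exists>j. (\<lambda>t. F m (x, t)) = (\<lambda>t. E j (x, t))"
      and inc: "\<And>x. incseq (\<lambda>m. \<integral>\<^sup>+t. F m (x, t) * G (x, t) \<partial>M)"
      and SUP: "\<And>x. (SUP m. \<integral>\<^sup>+t. F m (x, t) * G (x, t) \<partial>M) = (SUP m. \<integral>\<^sup>+t. E m (x, t) * G (x, t) \<partial>M)"
    have F_le: "Lp M r (\<lambda>t. F m (x, t)) \<le> 1" if "x \<in> space N" for m x
      using F_E[of m x] le1[OF that] by auto
    show thesis
    proof (rule witness[of F, OF F F_le inc])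
      fix x assume x: "x \<in> space N"
      have "(\<integral>\<^sup>+t. F m (x, t) * G (x, t) \<partial>M) \<le> Lp M s (\<lambda>t. G (x, t))" for m
      proof -
        have "(\<integral>\<^sup>+t. F m (x, t) * G (x, t) \<partial>M) \<le> Lp M r (\<lambda>t. F m (x, t)) * Lp M s (\<lambda>t. G (x, t))"
          using x by (intro Lp_Holder rs) auto
        also have "\<dots> \<le> 1 * Lp M s (\<lambda>t. G (x, t))"
          by (intro mult_right_mono F_le x) auto
        finally show ?thesis by simp
      qed
      then show "(SUP m. \<integral>\<^sup>+t. F m (x, t) * G (x, t) \<partial>M) = Lp M s (\<lambda>t. G (x, t))"
        using ge[OF x] by (intro antisym SUP_least) (simp_all only: SUP)
    qed
  qed
  obtain A :: "nat \<Rightarrow> 'm set" where A: "range A \<subseteq> sets M" "(\<Union>i. A i) = space M"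
    "\<And>i. emeasure M (A i) \<noteq> \<infinity>" "incseq A"
    using sigma_finite_incseq by metis
  have [measurable]: "A i \<in> sets M" for i using A by auto
  from rs show thesis
  proof (cases rule: conjugate_cases)
    case 2
    show thesis
    proof (rule main[where E = "\<lambda>_ _. 1"])
      show "Lp M r (\<lambda>t. 1) \<le> 1" unfolding 2 Lp_top by (intro esssup_I) auto
      show "Lp M s (\<lambda>t. G (x, t)) \<le> (SUP m. \<integral>\<^sup>+t. 1 * G (x, t) \<partial>M)" for x
        by (simp add: 2 Lp_1)
    qed auto
  next
    case 1
    \<comment> \<open>Normalised indicators of the sets where \<open>G\<close> exceeds a rational level, cut down to
      finite measure. If such a set is null, the factor \<open>\<infinity>\<close> does no harm.\<close>
    define S where "S = (\<lambda>j (c::rat) x. {t \<in> A j. G (x, t) > ennreal (of_rat c)})"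
    have S_eq: "S j c x = Pair x -` {y \<in> space (N \<Otimes>\<^sub>M M). snd y \<in> A j \<and> G y > ennreal (of_rat c)}"
      if "x \<in> space N" for j c x
      using that A(1) sets.sets_into_space[of "A j" M] by (auto simp: S_def space_pair_measure)
    have S_meas: "S j c x \<in> sets M" if "x \<in> space N" for j c x
      unfolding S_eq[OF that] by (intro sets_Pair1) measurable
    have mS [measurable]: "(\<lambda>x. emeasure M (S j c x)) \<in> borel_measurable N" for j c
    proof -
      have "(\<lambda>x. emeasure M (Pair x -` {y \<in> space (N \<Otimes>\<^sub>M M). snd y \<in> A j \<and> G y > ennreal (of_rat c)}))
          \<in> borel_measurable N"
        by (intro measurable_emeasure_Pair) measurable
      then show ?thesis by (rule measurable_cong[THEN iffD1, rotated]) (simp add: S_eq)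
    qed
    define F where "F = (\<lambda>m y. case from_nat m of (j, c) \<Rightarrow>
      (if snd y \<in> A j \<and> G y > ennreal (of_rat c) then 1 else 0) * inverse (emeasure M (S j c (fst y))))"
    have F_eq: "F (to_nat (j, c)) (x, t) = inverse (emeasure M (S j c x)) * indicator (S j c x) t" for j c x t
      by (auto simp: F_def S_def mult.commute)
    have F_ex: "\<exists>(j::nat) (c::rat). F m = F (to_nat (j, c))" for m
    proof -
      obtain j :: nat and c :: rat where "from_nat m = (j, c)" by fastforce
      then have "F m = F (to_nat (j, c))" by (simp add: F_def)
      then show ?thesis by blast
    qed
    show thesis
    proof (rule main[where E = F])
      show "F m \<in> borel_measurable (N \<Otimes>\<^sub>M M)" for m
        unfolding F_def by (cases "from_nat m :: nat \<times> rat") auto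
      show "Lp M r (\<lambda>t. F m (x, t)) \<le> 1" if x: "x \<in> space N" for m x
      proof -
        obtain j :: nat and c :: rat where F: "F m = F (to_nat (j, c))" using F_ex by blast
        have "Lp M r (\<lambda>t. F m (x, t)) = inverse (emeasure M (S j c x)) * emeasure M (S j c x)"
          using S_meas[OF x, of j c] by (simp add: 1 Lp_1 F F_eq nn_integral_cmult)
        also have "\<dots> \<le> 1"
          by (rule inverse_mult_le_1_ennreal)
        finally show ?thesis .
      qed
      show "Lp M s (\<lambda>t. G (x, t)) \<le> (SUP m. \<integral>\<^sup>+t. F m (x, t) * G (x, t) \<partial>M)" if x: "x \<in> space N" for x
      proof (rule dense_le)
        fix y assume y: "y < Lp M s (\<lambda>t. G (x, t))"
        then obtain c :: rat where c: "y \<le> ennreal (of_rat c)" "ennreal (of_rat c) < Lp M s (\<lambda>t. G (x, t))"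
          by (metis ennreal_rat_dense less_imp_le)
        have [measurable]: "(\<lambda>t. G (x, t)) \<in> borel_measurable M" using x by auto
        have "emeasure M {t \<in> space M. ennreal (of_rat c) < G (x, t)} > 0"
          using c(2) unfolding 1 Lp_top by (intro esssup_pos_measure) auto
        moreover have "{t \<in> space M. ennreal (of_rat c) < G (x, t)} = (\<Union>j. S j c x)"
          using A(2) by (auto simp: S_def)
        moreover have "emeasure M (\<Union>j. S j c x) = 0" if "\<And>j. emeasure M (S j c x) = 0"
          using that S_meas[OF x] by (intro emeasure_UN_eq_0) auto
        ultimately obtain j where j: "emeasure M (S j c x) \<noteq> 0" by fastforce
        have "emeasure M (S j c x) \<le> emeasure M (A j)"
          by (intro emeasure_mono) (auto simp: S_def)
        then have fin: "emeasure M (S j c x) \<noteq> top"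
          using A(3)[of j] by (auto simp: top_unique)
        have "ennreal (of_rat c) = ennreal (of_rat c) * (emeasure M (S j c x) * inverse (emeasure M (S j c x)))"
          using j fin by (simp add: mult_inverse_cancel_ennreal)
        also have "\<dots> = (\<integral>\<^sup>+t. inverse (emeasure M (S j c x)) * ennreal (of_rat c) * indicator (S j c x) t \<partial>M)"
          by (subst nn_integral_cmult_indicator[OF S_meas[OF x, of j c]]) (simp only: ac_simps)
        also have "\<dots> \<le> (\<integral>\<^sup>+t. F (to_nat (j, c)) (x, t) * G (x, t) \<partial>M)"
          by (intro nn_integral_mono)
            (auto simp: F_eq S_def indicator_def intro!: mult_left_mono)
        also have "\<dots> \<le> (SUP m. \<integral>\<^sup>+t. F m (x, t) * G (x, t) \<partial>M)"
          by (rule SUP_upper) auto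
        finally show "y \<le> (SUP m. \<integral>\<^sup>+t. F m (x, t) * G (x, t) \<partial>M)" using c(1) by simp
      qed
    qed
  next
    case (3 a b)
    \<comment> \<open>The equality case of Hoelder's inequality for the truncation \<open>H m\<close> of \<open>G\<close>, whose norm is finite.\<close>
    have ba: "(b - 1) * a = b" "1 - 1 / a = 1 / b" using 3 by (auto simp: field_simps)
    define H where "H = (\<lambda>m y. inf (G y) (of_nat m * indicator (A m) (snd y)))"
    have [measurable]: "H m \<in> borel_measurable (N \<Otimes>\<^sub>M M)" for m unfolding H_def by measurable
    define n where "n = (\<lambda>m x. \<integral>\<^sup>+t. epowr (H m (x, t)) b \<partial>M)"
    have [measurable]: "n m \<in> borel_measurable N" for m unfolding n_def by measurable
    have n_fin: "n m x \<noteq> top" for m x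
    proof -
      have "n m x \<le> (\<integral>\<^sup>+t. epowr (of_nat m) b * indicator (A m) t \<partial>M)"
        unfolding n_def using 3
        by (intro nn_integral_mono) (auto simp: H_def indicator_def inf_absorb2 intro!: epowr_mono)
      also have "\<dots> = epowr (of_nat m) b * emeasure M (A m)" by (simp add: nn_integral_cmult)
      also have "\<dots> < top" using A(3)[of m] by (auto simp: ennreal_mult_less_top less_top of_nat_less_top)
      finally show ?thesis by simp
    qed
    define F where "F = (\<lambda>m y. inverse (epowr (n m (fst y)) (1 / a)) * epowr (H m y) (b - 1))"
    have SUP_H: "(SUP m. H m (x, t)) = G (x, t)" if t: "t \<in> space M" for x t
    proof -
      obtain j where j: "t \<in> A j" using A(2) t by auto
      have "(of_nat m :: ennreal) \<le> (SUP m. of_nat m * indicator (A m) t)" for m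
      proof (rule SUP_upper2)
        have "t \<in> A (max m j)" using j A(4) by (meson incseq_def max.cobounded2 subsetD)
        then show "(of_nat m :: ennreal) \<le> of_nat (max m j) * indicator (A (max m j)) t" by simp
      qed simp
      then have "(SUP m. of_nat m) \<le> (SUP m. of_nat m * indicator (A m) t :: ennreal)" by (intro SUP_least)
      then have "(SUP m. of_nat m * indicator (A m) t) = (top :: ennreal)"
        by (simp add: ennreal_SUP_of_nat_eq_top top_unique)
      then have "inf (G (x, t)) (SUP m. of_nat m * indicator (A m) t) = G (x, t)"
        by (simp only: inf_top_right)
      then show ?thesis by (simp only: H_def snd_conv inf_SUP)
    qed
    have inc_H: "incseq (\<lambda>m t. H m (x, t))" for x
    proof -
      have "(of_nat m :: ennreal) * indicator (A m) t \<le> of_nat k * indicator (A k) t"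
        if "m \<le> k" for m k t
        using that A(4) by (intro mult_mono indicator_leI) (auto simp: incseq_def)
      then show ?thesis
        unfolding H_def incseq_def le_fun_def snd_conv by (intro allI impI inf_mono order_refl) auto
    qed
    show thesis
    proof (rule main[where E = F])
      show "F m \<in> borel_measurable (N \<Otimes>\<^sub>M M)" for m
        unfolding F_def by measurable
      show "Lp M r (\<lambda>t. F m (x, t)) \<le> 1" if x: "x \<in> space N" for m x
      proof -
        have "(\<integral>\<^sup>+t. epowr (F m (x, t)) a \<partial>M) = epowr (inverse (epowr (n m x) (1 / a))) a * n m x"
          using 3 x by (simp add: F_def epowr_mult epowr_epowr ba nn_integral_cmult n_def)
        also have "\<dots> \<le> 1"
          using n_fin[of m x] 3 by (intro epowr_inverse_mult_le_1) auto
        finally have "epowr (\<integral>\<^sup>+t. epowr (F m (x, t)) a \<partial>M) (1 / a) \<le> epowr 1 (1 / a)"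
          using 3 by (intro epowr_mono) auto
        then show ?thesis using 3 by (simp add: Lp_ennreal)
      qed
      show "Lp M s (\<lambda>t. G (x, t)) \<le> (SUP m. \<integral>\<^sup>+t. F m (x, t) * G (x, t) \<partial>M)" if x: "x \<in> space N" for x
      proof -
        have "Lp M s (\<lambda>t. H m (x, t)) \<le> (\<integral>\<^sup>+t. F m (x, t) * G (x, t) \<partial>M)" for m
        proof -
          have "Lp M s (\<lambda>t. H m (x, t)) = epowr (n m x) (1 / b)"
            using 3 by (simp add: Lp_ennreal n_def)
          also have "\<dots> = inverse (epowr (n m x) (1 / a)) * n m x"
            using n_fin[of m x] 3 by (intro epowr_conjugate) auto
          also have "\<dots> = (\<integral>\<^sup>+t. inverse (epowr (n m x) (1 / a)) * epowr (H m (x, t)) b \<partial>M)"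
            using x by (simp add: nn_integral_cmult n_def)
          also have "\<dots> = (\<integral>\<^sup>+t. F m (x, t) * H m (x, t) \<partial>M)"
            using epowr_add[of _ "b - 1" 1] by (simp add: F_def mult.assoc)
          also have "\<dots> \<le> (\<integral>\<^sup>+t. F m (x, t) * G (x, t) \<partial>M)"
            by (intro nn_integral_mono mult_left_mono) (auto simp: H_def)
          finally show ?thesis .
        qed
        moreover have "Lp M s (\<lambda>t. G (x, t)) = Lp M s (\<lambda>t. SUP m. H m (x, t))"
          using SUP_H by (intro antisym Lp_mono conjugate_ge_1[OF conjugate_sym[OF rs]]) (use x in auto)
        moreover have "\<dots> = (SUP m. Lp M s (\<lambda>t. H m (x, t)))"
          using x inc_H by (intro Lp_monotone_convergence conjugate_ge_1[OF conjugate_sym[OF rs]]) auto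
        ultimately show ?thesis by (auto intro!: SUP_mono)
      qed
    qed
  qed
qed

text \<open>
  For the essential supremum this is a byproduct of duality, which writes it as a countable
  supremum of integrals.
\<close>

lemma Lp_measurable [measurable (raw)]:
  fixes G :: "'n \<Rightarrow> 'm \<Rightarrow> ennreal"
  assumes M: "sigma_finite_measure M"
    and G [measurable]: "case_prod G \<in> borel_measurable (N \<Otimes>\<^sub>M M)"
    and s: "1 \<le> s"
  shows "(\<lambda>x. Lp M s (G x)) \<in> borel_measurable N"
proof -
  interpret sigma_finite_measure M by (rule M)
  show ?thesis
    using s
  proof (cases rule: ge_1_cases)
    case 1
    have "conjugate 1 s" by (simp add: conjugate_def 1)
    then obtain F :: "nat \<Rightarrow> 'n \<times> 'm \<Rightarrow> ennreal"
      where F [measurable]: "\<And>m. F m \<in> borel_measurable (N \<Otimes>\<^sub>M M)"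
        and eq: "\<And>x. x \<in> space N \<Longrightarrow>
          (SUP m. \<integral>\<^sup>+t. F m (x, t) * G x t \<partial>M) = Lp M s (G x)"
      by (rule Lp_extremizers[OF M _ G]) auto
    have "(\<lambda>x. SUP m. \<integral>\<^sup>+t. F m (x, t) * G x t \<partial>M) \<in> borel_measurable N"
      by measurable
    then show ?thesis by (rule measurable_cong[THEN iffD1, rotated]) (simp add: eq)
  next
    case (2 a)
    then show ?thesis by (simp add: Lp_ennreal)
  qed
qed

section \<open>The one-dimensional Herz norm as a norm of norms\<close>

definition shell_weight :: "real \<Rightarrow> int \<Rightarrow> ennreal" where
  "shell_weight a k = ennreal (2 powr (of_int k * a))"

text \<open>
  Both layers being Lebesgue norms, the properties of this norm are obtained by applying those of
  \<open>Lp\<close> twice.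
\<close>

definition herz :: "real \<Rightarrow> ennreal \<Rightarrow> ennreal \<Rightarrow> (real \<Rightarrow> ennreal) \<Rightarrow> ennreal" where
  "herz a p q h = Lp (count_space UNIV) p
     (\<lambda>k. shell_weight a k * Lp lborel q (\<lambda>t. h t * indicator (dyadic_shell k) t))"

lemma shell_weight_cancel: "shell_weight a k * shell_weight (- a) k = 1"
  by (simp add: shell_weight_def ennreal_mult[symmetric] powr_add[symmetric])

lemma mem_dyadic_shell: "t \<in> dyadic_shell k \<longleftrightarrow> 2 powi (k - 1) \<le> \<bar>t\<bar> \<and> \<bar>t\<bar> < 2 powi k"
  by (auto simp: dyadic_shell_def)

text \<open>
  This form displays measurability jointly in \<open>k\<close> and \<open>t\<close>.
\<close>

lemma indicator_dyadic_shell: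
  "(indicator (dyadic_shell k) t :: ennreal) = (if 2 powi (k - 1) \<le> \<bar>t\<bar> \<and> \<bar>t\<bar> < 2 powi k then 1 else 0)"
  by (simp add: mem_dyadic_shell indicator_def)

lemma dyadic_shell_borel [measurable]: "dyadic_shell k \<in> sets borel"
  unfolding dyadic_shell_def by measurable

lemma dyadic_shell_unique:
  assumes "t \<in> dyadic_shell k" "t \<in> dyadic_shell l" shows "k = l"
proof -
  have "k \<le> l" if "t \<in> dyadic_shell k" "t \<in> dyadic_shell l" for k l
  proof (rule ccontr)
    assume "\<not> k \<le> l"
    then have "(2::real) powi l \<le> 2 powi (k - 1)" by (intro power_int_increasing) auto
    then show False using that by (auto simp: mem_dyadic_shell)
  qed
  then show ?thesis using assms by (intro antisym) blast+
qed

lemma dyadic_shell_exists: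
  assumes "t \<noteq> 0" shows "\<exists>k. t \<in> dyadic_shell k"
proof -
  define k where "k = \<lfloor>log 2 \<bar>t\<bar>\<rfloor> + 1"
  have "2 powr (real_of_int (k - 1)) \<le> 2 powr (log 2 \<bar>t\<bar>)" "2 powr (log 2 \<bar>t\<bar>) < 2 powr (of_int k)"
    unfolding k_def by (auto intro: powr_mono powr_less_mono)
  then have "t \<in> dyadic_shell k"
    using assms by (simp add: mem_dyadic_shell powr_real_of_int' del: of_int_diff)
  then show ?thesis ..
qed

lemma nn_integral_dyadic_shell:
  assumes "t \<in> dyadic_shell k"
  shows "(\<integral>\<^sup>+l. indicator (dyadic_shell l) t * f l \<partial>count_space UNIV) = f k"
proof -
  have "(\<integral>\<^sup>+l. indicator (dyadic_shell l) t * f l \<partial>count_space UNIV)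
      = (\<integral>\<^sup>+l. f k * indicator {k} l \<partial>count_space UNIV)"
    using assms dyadic_shell_unique by (intro nn_integral_cong) (auto simp: indicator_def)
  then show ?thesis by simp
qed

lemma nn_integral_eq_sum_shells:
  assumes [measurable]: "h \<in> borel_measurable borel"
  shows "(\<integral>\<^sup>+t. h t \<partial>lborel) = (\<integral>\<^sup>+k. \<integral>\<^sup>+t. h t * indicator (dyadic_shell k) t \<partial>lborel \<partial>count_space UNIV)"
proof -
  interpret count: sigma_finite_measure "count_space (UNIV :: int set)"
    by (rule sigma_finite_measure_count_space)
  interpret pair_sigma_finite "count_space (UNIV :: int set)" "lborel :: real measure" ..
  have "(\<integral>\<^sup>+t. h t \<partial>lborel) = (\<integral>\<^sup>+t. \<integral>\<^sup>+k. indicator (dyadic_shell k) t * h t \<partial>count_space UNIV \<partial>lborel)"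
  proof (rule nn_integral_cong_AE)
    have "AE t in lborel. t \<noteq> (0::real)" by (rule AE_lborel_singleton)
    then show "AE t in lborel. h t = (\<integral>\<^sup>+k. indicator (dyadic_shell k) t * h t \<partial>count_space UNIV)"
    proof eventually_elim
      case (elim t)
      then obtain k where "t \<in> dyadic_shell k" using dyadic_shell_exists by blast
      then show ?case by (simp add: nn_integral_dyadic_shell)
    qed
  qed
  also have "\<dots> = (\<integral>\<^sup>+k. \<integral>\<^sup>+t. indicator (dyadic_shell k) t * h t \<partial>lborel \<partial>count_space UNIV)"
    by (subst Fubini') (simp_all add: indicator_dyadic_shell split_beta')
  finally show ?thesis by (simp add: mult.commute)
qed

lemma infsum_ennreal_eq_nn_integral:
  fixes f :: "int \<Rightarrow> ennreal"
  shows "(\<Sum>\<^sub>\<infinity>k. f k) = (\<integral>\<^sup>+k. f k \<partial>count_space UNIV)"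
proof (rule antisym)
  have *: "(\<Sum>\<^sub>\<infinity>k. f k) = (SUP A\<in>{A. finite A \<and> A \<subseteq> UNIV}. sum f A)"
    by (rule nonneg_infsum_complete) simp
  show "(\<Sum>\<^sub>\<infinity>k. f k) \<le> (\<integral>\<^sup>+k. f k \<partial>count_space UNIV)"
    unfolding *
  proof (rule SUP_least)
    fix A :: "int set" assume "A \<in> {A. finite A \<and> A \<subseteq> UNIV}"
    then have "sum f A = (\<integral>\<^sup>+k. f k * indicator A k \<partial>count_space UNIV)"
      by (subst nn_integral_count_space'[where A = A]) auto
    also have "\<dots> \<le> (\<integral>\<^sup>+k. f k \<partial>count_space UNIV)"
      by (intro nn_integral_mono) (auto simp: indicator_def)
    finally show "sum f A \<le> (\<integral>\<^sup>+k. f k \<partial>count_space UNIV)" .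
  qed
  have "(\<integral>\<^sup>+k. f k \<partial>count_space UNIV) = (\<integral>\<^sup>+n. f (int_decode n) \<partial>count_space UNIV)"
    by (rule nn_integral_bij_count_space[symmetric]) (rule bij_int_decode)
  also have "\<dots> = (SUP n. \<Sum>i<n. f (int_decode i))"
    by (simp add: nn_integral_count_space_nat suminf_eq_SUP)
  also have "\<dots> \<le> (\<Sum>\<^sub>\<infinity>k. f k)"
    unfolding *
  proof (rule SUP_mono)
    fix n :: nat
    have "(\<Sum>i<n. f (int_decode i)) = sum f (int_decode ` {..<n})"
      using inj_int_decode by (subst sum.reindex) (auto intro: inj_on_subset)
    then show "\<exists>A\<in>{A. finite A \<and> A \<subseteq> UNIV}. (\<Sum>i<n. f (int_decode i)) \<le> sum f A"
      by (intro bexI[of _ "int_decode ` {..<n}"]) auto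
  qed
  finally show "(\<integral>\<^sup>+k. f k \<partial>count_space UNIV) \<le> (\<Sum>\<^sub>\<infinity>k. f k)" .
qed

lemma herz_norm_eq_Lp:
  assumes p: "1 \<le> p"
  shows "herz_norm a p q h = Lp (count_space UNIV) p
     (\<lambda>k. shell_weight a k * Lp lebesgue q (\<lambda>t. h t * indicator (dyadic_shell k) t))"
proof -
  have Lq: "Lq_norm q = Lp lebesgue q"
    by (simp add: fun_eq_iff Lq_norm_def Lp_def)
  from p show ?thesis
  proof (cases rule: ge_1_cases)
    case 1
    then show ?thesis by (simp add: herz_norm_def Lq shell_weight_def Lp_count_space_top flip: infinity_ennreal_def)
  next
    case (2 b)
    have *: "epowr (shell_weight a k) b = ennreal (2 powr (of_int k * b * a))" for k
      by (simp add: shell_weight_def powr_powr ac_simps)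
    show ?thesis using 2
      by (simp add: herz_norm_def Lq Lp_ennreal epowr_mult * infsum_ennreal_eq_nn_integral)
  qed
qed

lemma herz_norm_eq_herz:
  assumes "1 \<le> p" and [measurable]: "h \<in> borel_measurable borel"
  shows "herz_norm a p q h = herz a p q h"
  by (simp add: herz_norm_eq_Lp assms herz_def Lp_completion)

lemma herz_norm_cong_AE:
  assumes p: "1 \<le> p" and ae: "AE t in lborel. f t = g t"
  shows "herz_norm a p q f = herz_norm a p q g"
proof -
  have "Lp lebesgue q (\<lambda>t. f t * indicator (dyadic_shell k) t)
      = Lp lebesgue q (\<lambda>t. g t * indicator (dyadic_shell k) t)" for k
    using ae by (intro Lp_completion_cong_AE) (auto simp: AE_completion_iff elim!: eventually_mono)
  then show ?thesis by (simp add: herz_norm_eq_Lp p)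
qed

lemma herz_measurable:
  assumes pq: "1 \<le> p" "1 \<le> q"
    and [measurable]: "case_prod G \<in> borel_measurable (N \<Otimes>\<^sub>M lborel)"
  shows "(\<lambda>x. herz a p q (G x)) \<in> borel_measurable N"
  unfolding herz_def indicator_dyadic_shell
proof (intro Lp_measurable pq sigma_finite_measure_count_space)
  have "(\<lambda>z. Lp lborel q (\<lambda>t. G (fst z) t *
      (if 2 powi (snd z - 1) \<le> \<bar>t\<bar> \<and> \<bar>t\<bar> < 2 powi (snd z) then 1 else 0)))
      \<in> borel_measurable (N \<Otimes>\<^sub>M count_space UNIV)"
    by (intro Lp_measurable pq lborel.sigma_finite_measure_axioms) measurable
  then show "(\<lambda>(x, k). shell_weight a k * Lp lborel q (\<lambda>t. G x t *
      (if 2 powi (k - 1) \<le> \<bar>t\<bar> \<and> \<bar>t\<bar> < 2 powi k then 1 else 0)))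
      \<in> borel_measurable (N \<Otimes>\<^sub>M count_space UNIV)"
    by (simp add: split_beta')
qed

lemma herz_Holder:
  assumes p: "conjugate p p'" and q: "conjugate q q'"
    and [measurable]: "f \<in> borel_measurable borel" "g \<in> borel_measurable borel"
  shows "(\<integral>\<^sup>+t. f t * g t \<partial>lborel) \<le> herz a p q f * herz (- a) p' q' g"
proof -
  let ?f = "\<lambda>k t. f t * indicator (dyadic_shell k) t" and ?g = "\<lambda>k t. g t * indicator (dyadic_shell k) t"
  have "(\<integral>\<^sup>+t. f t * g t \<partial>lborel) = (\<integral>\<^sup>+k. \<integral>\<^sup>+t. ?f k t * ?g k t \<partial>lborel \<partial>count_space UNIV)"
    by (subst nn_integral_eq_sum_shells) (auto intro!: nn_integral_cong simp: indicator_def)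
  also have "\<dots> \<le> (\<integral>\<^sup>+k. (shell_weight a k * Lp lborel q (?f k)) * (shell_weight (- a) k * Lp lborel q' (?g k)) \<partial>count_space UNIV)"
  proof (rule nn_integral_mono)
    fix k
    have "(\<integral>\<^sup>+t. ?f k t * ?g k t \<partial>lborel) \<le> Lp lborel q (?f k) * Lp lborel q' (?g k)"
      by (intro Lp_Holder q) measurable
    also have "\<dots> = (shell_weight a k * shell_weight (- a) k) * (Lp lborel q (?f k) * Lp lborel q' (?g k))"
      by (simp add: shell_weight_cancel)
    finally show "(\<integral>\<^sup>+t. ?f k t * ?g k t \<partial>lborel)
        \<le> (shell_weight a k * Lp lborel q (?f k)) * (shell_weight (- a) k * Lp lborel q' (?g k))"
      by (simp only: ac_simps)
  qed
  also have "\<dots> \<le> herz a p q f * herz (- a) p' q' g"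
    unfolding herz_def by (intro Lp_Holder p) auto
  finally show ?thesis .
qed

lemma herz_mono:
  assumes pq: "1 \<le> p" "1 \<le> q" and [measurable]: "f \<in> borel_measurable borel" and le: "\<And>t. f t \<le> g t"
  shows "herz a p q f \<le> herz a p q g"
  unfolding herz_def
  by (intro Lp_mono pq mult_left_mono) (auto intro!: mult_right_mono le)

lemma herz_cmult_le:
  assumes pq: "1 \<le> p" "1 \<le> q" and [measurable]: "f \<in> borel_measurable borel"
  shows "herz a p q (\<lambda>t. c * f t) \<le> c * herz a p q f"
proof -
  let ?f = "\<lambda>k t. f t * indicator (dyadic_shell k) t"
  have "herz a p q (\<lambda>t. c * f t) \<le> Lp (count_space UNIV) p (\<lambda>k. c * (shell_weight a k * Lp lborel q (?f k)))"
    unfolding herz_def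
  proof (intro Lp_mono pq)
    fix k
    have "Lp lborel q (\<lambda>t. c * f t * indicator (dyadic_shell k) t) \<le> c * Lp lborel q (?f k)"
      using Lp_cmult_le[OF pq(2), of "?f k" lborel c] by (simp add: mult.assoc)
    then have "shell_weight a k * Lp lborel q (\<lambda>t. c * f t * indicator (dyadic_shell k) t)
        \<le> shell_weight a k * (c * Lp lborel q (?f k))" by (rule mult_left_mono) simp
    then show "shell_weight a k * Lp lborel q (\<lambda>t. c * f t * indicator (dyadic_shell k) t)
        \<le> c * (shell_weight a k * Lp lborel q (?f k))" by (simp only: ac_simps)
  qed auto
  also have "\<dots> \<le> c * herz a p q f"
    unfolding herz_def by (intro Lp_cmult_le pq) auto
  finally show ?thesis .
qed

lemma herz_monotone_convergence:
  assumes pq: "1 \<le> p" "1 \<le> q" and [measurable]: "\<And>n. f n \<in> borel_measurable borel" and inc: "incseq f"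
  shows "herz a p q (\<lambda>t. SUP n. f n t) = (SUP n. herz a p q (f n))"
proof -
  let ?f = "\<lambda>n k t. f n t * indicator (dyadic_shell k) t"
  have inc_f: "incseq (\<lambda>n. ?f n k)" for k
    using inc by (auto simp: incseq_def le_fun_def intro!: mult_right_mono)
  have "herz a p q (\<lambda>t. SUP n. f n t)
      = Lp (count_space UNIV) p (\<lambda>k. SUP n. shell_weight a k * Lp lborel q (?f n k))"
    unfolding herz_def
    by (simp add: SUP_mult_right_ennreal Lp_monotone_convergence[OF pq(2) _ inc_f] SUP_mult_left_ennreal)
  also have "\<dots> = (SUP n. herz a p q (f n))"
    unfolding herz_def
    using inc_f by (intro Lp_monotone_convergence pq)
      (auto simp: incseq_def le_fun_def intro!: mult_left_mono Lp_mono pq)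
  finally show ?thesis .
qed

lemma INF_mult_eq_0_ennreal:
  fixes f :: "'i \<Rightarrow> ennreal"
  assumes c: "c < top" and 0: "(INF i\<in>I. f i) = 0"
  shows "(INF i\<in>I. c * f i) = 0"
proof (cases "c = 0")
  case True
  with 0 show ?thesis by (cases "I = {}") auto
next
  case False
  let ?y = "INF i\<in>I. c * f i"
  have "inverse c * ?y \<le> (INF i\<in>I. f i)"
  proof (rule INF_greatest)
    fix i assume "i \<in> I"
    then have "inverse c * ?y \<le> inverse c * (c * f i)" by (intro mult_left_mono INF_lower) auto
    also have "\<dots> = f i" using c False by (simp add: mult.assoc[symmetric] mult_inverse_cancel_ennreal)
    finally show "inverse c * ?y \<le> f i" .
  qed
  then have "inverse c * ?y = 0" by (simp only: 0 le_zero_eq)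
  then show ?thesis using c by auto
qed

lemma herz_decreasing_to_0:
  assumes p: "1 \<le> p" "p < \<infinity>" and q: "1 \<le> q" "q < \<infinity>"
    and [measurable]: "\<And>n. f n \<in> borel_measurable borel"
    and dec: "decseq f" and fin: "herz a p q (f 0) < \<infinity>"
    and lim: "\<And>t. f 0 t < \<infinity> \<Longrightarrow> (INF n. f n t) = 0"
  shows "(INF n. herz a p q (f n)) = 0"
proof -
  let ?f = "\<lambda>n k t. f n t * indicator (dyadic_shell k) t"
  let ?h = "\<lambda>n k. shell_weight a k * Lp lborel q (?f n k)"
  have "(INF n. Lp (count_space UNIV) p (?h n)) = 0"
  proof (rule Lp_decreasing_to_0[OF p])
  show "Lp (count_space UNIV) p (?h 0) < \<infinity>" using fin by (simp add: herz_def)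
  show "decseq (\<lambda>n k. shell_weight a k * Lp lborel q (?f n k))"
    using dec by (auto simp: monotone_def le_fun_def intro!: mult_left_mono Lp_mono q mult_right_mono)
  fix k assume "shell_weight a k * Lp lborel q (?f 0 k) < \<infinity>"
  then have "Lp lborel q (?f 0 k) < \<infinity>"
    by (auto simp: ennreal_mult_less_top shell_weight_def)
  then have "(INF n. Lp lborel q (?f n k)) = 0"
    using dec lim
    by (intro Lp_decreasing_to_0 q)
       (auto simp: monotone_def le_fun_def indicator_def intro!: mult_right_mono)
  then show "(INF n. shell_weight a k * Lp lborel q (?f n k)) = 0"
    by (simp add: INF_mult_eq_0_ennreal shell_weight_def)
  qed auto
  then show ?thesis by (simp only: herz_def)
qed

text \<open>
  Extremizers \<open>F1\<close> for the single shells, with parameter \<open>(x, k)\<close>, are glued together with coefficients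
  taken from extremizers \<open>F2\<close> for the sequence of the weighted norms of the shells. The weights of the
  two dual norms cancel.
\<close>

lemma herz_extremizers:
  fixes G :: "'n \<times> real \<Rightarrow> ennreal"
  assumes p: "conjugate p p'" and q: "conjugate q q'"
    and G [measurable]: "G \<in> borel_measurable (N \<Otimes>\<^sub>M lborel)"
  obtains F :: "nat \<Rightarrow> 'n \<times> real \<Rightarrow> ennreal"
  where "\<And>m. F m \<in> borel_measurable (N \<Otimes>\<^sub>M lborel)"
    and "\<And>m x. x \<in> space N \<Longrightarrow> herz a p q (\<lambda>t. F m (x, t)) \<le> 1"
    and "\<And>x. incseq (\<lambda>m. \<integral>\<^sup>+t. F m (x, t) * G (x, t) \<partial>lborel)"
    and "\<And>x. x \<in> space N \<Longrightarrow>
      (SUP m. \<integral>\<^sup>+t. F m (x, t) * G (x, t) \<partial>lborel) = herz (- a) p' q' (\<lambda>t. G (x, t))"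
proof -
  have pq: "1 \<le> p" "1 \<le> q" "1 \<le> p'" "1 \<le> q'"
    using p q conjugate_ge_1 conjugate_sym by blast+
  interpret count: sigma_finite_measure "count_space (UNIV :: int set)"
    by (rule sigma_finite_measure_count_space)
  let ?K = "N \<Otimes>\<^sub>M count_space (UNIV :: int set)"
  let ?w = "shell_weight (- a)"
  define G1 where "G1 = (\<lambda>y. G (fst (fst y), snd y) * indicator (dyadic_shell (snd (fst y))) (snd y))"
  have [measurable]: "G1 \<in> borel_measurable (?K \<Otimes>\<^sub>M lborel)"
    unfolding G1_def indicator_dyadic_shell by measurable
  define G2 where "G2 = (\<lambda>z. ?w (snd z) * Lp lborel q' (\<lambda>t. G1 (z, t)))"
  have [measurable]: "(\<lambda>z. Lp lborel q' (\<lambda>t. G1 (z, t))) \<in> borel_measurable ?K"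
    by (intro Lp_measurable pq lborel.sigma_finite_measure_axioms) simp
  have [measurable]: "G2 \<in> borel_measurable ?K" unfolding G2_def by measurable
  obtain F1 :: "nat \<Rightarrow> ('n \<times> int) \<times> real \<Rightarrow> ennreal"
    where F1 [measurable]: "\<And>m. F1 m \<in> borel_measurable (?K \<Otimes>\<^sub>M lborel)"
    and F1_le: "\<And>m z. z \<in> space ?K \<Longrightarrow> Lp lborel q (\<lambda>t. F1 m (z, t)) \<le> 1"
    and F1_inc: "\<And>z. incseq (\<lambda>m. \<integral>\<^sup>+t. F1 m (z, t) * G1 (z, t) \<partial>lborel)"
    and F1_SUP: "\<And>z. z \<in> space ?K \<Longrightarrow>
      (SUP m. \<integral>\<^sup>+t. F1 m (z, t) * G1 (z, t) \<partial>lborel) = Lp lborel q' (\<lambda>t. G1 (z, t))"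
    by (rule Lp_extremizers[OF lborel.sigma_finite_measure_axioms q \<open>G1 \<in> borel_measurable _\<close>]) (rule that)
  obtain F2 :: "nat \<Rightarrow> 'n \<times> int \<Rightarrow> ennreal"
    where F2 [measurable]: "\<And>m. F2 m \<in> borel_measurable ?K"
    and F2_le: "\<And>m x. x \<in> space N \<Longrightarrow> Lp (count_space UNIV) p (\<lambda>k. F2 m (x, k)) \<le> 1"
    and F2_SUP: "\<And>x. x \<in> space N \<Longrightarrow>
      (SUP m. \<integral>\<^sup>+k. F2 m (x, k) * G2 (x, k) \<partial>count_space UNIV) = Lp (count_space UNIV) p' (\<lambda>k. G2 (x, k))"
    by (rule Lp_extremizers[OF count.sigma_finite_measure_axioms p \<open>G2 \<in> borel_measurable _\<close>]) (rule that)
  have herz_G2: "herz (- a) p' q' (\<lambda>t. G (x, t)) = Lp (count_space UNIV) p' (\<lambda>k. G2 (x, k))" for x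
    by (simp add: herz_def G2_def G1_def)
  \<comment> \<open>Only one term of this sum is nonzero; summation makes it measurable.\<close>
  define E where "E = (\<lambda>m l y. \<integral>\<^sup>+k. indicator (dyadic_shell k) (snd y) *
      (?w k * F2 m (fst y, k) * F1 l ((fst y, k), snd y)) \<partial>count_space UNIV)"
  have E_meas [measurable]: "E m l \<in> borel_measurable (N \<Otimes>\<^sub>M lborel)" for m l
    unfolding E_def indicator_dyadic_shell by measurable
  have E_eq: "E m l (x, t) = ?w k * F2 m (x, k) * F1 l ((x, k), t)" if "t \<in> dyadic_shell k" for m l x t k
    unfolding E_def by (simp add: nn_integral_dyadic_shell[OF that])
  have E_le: "herz a p q (\<lambda>t. E m l (x, t)) \<le> 1" if x: "x \<in> space N" for m l x
  proof -
    have "herz a p q (\<lambda>t. E m l (x, t)) \<le> Lp (count_space UNIV) p (\<lambda>k. F2 m (x, k))"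
      unfolding herz_def
    proof (intro Lp_mono pq)
      fix k
      have z: "(x, k) \<in> space ?K" using x by (simp add: space_pair_measure)
      have [measurable]: "(\<lambda>t. F1 l ((x, k), t)) \<in> borel_measurable borel"
        using measurable_Pair2[OF F1 z] by simp
      have [measurable]: "(\<lambda>t. E m l (x, t)) \<in> borel_measurable borel"
        using measurable_Pair2[OF E_meas x] by simp
      have "Lp lborel q (\<lambda>t. E m l (x, t) * indicator (dyadic_shell k) t)
          \<le> Lp lborel q (\<lambda>t. (?w k * F2 m (x, k)) * F1 l ((x, k), t))"
        by (intro Lp_mono pq) (auto simp: E_eq indicator_def)
      also have "\<dots> \<le> (?w k * F2 m (x, k)) * Lp lborel q (\<lambda>t. F1 l ((x, k), t))"
        by (intro Lp_cmult_le pq) simp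
      also have "\<dots> \<le> (?w k * F2 m (x, k)) * 1"
        by (intro mult_left_mono F1_le z) simp
      finally have "shell_weight a k * Lp lborel q (\<lambda>t. E m l (x, t) * indicator (dyadic_shell k) t)
          \<le> shell_weight a k * (?w k * F2 m (x, k))"
        by (intro mult_left_mono) simp_all
      also have "\<dots> = F2 m (x, k)"
        by (simp add: mult.assoc[symmetric] shell_weight_cancel)
      finally show "shell_weight a k * Lp lborel q (\<lambda>t. E m l (x, t) * indicator (dyadic_shell k) t) \<le> F2 m (x, k)" .
    qed auto
    also have "\<dots> \<le> 1" by (rule F2_le[OF x])
    finally show ?thesis .
  qed
  have E_int: "(\<integral>\<^sup>+t. E m l (x, t) * G (x, t) \<partial>lborel) =
      (\<integral>\<^sup>+k. (?w k * F2 m (x, k)) * (\<integral>\<^sup>+t. F1 l ((x, k), t) * G1 ((x, k), t) \<partial>lborel) \<partial>count_space UNIV)"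
    if x: "x \<in> space N" for m l x
  proof -
    have "(\<integral>\<^sup>+t. E m l (x, t) * G (x, t) \<partial>lborel) =
        (\<integral>\<^sup>+k. \<integral>\<^sup>+t. E m l (x, t) * G (x, t) * indicator (dyadic_shell k) t \<partial>lborel \<partial>count_space UNIV)"
      using measurable_Pair2[OF E_meas x] measurable_Pair2[OF G x]
      by (intro nn_integral_eq_sum_shells) simp
    also have "\<dots> = (\<integral>\<^sup>+k. \<integral>\<^sup>+t. (?w k * F2 m (x, k)) * (F1 l ((x, k), t) * G1 ((x, k), t)) \<partial>lborel \<partial>count_space UNIV)"
      by (intro nn_integral_cong) (auto simp: E_eq G1_def indicator_def ac_simps)
    also have "\<dots> = (\<integral>\<^sup>+k. (?w k * F2 m (x, k)) * (\<integral>\<^sup>+t. F1 l ((x, k), t) * G1 ((x, k), t) \<partial>lborel) \<partial>count_space UNIV)"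
    proof (intro nn_integral_cong nn_integral_cmult)
      fix k
      have z: "(x, k) \<in> space ?K" using x by (simp add: space_pair_measure)
      show "(\<lambda>t. F1 l ((x, k), t) * G1 ((x, k), t)) \<in> borel_measurable lborel"
        using measurable_Pair2[OF F1 z] measurable_Pair2[OF \<open>G1 \<in> borel_measurable _\<close> z]
        by (intro borel_measurable_times_ennreal)
    qed
    finally show ?thesis .
  qed
  have E_SUP: "(SUP l. \<integral>\<^sup>+t. E m l (x, t) * G (x, t) \<partial>lborel) = (\<integral>\<^sup>+k. F2 m (x, k) * G2 (x, k) \<partial>count_space UNIV)"
    if x: "x \<in> space N" for m x
  proof -
    have "(SUP l. \<integral>\<^sup>+t. E m l (x, t) * G (x, t) \<partial>lborel) =
      (\<integral>\<^sup>+k. (SUP l. (?w k * F2 m (x, k)) * (\<integral>\<^sup>+t. F1 l ((x, k), t) * G1 ((x, k), t) \<partial>lborel)) \<partial>count_space UNIV)"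
      unfolding E_int[OF x] using F1_inc
      by (intro nn_integral_monotone_convergence_SUP[symmetric])
         (auto simp: incseq_def le_fun_def intro!: mult_left_mono)
    also have "\<dots> = (\<integral>\<^sup>+k. F2 m (x, k) * G2 (x, k) \<partial>count_space UNIV)"
      using x by (intro nn_integral_cong)
        (simp add: SUP_mult_left_ennreal[symmetric] F1_SUP space_pair_measure G2_def, simp only: ac_simps)
    finally show ?thesis .
  qed
  define E' where "E' = (\<lambda>n. case prod_decode n of (m, l) \<Rightarrow> E m l)"
  have [measurable]: "E' n \<in> borel_measurable (N \<Otimes>\<^sub>M lborel)" for n
    by (simp add: E'_def split: prod.split)
  have E'_SUP: "(SUP n. \<integral>\<^sup>+t. E' n (x, t) * G (x, t) \<partial>lborel) = herz (- a) p' q' (\<lambda>t. G (x, t))"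
    if x: "x \<in> space N" for x
  proof -
    have "(SUP n. \<integral>\<^sup>+t. E' n (x, t) * G (x, t) \<partial>lborel)
        = (SUP y\<in>range prod_decode. \<integral>\<^sup>+t. E (fst y) (snd y) (x, t) * G (x, t) \<partial>lborel)"
      by (simp add: E'_def split_beta' image_comp)
    also have "\<dots> = (SUP y\<in>UNIV \<times> UNIV. \<integral>\<^sup>+t. E (fst y) (snd y) (x, t) * G (x, t) \<partial>lborel)"
      by (simp add: surj_prod_decode)
    also have "\<dots> = (SUP m. SUP l. \<integral>\<^sup>+t. E m l (x, t) * G (x, t) \<partial>lborel)"
    proof (rule antisym)
      show "(SUP m. SUP l. \<integral>\<^sup>+t. E m l (x, t) * G (x, t) \<partial>lborel)
          \<le> (SUP y\<in>UNIV \<times> UNIV. \<integral>\<^sup>+t. E (fst y) (snd y) (x, t) * G (x, t) \<partial>lborel)"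
        by (intro SUP_least, rule SUP_upper2[of "(m, l)" for m l]) auto
    qed (auto intro!: SUP_least SUP_upper2)
    finally show ?thesis by (simp add: E_SUP[OF x] F2_SUP[OF x] herz_G2)
  qed
  obtain F :: "nat \<Rightarrow> 'n \<times> real \<Rightarrow> ennreal"
    where F: "\<And>m. F m \<in> borel_measurable (N \<Otimes>\<^sub>M lborel)"
    and F_E': "\<And>m x. \<exists>j. (\<lambda>t. F m (x, t)) = (\<lambda>t. E' j (x, t))"
    and F_inc: "\<And>x. incseq (\<lambda>m. \<integral>\<^sup>+t. F m (x, t) * G (x, t) \<partial>lborel)"
    and F_SUP: "\<And>x. (SUP m. \<integral>\<^sup>+t. F m (x, t) * G (x, t) \<partial>lborel) = (SUP m. \<integral>\<^sup>+t. E' m (x, t) * G (x, t) \<partial>lborel)"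
    by (rule running_maximum_extremizers[OF lborel.sigma_finite_measure_axioms \<open>\<And>n. E' n \<in> _\<close> G]) (rule that)
  show thesis
  proof (rule that[OF F _ F_inc])
    show "herz a p q (\<lambda>t. F m (x, t)) \<le> 1" if "x \<in> space N" for m x
    proof -
      obtain j where "(\<lambda>t. F m (x, t)) = (\<lambda>t. E' j (x, t))" using F_E' by blast
      then show ?thesis using E_le[OF that] by (simp add: E'_def split: prod.split)
    qed
    show "(SUP m. \<integral>\<^sup>+t. F m (x, t) * G (x, t) \<partial>lborel) = herz (- a) p' q' (\<lambda>t. G (x, t))" if "x \<in> space N" for x
      by (simp add: F_SUP E'_SUP that)
  qed
qed

section \<open>Operations acting on one coordinate\<close>

definition coord_upd :: "real^'n \<Rightarrow> 'n::finite \<Rightarrow> real \<Rightarrow> real^'n" where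
  "coord_upd x i t = (\<chi> j. if j = i then t else x $ j)"

text \<open>
  The counterpart of \<open>partial_herz_norm\<close> for integration. As both produce functions on the whole
  space, statements about their iterates can be proved pointwise, at a fixed value of the
  remaining coordinates.
\<close>

definition coord_int :: "'n::finite \<Rightarrow> (real^'n \<Rightarrow> ennreal) \<Rightarrow> real^'n \<Rightarrow> ennreal" where
  "coord_int i F = (\<lambda>x. \<integral>\<^sup>+t. F (coord_upd x i t) \<partial>lborel)"

lemma coord_upd_same [simp]: "coord_upd (coord_upd x i s) i t = coord_upd x i t"
  by (simp add: coord_upd_def vec_eq_iff)

lemma coord_upd_nth [simp]: "coord_upd x i t $ j = (if j = i then t else x $ j)"
  by (simp add: coord_upd_def)

lemma coord_upd_commute: "i \<noteq> j \<Longrightarrow> coord_upd (coord_upd x i s) j t = coord_upd (coord_upd x j t) i s"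
  by (simp add: coord_upd_def vec_eq_iff)

lemma coord_upd_measurable [measurable (raw)]:
  assumes [measurable]: "f \<in> borel_measurable M" "g \<in> borel_measurable M"
  shows "(\<lambda>x. coord_upd (f x) i (g x)) \<in> borel_measurable M"
proof -
  have "continuous_on UNIV (\<lambda>z. if j = i then snd z else fst z $ j)" for j
    by (cases "j = i") (auto intro!: continuous_intros)
  then have c: "(\<lambda>z. coord_upd (fst z) i (snd z)) \<in> borel_measurable borel"
    unfolding coord_upd_def by (intro borel_measurable_continuous_onI continuous_on_vec_lambda)
  have p: "(\<lambda>x. (f x, g x)) \<in> borel_measurable M" by measurable
  show ?thesis using measurable_compose[OF p c] by simp
qed

lemma partial_herz_norm_eq:
  assumes p: "\<And>i. 1 \<le> p $ i" and [measurable]: "F \<in> borel_measurable borel"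
  shows "partial_herz_norm \<alpha> p q i F = (\<lambda>x. herz (\<alpha> $ i) (p $ i) (q $ i) (\<lambda>t. F (coord_upd x i t)))"
  unfolding partial_herz_norm_def coord_upd_def[symmetric]
  by (intro ext herz_norm_eq_herz p) measurable

lemma partial_herz_norm_measurable:
  assumes p: "\<And>i. 1 \<le> p $ i" and q: "\<And>i. 1 \<le> q $ i" and [measurable]: "F \<in> borel_measurable borel"
  shows "partial_herz_norm \<alpha> p q i F \<in> borel_measurable borel"
  unfolding partial_herz_norm_eq[OF p \<open>F \<in> _\<close>]
  by (intro herz_measurable p q) measurable

lemma coord_int_measurable [measurable (raw)]:
  assumes [measurable]: "F \<in> borel_measurable borel"
  shows "coord_int i F \<in> borel_measurable borel"
  unfolding coord_int_def by measurable

lemma partial_herz_norm_mono: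
  assumes p: "\<And>i. 1 \<le> p $ i" and q: "\<And>i. 1 \<le> q $ i"
    and F [measurable]: "F \<in> borel_measurable borel" and G: "G \<in> borel_measurable borel" and le: "F \<le> G"
  shows "partial_herz_norm \<alpha> p q i F \<le> partial_herz_norm \<alpha> p q i G"
  unfolding partial_herz_norm_eq[OF p F] partial_herz_norm_eq[OF p G] using le
  by (auto simp: le_fun_def intro!: herz_mono p q)

lemma fold_partial_herz_norm_mono:
  assumes p: "\<And>i. 1 \<le> p $ i" and q: "\<And>i. 1 \<le> q $ i"
    and "F \<in> borel_measurable borel" "G \<in> borel_measurable borel" "F \<le> G"
  shows "fold (partial_herz_norm \<alpha> p q) xs F \<le> fold (partial_herz_norm \<alpha> p q) xs G"
  using assms(3-)
  by (induction xs arbitrary: F G)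
     (simp_all add: partial_herz_norm_measurable[OF p q] partial_herz_norm_mono[OF p q])

lemma fold_coord_int_mono: "F \<le> G \<Longrightarrow> fold coord_int xs F \<le> fold coord_int xs G"
proof (induction xs arbitrary: F G)
  case (Cons i xs)
  have "coord_int i F \<le> coord_int i G"
    using Cons.prems by (auto simp: coord_int_def le_fun_def intro!: nn_integral_mono)
  then show ?case using Cons.IH by simp
qed simp

lemma fold_coord_int_cmult:
  assumes "F \<in> borel_measurable borel"
  shows "fold coord_int xs (\<lambda>x. c * F x) x = c * fold coord_int xs F x"
  using assms
proof (induction xs arbitrary: F)
  case (Cons i xs)
  note [measurable] = Cons.prems
  have "coord_int i (\<lambda>x. c * F x) = (\<lambda>x. c * coord_int i F x)"
    unfolding coord_int_def by (intro ext nn_integral_cmult) measurable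
  then show ?case using Cons.prems by (simp add: Cons.IH coord_int_measurable)
qed simp

text \<open>
  This is what allows extremal functions for different coordinates to be multiplied.
\<close>

lemma partial_herz_norm_mult_indep_le:
  assumes p: "\<And>i. 1 \<le> p $ i" and q: "\<And>i. 1 \<le> q $ i"
    and [measurable]: "F \<in> borel_measurable borel" "H \<in> borel_measurable borel"
    and indep: "\<And>x t. H (coord_upd x i t) = H x"
  shows "partial_herz_norm \<alpha> p q i (\<lambda>x. H x * F x) x \<le> H x * partial_herz_norm \<alpha> p q i F x"
proof -
  have [measurable]: "(\<lambda>x. H x * F x) \<in> borel_measurable borel" by measurable
  show ?thesis
    unfolding partial_herz_norm_eq[OF p \<open>F \<in> _\<close>] partial_herz_norm_eq[OF p \<open>(\<lambda>x. H x * F x) \<in> _\<close>] indep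
    by (intro herz_cmult_le p q) measurable
qed

lemma fold_partial_herz_norm_cmult_le:
  assumes p: "\<And>i. 1 \<le> p $ i" and q: "\<And>i. 1 \<le> q $ i" and "F \<in> borel_measurable borel"
  shows "fold (partial_herz_norm \<alpha> p q) xs (\<lambda>x. c * F x) x \<le> c * fold (partial_herz_norm \<alpha> p q) xs F x"
  using assms(3)
proof (induction xs arbitrary: F)
  case (Cons i xs)
  note [measurable] = Cons.prems partial_herz_norm_measurable[OF p q]
  have "fold (partial_herz_norm \<alpha> p q) (i # xs) (\<lambda>x. c * F x) x
      \<le> fold (partial_herz_norm \<alpha> p q) xs (\<lambda>x. c * partial_herz_norm \<alpha> p q i F x) x"
    by (simp, intro fold_partial_herz_norm_mono[OF p q, THEN le_funD])
       (auto simp: le_fun_def intro!: partial_herz_norm_mult_indep_le[OF p q])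
  also have "\<dots> \<le> c * fold (partial_herz_norm \<alpha> p q) xs (partial_herz_norm \<alpha> p q i F) x"
    by (rule Cons.IH) measurable
  finally show ?case by simp
qed simp

lemma fold_partial_herz_norm_monotone_convergence:
  assumes p: "\<And>i. 1 \<le> p $ i" and q: "\<And>i. 1 \<le> q $ i"
    and "\<And>n. F n \<in> borel_measurable borel" "incseq F"
  shows "fold (partial_herz_norm \<alpha> p q) xs (\<lambda>x. SUP n. F n x) x = (SUP n. fold (partial_herz_norm \<alpha> p q) xs (F n) x)"
  using assms(3,4)
proof (induction xs arbitrary: F)
  case (Cons i xs)
  note [measurable] = Cons.prems(1)
  have [measurable]: "(\<lambda>x. SUP n. F n x) \<in> borel_measurable borel" by measurable
  have "partial_herz_norm \<alpha> p q i (\<lambda>x. SUP n. F n x) = (\<lambda>x. SUP n. partial_herz_norm \<alpha> p q i (F n) x)"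
    unfolding partial_herz_norm_eq[OF p \<open>(\<lambda>x. SUP n. F n x) \<in> _\<close>] partial_herz_norm_eq[OF p Cons.prems(1)]
    using Cons.prems(2) by (intro ext herz_monotone_convergence p q) (auto simp: monotone_def le_fun_def)
  moreover have "incseq (\<lambda>n. partial_herz_norm \<alpha> p q i (F n))"
    using Cons.prems by (auto simp: incseq_def intro!: partial_herz_norm_mono[OF p q])
  ultimately show ?case
    using Cons.IH[of "\<lambda>n. partial_herz_norm \<alpha> p q i (F n)"] by (simp add: partial_herz_norm_measurable[OF p q])
qed simp

text \<open>
  Even for finite functions the intermediate norms may be infinite at some points; therefore
  convergence is demanded only where the first function is finite, a hypothesis that the partial
  norms inherit.
\<close>

lemma fold_partial_herz_norm_decreasing_to_0:
  assumes p: "\<And>i. 1 \<le> p $ i \<and> p $ i < \<infinity>" and q: "\<And>i. 1 \<le> q $ i \<and> q $ i < \<infinity>"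
    and "\<And>n. F n \<in> borel_measurable borel" "decseq F" "\<And>x. F 0 x < \<infinity> \<Longrightarrow> (INF n. F n x) = 0"
    and "fold (partial_herz_norm \<alpha> p q) xs (F 0) x < \<infinity>"
  shows "(INF n. fold (partial_herz_norm \<alpha> p q) xs (F n) x) = 0"
  using assms(3-)
proof (induction xs arbitrary: F)
  case (Cons i xs)
  note [measurable] = Cons.prems(1)
  have p1: "\<And>i. 1 \<le> p $ i" and q1: "\<And>i. 1 \<le> q $ i" using p q by auto
  let ?P = "\<lambda>n. partial_herz_norm \<alpha> p q i (F n)"
  have "(INF n. fold (partial_herz_norm \<alpha> p q) xs (?P n) x) = 0"
  proof (rule Cons.IH)
    show "?P n \<in> borel_measurable borel" for n by (intro partial_herz_norm_measurable[OF p1 q1]) measurable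
    show "decseq ?P"
      using Cons.prems(1,2) by (auto simp: monotone_def intro!: partial_herz_norm_mono[OF p1 q1])
    show "(INF n. ?P n y) = 0" if "?P 0 y < \<infinity>" for y
      using that Cons.prems(2,3) p q unfolding partial_herz_norm_eq[OF p1 Cons.prems(1)]
      by (intro herz_decreasing_to_0) (auto simp: monotone_def le_fun_def)
    show "fold (partial_herz_norm \<alpha> p q) xs (?P 0) x < \<infinity>" using Cons.prems(4) by simp
  qed
  then show ?case by simp
qed simp

lemma fold_partial_herz_norm_coord_upd:
  "i \<notin> set xs \<Longrightarrow> fold (partial_herz_norm \<alpha> p q) xs (\<lambda>y. F (coord_upd y i c)) x
    = fold (partial_herz_norm \<alpha> p q) xs F (coord_upd x i c)"
proof (induction xs arbitrary: F)
  case (Cons j xs)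
  then have "partial_herz_norm \<alpha> p q j (\<lambda>y. F (coord_upd y i c))
      = (\<lambda>y. partial_herz_norm \<alpha> p q j F (coord_upd y i c))"
    by (simp add: partial_herz_norm_def coord_upd_def[symmetric] coord_upd_commute[of i j])
  with Cons show ?case by simp
qed simp

lemma fold_coord_int_coord_upd:
  "i \<notin> set xs \<Longrightarrow> fold coord_int xs (\<lambda>y. F (coord_upd y i c)) x = fold coord_int xs F (coord_upd x i c)"
proof (induction xs arbitrary: F)
  case (Cons j xs)
  then have "coord_int j (\<lambda>y. F (coord_upd y i c)) = (\<lambda>y. coord_int j F (coord_upd y i c))"
    by (simp add: coord_int_def coord_upd_commute[of i j])
  with Cons show ?case by simp
qed simp

section \<open>Hoelder's inequality and duality for mixed norms\<close>

lemma fold_Holder: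
  assumes p: "\<And>i. conjugate (p $ i) (p' $ i)" and q: "\<And>i. conjugate (q $ i) (q' $ i)"
    and "F \<in> borel_measurable borel" "G \<in> borel_measurable borel"
  shows "fold coord_int xs (\<lambda>x. F x * G x) x
    \<le> fold (partial_herz_norm \<alpha> p q) xs F x * fold (partial_herz_norm (- \<alpha>) p' q') xs G x"
  using assms(3,4)
proof (induction xs arbitrary: F G)
  case (Cons i xs)
  note [measurable] = Cons.prems
  have pq: "\<And>i. 1 \<le> p $ i" "\<And>i. 1 \<le> q $ i" "\<And>i. 1 \<le> p' $ i" "\<And>i. 1 \<le> q' $ i"
    using p q conjugate_ge_1 conjugate_sym by blast+
  have "coord_int i (\<lambda>x. F x * G x) \<le> (\<lambda>x. partial_herz_norm \<alpha> p q i F x * partial_herz_norm (- \<alpha>) p' q' i G x)"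
    unfolding coord_int_def partial_herz_norm_eq[OF pq(1) \<open>F \<in> _\<close>] partial_herz_norm_eq[OF pq(3) \<open>G \<in> _\<close>]
    by (auto simp: le_fun_def intro!: herz_Holder p q)
  then have "fold coord_int (i # xs) (\<lambda>x. F x * G x) x
      \<le> fold coord_int xs (\<lambda>x. partial_herz_norm \<alpha> p q i F x * partial_herz_norm (- \<alpha>) p' q' i G x) x"
    by (simp, intro fold_coord_int_mono[THEN le_funD])
  also have "\<dots> \<le> fold (partial_herz_norm \<alpha> p q) xs (partial_herz_norm \<alpha> p q i F) x *
      fold (partial_herz_norm (- \<alpha>) p' q') xs (partial_herz_norm (- \<alpha>) p' q' i G) x"
    by (intro Cons.IH partial_herz_norm_measurable pq) auto
  finally show ?case by simp
qed simp

text \<open>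
  Let \<open>F m\<close> be extremizers for \<open>G\<close> in the first coordinate \<open>i\<close>. The partial pairings \<open>J m\<close> of \<open>F m\<close> and \<open>G\<close>
  increase to the norm of \<open>G\<close> in that coordinate, and the induction hypothesis applies to each \<open>J m\<close>. A
  test function \<open>H\<close> for \<open>J m\<close> may be made independent of the coordinate \<open>i\<close> by evaluating it at 0 there,
  since \<open>J m\<close> does not depend on that coordinate; then \<open>H\<close> times \<open>F m\<close> is a test function for \<open>G\<close>.
\<close>

lemma fold_duality:
  assumes p: "\<And>i. conjugate (p $ i) (p' $ i)" and q: "\<And>i. conjugate (q $ i) (q' $ i)"
    and "distinct xs" "G \<in> borel_measurable borel"
  shows "fold (partial_herz_norm (- \<alpha>) p' q') xs G x
    \<le> (SUP F\<in>{F \<in> borel_measurable borel. \<forall>y. fold (partial_herz_norm \<alpha> p q) xs F y \<le> 1}.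
          fold coord_int xs (\<lambda>y. F y * G y) x)"
  using assms(3,4)
proof (induction xs arbitrary: G x)
  case Nil
  show ?case by (rule SUP_upper2[of "\<lambda>_. 1"]) auto
next
  case (Cons i xs)
  have i: "i \<notin> set xs" "distinct xs" using Cons.prems by auto
  have G [measurable]: "G \<in> borel_measurable borel" using Cons.prems by simp
  have pq: "\<And>i. 1 \<le> p $ i" "\<And>i. 1 \<le> q $ i" "\<And>i. 1 \<le> p' $ i" "\<And>i. 1 \<le> q' $ i"
    using p q conjugate_ge_1 conjugate_sym by blast+
  let ?P = "partial_herz_norm \<alpha> p q" and ?P' = "partial_herz_norm (- \<alpha>) p' q'"
  let ?B = "\<lambda>xs. {F \<in> borel_measurable borel. \<forall>y. fold ?P xs F y \<le> 1}"
  have G' [measurable]: "(\<lambda>z. G (coord_upd (fst z) i (snd z))) \<in> borel_measurable (borel \<Otimes>\<^sub>M lborel)"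
    by measurable
  obtain E :: "nat \<Rightarrow> (real^'a) \<times> real \<Rightarrow> ennreal"
    where E [measurable]: "\<And>m. E m \<in> borel_measurable (borel \<Otimes>\<^sub>M lborel)"
    and E_le: "\<And>m x. x \<in> space borel \<Longrightarrow> herz (\<alpha> $ i) (p $ i) (q $ i) (\<lambda>t. E m (x, t)) \<le> 1"
    and E_inc: "\<And>x. incseq (\<lambda>m. \<integral>\<^sup>+t. E m (x, t) * G (coord_upd (fst (x, t)) i (snd (x, t))) \<partial>lborel)"
    and E_SUP: "\<And>x. x \<in> space borel \<Longrightarrow>
      (SUP m. \<integral>\<^sup>+t. E m (x, t) * G (coord_upd (fst (x, t)) i (snd (x, t))) \<partial>lborel)
      = herz (- (\<alpha> $ i)) (p' $ i) (q' $ i) (\<lambda>t. G (coord_upd (fst (x, t)) i (snd (x, t))))"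
    by (rule herz_extremizers[OF p q G']) (rule that)
  define F where "F = (\<lambda>m y. E m (coord_upd y i 0, y $ i))"
  have F_upd: "F m (coord_upd y i t) = E m (coord_upd y i 0, t)" for m y t
    by (simp add: F_def)
  have [measurable]: "(\<lambda>y::real^'a. y $ i) \<in> borel_measurable borel"
    by (intro borel_measurable_continuous_onI continuous_intros)
  have F [measurable]: "F m \<in> borel_measurable borel" for m
    unfolding F_def by measurable
  have F_le: "?P i (F m) y \<le> 1" for m y
    unfolding partial_herz_norm_eq[OF pq(1) F] F_upd by (rule E_le) simp
  define J where "J = (\<lambda>m. coord_int i (\<lambda>y. F m y * G y))"
  have J_meas [measurable]: "J m \<in> borel_measurable borel" for m
    unfolding J_def by measurable
  have J_eq: "J m y = (\<integral>\<^sup>+t. E m (coord_upd y i 0, t) * G (coord_upd (fst (coord_upd y i 0, t)) i (snd (coord_upd y i 0, t))) \<partial>lborel)" for m y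
    by (simp add: J_def coord_int_def F_upd)
  have J_inc: "incseq J"
    by (intro incseq_SucI le_funI) (simp only: J_eq incseq_SucD[OF E_inc])
  have J_SUP: "(SUP m. J m y) = ?P' i G y" for y
    unfolding partial_herz_norm_eq[OF pq(3) G] J_eq by (subst E_SUP) simp_all
  have J_upd: "J m (coord_upd y i t) = J m y" for m y t
    by (simp add: J_eq)
  have step: "fold ?P' xs (J m) x \<le> (SUP F\<in>?B (i # xs). fold coord_int (i # xs) (\<lambda>y. F y * G y) x)" for m
  proof -
    have "fold ?P' xs (J m) x = fold ?P' xs (J m) (coord_upd x i 0)"
      using fold_partial_herz_norm_coord_upd[OF i(1), of "- \<alpha>" p' q' "J m" 0 x] by (simp add: J_upd)
    also have "\<dots> \<le> (SUP F\<in>?B xs. fold coord_int xs (\<lambda>y. F y * J m y) (coord_upd x i 0))"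
      by (rule Cons.IH) (use i in auto)
    also have "\<dots> \<le> (SUP F\<in>?B (i # xs). fold coord_int (i # xs) (\<lambda>y. F y * G y) x)"
    proof (rule SUP_mono)
      fix H assume H: "H \<in> ?B xs"
      then have [measurable]: "H \<in> borel_measurable borel" by simp
      define K where "K = (\<lambda>y. H (coord_upd y i 0) * F m y)"
      have [measurable]: "(\<lambda>y. H (coord_upd y i 0)) \<in> borel_measurable borel" by measurable
      have [measurable]: "K \<in> borel_measurable borel" unfolding K_def by measurable
      have "?P i K y \<le> H (coord_upd y i 0)" for y
      proof -
        have "?P i K y \<le> H (coord_upd y i 0) * ?P i (F m) y"
          unfolding K_def by (rule partial_herz_norm_mult_indep_le[OF pq(1,2)]) auto
        also have "\<dots> \<le> H (coord_upd y i 0) * 1" by (intro mult_left_mono F_le) simp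
        finally show ?thesis by simp
      qed
      then have "fold ?P xs (?P i K) y \<le> fold ?P xs (\<lambda>y. H (coord_upd y i 0)) y" for y
        by (intro fold_partial_herz_norm_mono[OF pq(1,2), THEN le_funD] partial_herz_norm_measurable pq)
           (auto simp: le_fun_def)
      also have "fold ?P xs (\<lambda>y. H (coord_upd y i 0)) y = fold ?P xs H (coord_upd y i 0)" for y
        by (rule fold_partial_herz_norm_coord_upd[OF i(1)])
      also have "fold ?P xs H (coord_upd y i 0) \<le> 1" for y using H by simp
      finally have K: "K \<in> ?B (i # xs)" by simp
      have "coord_int i (\<lambda>y. K y * G y) = (\<lambda>y. H (coord_upd y i 0) * J m (coord_upd y i 0))"
      proof
        fix y
        have "coord_int i (\<lambda>y. K y * G y) y
            = (\<integral>\<^sup>+t. H (coord_upd y i 0) * (F m (coord_upd y i t) * G (coord_upd y i t)) \<partial>lborel)"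
          by (simp add: coord_int_def K_def mult.assoc)
        also have "\<dots> = H (coord_upd y i 0) * J m y"
          unfolding J_def coord_int_def by (intro nn_integral_cmult) measurable
        finally show "coord_int i (\<lambda>y. K y * G y) y = H (coord_upd y i 0) * J m (coord_upd y i 0)"
          by (simp add: J_upd)
      qed
      then have "fold coord_int (i # xs) (\<lambda>y. K y * G y) x = fold coord_int xs (\<lambda>y. H y * J m y) (coord_upd x i 0)"
        using fold_coord_int_coord_upd[OF i(1), of "\<lambda>y. H y * J m y" 0 x] by simp
      with K show "\<exists>F\<in>?B (i # xs). fold coord_int xs (\<lambda>y. H y * J m y) (coord_upd x i 0)
          \<le> fold coord_int (i # xs) (\<lambda>y. F y * G y) x"
        by (intro bexI[of _ K]) simp_all
    qed
    finally show ?thesis .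
  qed
  have "fold ?P' (i # xs) G x = fold ?P' xs (\<lambda>y. SUP m. J m y) x"
    by (simp add: J_SUP)
  also have "\<dots> = (SUP m. fold ?P' xs (J m) x)"
    by (intro fold_partial_herz_norm_monotone_convergence pq J_inc) simp
  also have "\<dots> \<le> (SUP F\<in>?B (i # xs). fold coord_int (i # xs) (\<lambda>y. F y * G y) x)"
    by (intro SUP_least step)
  finally show ?case .
qed

section \<open>Independence of null sets and Fubini's theorem\<close>

text \<open>
  By Tonelli's theorem almost every line in the direction of the first coordinate meets a null set
  in a null set. The exceptional lines make up the set \<open>N'\<close>, which is null for the remaining
  coordinates.
\<close>

lemma fold_partial_herz_norm_cong_AE:
  assumes p: "\<And>i. 1 \<le> p $ i" and "N \<in> sets borel" "fold coord_int xs (indicator N) x = 0"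
    and "\<And>y. y \<notin> N \<Longrightarrow> F y = G y"
  shows "fold (partial_herz_norm \<alpha> p q) xs F x = fold (partial_herz_norm \<alpha> p q) xs G x"
  using assms(2-)
proof (induction xs arbitrary: F G N)
  case Nil then show ?case by (simp add: indicator_eq_0_iff)
next
  case (Cons i xs)
  note [measurable] = Cons.prems(1)
  define N' where "N' = {y. coord_int i (indicator N) y \<noteq> 0}"
  have N' [measurable]: "N' \<in> sets borel"
  proof -
    have "coord_int i (indicator N) \<in> borel_measurable borel" by measurable
    from measurable_sets[OF this, of "- {0}"] show ?thesis by (simp add: N'_def vimage_def Collect_neg_eq[symmetric])
  qed
  have "fold coord_int xs (indicator N') x \<le> fold coord_int xs (\<lambda>y. \<infinity> * coord_int i (indicator N) y) x"
    by (intro fold_coord_int_mono[THEN le_funD])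
       (auto simp: le_fun_def indicator_def N'_def ennreal_top_mult)
  also have "\<dots> = \<infinity> * fold coord_int xs (coord_int i (indicator N)) x"
    by (rule fold_coord_int_cmult) measurable
  finally have "fold coord_int xs (indicator N') x = 0" using Cons.prems by simp
  moreover have "partial_herz_norm \<alpha> p q i F y = partial_herz_norm \<alpha> p q i G y" if "y \<notin> N'" for y
  proof -
    have "(\<integral>\<^sup>+t. indicator N (coord_upd y i t) \<partial>lborel) = 0"
      using that by (simp add: N'_def coord_int_def)
    then have "AE t in lborel. coord_upd y i t \<notin> N"
      by (subst (asm) nn_integral_0_iff_AE) (auto simp: indicator_eq_0_iff)
    then have "AE t in lborel. F (coord_upd y i t) = G (coord_upd y i t)"
      using Cons.prems(3) by (auto elim: eventually_mono)
    then show ?thesis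
      unfolding partial_herz_norm_def coord_upd_def[symmetric] by (intro herz_norm_cong_AE p)
  qed
  ultimately have "fold (partial_herz_norm \<alpha> p q) xs (partial_herz_norm \<alpha> p q i F) x
      = fold (partial_herz_norm \<alpha> p q) xs (partial_herz_norm \<alpha> p q i G) x"
    by (rule Cons.IH[OF N'])
  then show ?case by simp
qed

lemma lborel_eq_distr_vec_lambda:
  "(lborel :: (real^'n::finite) measure) = distr (\<Pi>\<^sub>M i\<in>UNIV. lborel) borel vec_lambda"
proof (rule lborel_eqI)
  have m [measurable]: "vec_lambda \<in> measurable (\<Pi>\<^sub>M i\<in>UNIV. lborel) (borel :: (real^'n) measure)"
    by (subst borel_measurable_euclidean_space) (auto simp: Basis_vec_def inner_axis)
  interpret product_sigma_finite "\<lambda>_::'n. lborel :: real measure" ..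
  fix l u :: "real^'n" assume le: "\<And>b. b \<in> Basis \<Longrightarrow> l \<bullet> b \<le> u \<bullet> b"
  then have le': "l $ i \<le> u $ i" for i using le[of "axis i 1"] by (simp add: inner_axis axis_in_Basis_iff)
  have "emeasure (distr (\<Pi>\<^sub>M i\<in>UNIV. lborel) borel vec_lambda) (box l u)
      = emeasure (\<Pi>\<^sub>M i\<in>UNIV. lborel) (\<Pi>\<^sub>E i\<in>UNIV. {l $ i <..< u $ i})"
  proof (subst emeasure_distr)
    have "vec_lambda -` box l u \<inter> space (\<Pi>\<^sub>M i\<in>UNIV. lborel) = (\<Pi>\<^sub>E i\<in>UNIV. {l $ i <..< u $ i})"
      by (auto simp: space_PiM mem_box_cart PiE_iff)
    then show "emeasure (\<Pi>\<^sub>M i\<in>UNIV. lborel) (vec_lambda -` box l u \<inter> space (\<Pi>\<^sub>M i\<in>UNIV. lborel))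
        = emeasure (\<Pi>\<^sub>M i\<in>UNIV. lborel) (\<Pi>\<^sub>E i\<in>UNIV. {l $ i <..< u $ i})" by simp
  qed (simp_all add: m)
  also have "\<dots> = (\<Prod>i\<in>UNIV. ennreal (u $ i - l $ i))"
    by (subst emeasure_PiM) (auto simp: le')
  also have "\<dots> = ennreal (\<Prod>i\<in>UNIV. u $ i - l $ i)"
    by (rule prod_ennreal) (simp add: le')
  also have "(\<Prod>i\<in>UNIV. u $ i - l $ i) = (\<Prod>b\<in>Basis. (u - l) \<bullet> b)"
    by (simp add: Basis_vec_def inner_axis axis_eq_axis prod.UNION_disjoint)
  finally show "emeasure (distr (\<Pi>\<^sub>M i\<in>UNIV. lborel) borel vec_lambda) (box l u) = ennreal (\<Prod>b\<in>Basis. (u - l) \<bullet> b)" .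
qed simp

lemma fold_coord_int_eq_nn_integral:
  fixes F :: "real^'n::finite \<Rightarrow> ennreal"
  assumes "F \<in> borel_measurable borel" "distinct xs" "set xs = UNIV"
  shows "fold coord_int xs F x = (\<integral>\<^sup>+y. F y \<partial>lborel)"
proof -
  interpret product_sigma_finite "\<lambda>_::'n. lborel :: real measure" ..
  define glue where "glue = (\<lambda>J x f. (\<chi> j. if j \<in> J then f j else x $ j) :: real^'n)"
  have glue [measurable]: "glue J x \<in> measurable (\<Pi>\<^sub>M i\<in>J. lborel) borel" for J :: "'n set" and x
    unfolding glue_def
  proof (subst borel_measurable_euclidean_space, intro ballI)
    fix b :: "real^'n" assume "b \<in> Basis"
    then obtain j where b: "b = axis j 1" by (auto simp: Basis_vec_def)
    show "(\<lambda>f. (\<chi> j. if j \<in> J then f j else x $ j) \<bullet> b) \<in> borel_measurable (\<Pi>\<^sub>M i\<in>J. lborel)"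
      unfolding b inner_axis by (cases "j \<in> J") auto
  qed
  have "fold coord_int xs F x = (\<integral>\<^sup>+f. F (glue (set xs) x f) \<partial>(\<Pi>\<^sub>M i\<in>set xs. lborel))"
    if "F \<in> borel_measurable borel" "distinct xs" for F xs
    using that
  proof (induction xs arbitrary: F)
    case Nil
    have "F (glue {} x f) = F x" for f by (simp add: glue_def)
    then show ?case by (simp add: PiM_empty)
  next
    case (Cons i xs)
    note [measurable] = Cons.prems(1)
    have "glue (insert i (set xs)) x (f(i := y)) = coord_upd (glue (set xs) x f) i y" for f y
      by (simp add: glue_def coord_upd_def vec_eq_iff)
    moreover have "(\<integral>\<^sup>+f. F (glue (insert i (set xs)) x f) \<partial>(\<Pi>\<^sub>M i\<in>insert i (set xs). lborel))
        = (\<integral>\<^sup>+f. \<integral>\<^sup>+y. F (glue (insert i (set xs)) x (f(i := y))) \<partial>lborel \<partial>(\<Pi>\<^sub>M i\<in>set xs. lborel))"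
      using Cons.prems(2) by (intro product_nn_integral_insert) auto
    ultimately have "(\<integral>\<^sup>+f. F (glue (set (i # xs)) x f) \<partial>(\<Pi>\<^sub>M i\<in>set (i # xs). lborel))
        = (\<integral>\<^sup>+f. coord_int i F (glue (set xs) x f) \<partial>(\<Pi>\<^sub>M i\<in>set xs. lborel))"
      by (simp add: coord_int_def)
    also have "\<dots> = fold coord_int xs (coord_int i F) x"
      using Cons by (simp add: coord_int_measurable)
    finally show ?case by simp
  qed
  from this[OF assms(1,2)] have "fold coord_int xs F x = (\<integral>\<^sup>+f. F (vec_lambda f) \<partial>(\<Pi>\<^sub>M i\<in>UNIV. lborel))"
    by (simp add: assms(3) glue_def)
  also have "\<dots> = (\<integral>\<^sup>+y. F y \<partial>distr (\<Pi>\<^sub>M i\<in>UNIV. lborel) borel vec_lambda)"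
    using glue[of UNIV x] assms(1) by (subst nn_integral_distr) (auto simp: glue_def)
  finally show ?thesis by (simp add: lborel_eq_distr_vec_lambda)
qed

section \<open>Mixed norms of Lebesgue measurable functions\<close>

definition mixed_norm ::
  "real^'n::{finite,linorder} \<Rightarrow> ennreal^'n::{finite,linorder} \<Rightarrow> ennreal^'n::{finite,linorder} \<Rightarrow> (real^'n::{finite,linorder} \<Rightarrow> ennreal) \<Rightarrow> ennreal" where
  "mixed_norm \<alpha> p q F = fold (partial_herz_norm \<alpha> p q) (sorted_list_of_set UNIV) F 0"

lemma mixed_herz_norm_eq: "mixed_herz_norm \<alpha> p q f = mixed_norm \<alpha> p q (\<lambda>x. ennreal (norm (f x)))"
  by (simp add: mixed_herz_norm_def mixed_norm_def)

lemma coordinates_list: "distinct (sorted_list_of_set (UNIV :: 'n::{finite,linorder} set))"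
  "set (sorted_list_of_set (UNIV :: 'n::{finite,linorder} set)) = UNIV"
  by simp_all

lemmas fold_coordinates_eq_nn_integral = fold_coord_int_eq_nn_integral[OF _ coordinates_list]

lemma mixed_norm_cong_AE:
  assumes p: "\<And>i. 1 \<le> p $ i" and ae: "AE x in lebesgue. F x = G x"
  shows "mixed_norm \<alpha> p q F = mixed_norm \<alpha> p q G"
proof -
  from ae have "AE x in lborel. F x = G x" by (simp add: AE_completion_iff)
  then obtain N where N: "{x. F x \<noteq> G x} \<subseteq> N" "N \<in> sets borel" "emeasure lborel N = 0"
    by (auto elim!: AE_E)
  have "fold coord_int (sorted_list_of_set UNIV) (indicator N) 0 = emeasure lborel N"
    using N(2) by (subst fold_coordinates_eq_nn_integral) auto
  with N show ?thesis
    unfolding mixed_norm_def by (intro fold_partial_herz_norm_cong_AE[OF p N(2)]) auto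
qed

lemma borel_version:
  fixes F :: "'a::euclidean_space \<Rightarrow> ennreal"
  assumes "F \<in> borel_measurable lebesgue"
  obtains F' where "F' \<in> borel_measurable borel" "AE x in lebesgue. F x = F' x"
  using completion_ex_borel_measurable[OF assms] by (auto simp: AE_completion_iff)

lemma mixed_norm_mono:
  assumes p: "\<And>i. 1 \<le> p $ i" and q: "\<And>i. 1 \<le> q $ i"
    and F: "F \<in> borel_measurable lebesgue" and G: "G \<in> borel_measurable lebesgue"
    and le: "AE x in lebesgue. F x \<le> G x"
  shows "mixed_norm \<alpha> p q F \<le> mixed_norm \<alpha> p q G"
proof -
  obtain F' where F': "F' \<in> borel_measurable borel" "AE x in lebesgue. F x = F' x" using F by (rule borel_version)
  obtain G' where G': "G' \<in> borel_measurable borel" "AE x in lebesgue. G x = G' x" using G by (rule borel_version)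
  note [measurable] = F'(1) G'(1)
  have "AE x in lebesgue. F x = min (F' x) (G' x)"
    using F'(2) G'(2) le by eventually_elim (auto simp: min_absorb1)
  then have "mixed_norm \<alpha> p q F = mixed_norm \<alpha> p q (\<lambda>x. min (F' x) (G' x))" by (rule mixed_norm_cong_AE[OF p])
  also have "\<dots> \<le> mixed_norm \<alpha> p q G'"
    unfolding mixed_norm_def
    by (intro fold_partial_herz_norm_mono[OF p q, THEN le_funD]) (auto simp: le_fun_def)
  also have "\<dots> = mixed_norm \<alpha> p q G" using mixed_norm_cong_AE[OF p G'(2)] by simp
  finally show ?thesis .
qed

lemma mixed_norm_cmult_le:
  assumes p: "\<And>i. 1 \<le> p $ i" and q: "\<And>i. 1 \<le> q $ i" and F: "F \<in> borel_measurable lebesgue"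
  shows "mixed_norm \<alpha> p q (\<lambda>x. c * F x) \<le> c * mixed_norm \<alpha> p q F"
proof -
  obtain F' where F': "F' \<in> borel_measurable borel" "AE x in lebesgue. F x = F' x" using F by (rule borel_version)
  have "AE x in lebesgue. c * F x = c * F' x" using F'(2) by eventually_elim simp
  then have "mixed_norm \<alpha> p q (\<lambda>x. c * F x) = mixed_norm \<alpha> p q (\<lambda>x. c * F' x)" by (rule mixed_norm_cong_AE[OF p])
  also have "\<dots> \<le> c * mixed_norm \<alpha> p q F'"
    unfolding mixed_norm_def by (rule fold_partial_herz_norm_cmult_le[OF p q F'(1)])
  also have "\<dots> = c * mixed_norm \<alpha> p q F" using mixed_norm_cong_AE[OF p F'(2)] by simp
  finally show ?thesis .
qed

lemma mixed_Holder:
  assumes p: "\<And>i. conjugate (p $ i) (p' $ i)" and q: "\<And>i. conjugate (q $ i) (q' $ i)"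
    and F: "F \<in> borel_measurable lebesgue" and G: "G \<in> borel_measurable lebesgue"
  shows "(\<integral>\<^sup>+x. F x * G x \<partial>lebesgue) \<le> mixed_norm \<alpha> p q F * mixed_norm (- \<alpha>) p' q' G"
proof -
  have p1: "\<And>i. 1 \<le> p $ i" "\<And>i. 1 \<le> p' $ i" using p conjugate_ge_1 conjugate_sym by blast+
  obtain F' where F': "F' \<in> borel_measurable borel" "AE x in lebesgue. F x = F' x" using F by (rule borel_version)
  obtain G' where G': "G' \<in> borel_measurable borel" "AE x in lebesgue. G x = G' x" using G by (rule borel_version)
  note [measurable] = F'(1) G'(1)
  have "AE x in lebesgue. F x * G x = F' x * G' x" using F'(2) G'(2) by eventually_elim simp
  then have "(\<integral>\<^sup>+x. F x * G x \<partial>lebesgue) = (\<integral>\<^sup>+x. F' x * G' x \<partial>lebesgue)" by (rule nn_integral_cong_AE)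
  also have "\<dots> = fold coord_int (sorted_list_of_set UNIV) (\<lambda>x. F' x * G' x) 0"
    by (subst fold_coordinates_eq_nn_integral) (auto simp: nn_integral_completion)
  also have "\<dots> \<le> mixed_norm \<alpha> p q F' * mixed_norm (- \<alpha>) p' q' G'"
    unfolding mixed_norm_def by (rule fold_Holder[OF p q F'(1) G'(1)])
  also have "\<dots> = mixed_norm \<alpha> p q F * mixed_norm (- \<alpha>) p' q' G"
    using mixed_norm_cong_AE[OF p1(1) F'(2)] mixed_norm_cong_AE[OF p1(2) G'(2)] by simp
  finally show ?thesis .
qed

lemma mixed_duality_le:
  assumes p: "\<And>i. conjugate (p $ i) (p' $ i)" and q: "\<And>i. conjugate (q $ i) (q' $ i)"
    and G: "G \<in> borel_measurable lebesgue"
    and le: "\<And>F. F \<in> borel_measurable borel \<Longrightarrow> mixed_norm \<alpha> p q F \<le> 1 \<Longrightarrow> (\<integral>\<^sup>+x. F x * G x \<partial>lebesgue) \<le> C"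
  shows "mixed_norm (- \<alpha>) p' q' G \<le> C"
proof -
  have p1: "\<And>i. 1 \<le> p' $ i" using p conjugate_ge_1 conjugate_sym by blast
  obtain G' where G': "G' \<in> borel_measurable borel" "AE x in lebesgue. G x = G' x" using G by (rule borel_version)
  note [measurable] = G'(1)
  have "mixed_norm (- \<alpha>) p' q' G = mixed_norm (- \<alpha>) p' q' G'" by (rule mixed_norm_cong_AE[OF p1 G'(2)])
  also have "\<dots> \<le> (SUP F\<in>{F \<in> borel_measurable borel. \<forall>y. fold (partial_herz_norm \<alpha> p q) (sorted_list_of_set UNIV) F y \<le> 1}.
      fold coord_int (sorted_list_of_set UNIV) (\<lambda>y. F y * G' y) 0)"
    unfolding mixed_norm_def by (rule fold_duality[OF p q]) auto
  also have "\<dots> \<le> C"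
  proof (rule SUP_least)
    fix F assume F: "F \<in> {F \<in> borel_measurable borel. \<forall>y. fold (partial_herz_norm \<alpha> p q) (sorted_list_of_set UNIV) F y \<le> 1}"
    then have [measurable]: "F \<in> borel_measurable borel" by simp
    have "fold coord_int (sorted_list_of_set UNIV) (\<lambda>y. F y * G' y) 0 = (\<integral>\<^sup>+x. F x * G' x \<partial>lebesgue)"
      by (subst fold_coordinates_eq_nn_integral) (auto simp: nn_integral_completion)
    also have "\<dots> = (\<integral>\<^sup>+x. F x * G x \<partial>lebesgue)"
      using G'(2) by (intro nn_integral_cong_AE) (auto elim: eventually_mono)
    also have "\<dots> \<le> C" using F by (intro le) (auto simp: mixed_norm_def)
    finally show "fold coord_int (sorted_list_of_set UNIV) (\<lambda>y. F y * G' y) 0 \<le> C" .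
  qed
  finally show ?thesis .
qed

text \<open>
  By monotone convergence it suffices to test against the cut-offs of nonnegative functions at the
  multiples of a strictly positive function.
\<close>

lemma mixed_duality_le_truncated:
  fixes \<alpha> :: "real^'n::{finite,linorder}" and w :: "(real, 'n) vec \<Rightarrow> real"
  assumes p: "\<And>i. conjugate (p $ i) (p' $ i)" and q: "\<And>i. conjugate (q $ i) (q' $ i)"
    and G [measurable]: "G \<in> borel_measurable lebesgue"
    and w [measurable]: "w \<in> borel_measurable borel" and w_pos: "\<And>x. 0 < w x"
    and le: "\<And>K m. K \<in> borel_measurable borel \<Longrightarrow> (\<And>x. 0 \<le> K x) \<Longrightarrow> (\<And>x. K x \<le> real m * w x) \<Longrightarrow>
      mixed_norm \<alpha> p q (\<lambda>x. ennreal (K x)) \<le> 1 \<Longrightarrow> (\<integral>\<^sup>+x. ennreal (K x) * G x \<partial>lebesgue) \<le> C"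
  shows "mixed_norm (- \<alpha>) p' q' G \<le> C"
proof (rule mixed_duality_le[OF p q G])
  have p1: "\<And>i. 1 \<le> p $ i" and q1: "\<And>i. 1 \<le> q $ i"
    using p q conjugate_ge_1 by blast+
  fix F :: "(real, 'n) vec \<Rightarrow> ennreal" assume F [measurable]: "F \<in> borel_measurable borel" and F1: "mixed_norm \<alpha> p q F \<le> 1"
  have F_leb [measurable]: "F \<in> borel_measurable lebesgue" using F by (intro measurable_completion) simp
  define K where "K = (\<lambda>m x. enn2real (min (F x) (ennreal (real m * w x))))"
  have K_enn: "ennreal (K m x) = min (F x) (ennreal (real m * w x))" for m x
    unfolding K_def by (simp add: min_less_iff_disj)
  have K_le: "K m x \<le> real m * w x" for m x
  proof -
    have "ennreal (K m x) \<le> ennreal (real m * w x)" by (simp add: K_enn)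
    then show ?thesis using w_pos[of x] by (simp add: ennreal_le_iff)
  qed
  have K_nn: "0 \<le> K m x" for m x by (simp add: K_def)
  have K_meas [measurable]: "K m \<in> borel_measurable borel" for m unfolding K_def by measurable
  have K_leb [measurable]: "(\<lambda>x. ennreal (K m x)) \<in> borel_measurable lebesgue" for m
    by (intro measurable_completion) simp
  have step: "(\<integral>\<^sup>+x. ennreal (K m x) * G x \<partial>lebesgue) \<le> C" for m
  proof (rule le[OF K_meas K_nn K_le])
    have "mixed_norm \<alpha> p q (\<lambda>x. ennreal (K m x)) \<le> mixed_norm \<alpha> p q F"
      by (intro mixed_norm_mono[OF p1 q1 K_leb F_leb] AE_I2) (simp add: K_enn)
    then show "mixed_norm \<alpha> p q (\<lambda>x. ennreal (K m x)) \<le> 1" using F1 by (rule order_trans)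
  qed
  have SUP_K: "(SUP m. ennreal (K m x)) = F x" for x
  proof -
    have "(SUP m. ennreal (real m * w x)) = (SUP m. of_nat m * ennreal (w x))"
      using w_pos[of x] by (simp add: ennreal_mult ennreal_of_nat_eq_real_of_nat less_imp_le)
    also have "\<dots> = top"
      using w_pos[of x] by (simp add: SUP_mult_right_ennreal[symmetric] ennreal_SUP_of_nat_eq_top ennreal_top_mult)
    finally have "inf (F x) (SUP m. ennreal (real m * w x)) = F x" by (simp only: inf_top_right)
    then show ?thesis by (simp only: K_enn inf_min[symmetric] inf_SUP)
  qed
  have "(\<integral>\<^sup>+x. F x * G x \<partial>lebesgue) = (\<integral>\<^sup>+x. (SUP m. ennreal (K m x) * G x) \<partial>lebesgue)"
    by (simp add: SUP_mult_right_ennreal[symmetric] SUP_K)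
  also have "\<dots> = (SUP m. \<integral>\<^sup>+x. ennreal (K m x) * G x \<partial>lebesgue)"
  proof (rule nn_integral_monotone_convergence_SUP)
    show "incseq (\<lambda>m x. ennreal (K m x) * G x)"
      unfolding K_enn using w_pos
      by (intro incseq_SucI le_funI mult_right_mono min.mono order_refl ennreal_leI) (auto simp: less_imp_le)
  qed measurable
  also have "\<dots> \<le> C" by (intro SUP_least step)
  finally show "(\<integral>\<^sup>+x. F x * G x \<partial>lebesgue) \<le> C" .
qed

text \<open>
  By duality the norm is a supremum of additive functionals.
\<close>

lemma mixed_norm_add_le:
  assumes p: "\<And>i. conjugate (p $ i) (p' $ i)" and q: "\<And>i. conjugate (q $ i) (q' $ i)"
    and [measurable]: "F \<in> borel_measurable lebesgue" "G \<in> borel_measurable lebesgue"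
  shows "mixed_norm \<alpha> p q (\<lambda>x. F x + G x) \<le> mixed_norm \<alpha> p q F + mixed_norm \<alpha> p q G"
proof -
  note pp = conjugate_sym[OF p] and qq = conjugate_sym[OF q]
  have "mixed_norm (- (- \<alpha>)) p q (\<lambda>x. F x + G x) \<le> mixed_norm \<alpha> p q F + mixed_norm \<alpha> p q G"
  proof (rule mixed_duality_le[OF pp qq])
    fix H assume H: "H \<in> borel_measurable borel" "mixed_norm (- \<alpha>) p' q' H \<le> 1"
    have [measurable]: "H \<in> borel_measurable lebesgue" using H(1) by (intro measurable_completion) simp
    have Hold: "(\<integral>\<^sup>+x. H x * K x \<partial>lebesgue) \<le> mixed_norm \<alpha> p q K" if [measurable]: "K \<in> borel_measurable lebesgue" for K
    proof -
      have "(\<integral>\<^sup>+x. H x * K x \<partial>lebesgue) \<le> mixed_norm (- \<alpha>) p' q' H * mixed_norm (- (- \<alpha>)) p q K"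
        by (rule mixed_Holder[OF pp qq]) measurable
      also have "\<dots> \<le> 1 * mixed_norm (- (- \<alpha>)) p q K" by (intro mult_right_mono H) simp
      finally show ?thesis by simp
    qed
    have "(\<integral>\<^sup>+x. H x * (F x + G x) \<partial>lebesgue) = (\<integral>\<^sup>+x. H x * F x \<partial>lebesgue) + (\<integral>\<^sup>+x. H x * G x \<partial>lebesgue)"
      by (simp add: distrib_left nn_integral_add)
    also have "\<dots> \<le> mixed_norm \<alpha> p q F + mixed_norm \<alpha> p q G"
      by (intro add_mono Hold) measurable
    finally show "(\<integral>\<^sup>+x. H x * (F x + G x) \<partial>lebesgue) \<le> mixed_norm \<alpha> p q F + mixed_norm \<alpha> p q G" .
  qed measurable
  then show ?thesis by simp
qed

lemma mixed_norm_decreasing_to_0: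
  assumes p: "\<And>i. 1 \<le> p $ i \<and> p $ i < \<infinity>" and q: "\<And>i. 1 \<le> q $ i \<and> q $ i < \<infinity>"
    and "\<And>n. F n \<in> borel_measurable borel" and dec: "decseq F" "\<And>x. (INF n. F n x) = 0"
    and "mixed_norm \<alpha> p q (F 0) < \<infinity>"
  shows "(\<lambda>n. mixed_norm \<alpha> p q (F n)) \<longlonglongrightarrow> 0"
proof -
  have p1: "\<And>i. 1 \<le> p $ i" and q1: "\<And>i. 1 \<le> q $ i" using p q by auto
  have "decseq (\<lambda>n. mixed_norm \<alpha> p q (F n))"
    unfolding mixed_norm_def using assms(3) dec(1)
    by (intro decseq_SucI fold_partial_herz_norm_mono[OF p1 q1, THEN le_funD]) (auto simp: decseq_SucD)
  then have "(\<lambda>n. mixed_norm \<alpha> p q (F n)) \<longlonglongrightarrow> (INF n. mixed_norm \<alpha> p q (F n))"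
    by (rule LIMSEQ_INF)
  also have "(INF n. mixed_norm \<alpha> p q (F n)) = 0"
    using assms unfolding mixed_norm_def by (intro fold_partial_herz_norm_decreasing_to_0) auto
  finally show ?thesis .
qed

lemma mixed_herz_spaceI:
  "f \<in> borel_measurable lebesgue \<Longrightarrow> mixed_norm \<alpha> p q (\<lambda>x. ennreal (norm (f x))) < \<infinity> \<Longrightarrow> f \<in> mixed_herz_space \<alpha> p q"
  by (simp add: mixed_herz_space_def mixed_herz_norm_eq)

lemma mixed_herz_spaceD:
  assumes "f \<in> mixed_herz_space \<alpha> p q"
  shows "f \<in> borel_measurable lebesgue" "mixed_norm \<alpha> p q (\<lambda>x. ennreal (norm (f x))) < \<infinity>"
  using assms by (simp_all add: mixed_herz_space_def mixed_herz_norm_eq)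

lemma mixed_norm_zero:
  assumes p: "\<And>i. 1 \<le> p $ i" and q: "\<And>i. 1 \<le> q $ i"
  shows "mixed_norm \<alpha> p q (\<lambda>x. 0) = 0"
  using mixed_norm_cmult_le[OF p q, of "\<lambda>x. 0" \<alpha> 0] by simp

lemma mixed_herz_space_zero:
  assumes "\<And>i. 1 \<le> p $ i" and "\<And>i. 1 \<le> q $ i"
  shows "(\<lambda>x. 0) \<in> mixed_herz_space \<alpha> p q"
  using mixed_norm_zero[OF assms] by (intro mixed_herz_spaceI) auto

lemma mixed_herz_space_mono:
  assumes p: "\<And>i. 1 \<le> p $ i" and q: "\<And>i. 1 \<le> q $ i"
    and f: "f \<in> borel_measurable lebesgue" and h: "h \<in> mixed_herz_space \<alpha> p q"
    and le: "\<And>x. norm (f x) \<le> norm (h x)"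
  shows "f \<in> mixed_herz_space \<alpha> p q" "mixed_herz_norm \<alpha> p q f \<le> mixed_herz_norm \<alpha> p q h"
proof -
  note [measurable] = f mixed_herz_spaceD(1)[OF h]
  show "mixed_herz_norm \<alpha> p q f \<le> mixed_herz_norm \<alpha> p q h"
    unfolding mixed_herz_norm_eq using le by (intro mixed_norm_mono[OF p q] AE_I2) (auto intro: ennreal_leI)
  then show "f \<in> mixed_herz_space \<alpha> p q"
    using f h by (auto simp: mixed_herz_space_def)
qed

lemma mixed_herz_space_add:
  assumes p: "\<And>i. conjugate (p $ i) (p' $ i)" and q: "\<And>i. conjugate (q $ i) (q' $ i)"
    and f: "f \<in> mixed_herz_space \<alpha> p q" and h: "h \<in> mixed_herz_space \<alpha> p q"
  shows "(\<lambda>x. f x + h x :: 'b::euclidean_space) \<in> mixed_herz_space \<alpha> p q"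
proof -
  have p1: "\<And>i. 1 \<le> p $ i" and q1: "\<And>i. 1 \<le> q $ i"
    using p q conjugate_ge_1 by blast+
  note [measurable] = mixed_herz_spaceD(1)[OF f] mixed_herz_spaceD(1)[OF h]
  have "mixed_norm \<alpha> p q (\<lambda>x. ennreal (norm (f x + h x)))
      \<le> mixed_norm \<alpha> p q (\<lambda>x. ennreal (norm (f x)) + ennreal (norm (h x)))"
    by (intro mixed_norm_mono[OF p1 q1] AE_I2) (auto simp flip: ennreal_plus intro!: ennreal_leI norm_triangle_ineq)
  also have "\<dots> \<le> mixed_norm \<alpha> p q (\<lambda>x. ennreal (norm (f x))) + mixed_norm \<alpha> p q (\<lambda>x. ennreal (norm (h x)))"
    by (intro mixed_norm_add_le[OF p q]) measurable
  also have "\<dots> < \<infinity>" using mixed_herz_spaceD(2)[OF f] mixed_herz_spaceD(2)[OF h] by simp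
  finally show ?thesis by (intro mixed_herz_spaceI) measurable
qed

lemma mixed_herz_norm_scale:
  fixes f :: "_ \<Rightarrow> 'b::euclidean_space"
  assumes p: "\<And>i. 1 \<le> p $ i" and q: "\<And>i. 1 \<le> q $ i" and f: "f \<in> borel_measurable lebesgue"
    and h: "\<And>x. norm (h x) = \<bar>c\<bar> * norm (f x)"
  shows "mixed_herz_norm \<alpha> p q h \<le> ennreal \<bar>c\<bar> * mixed_herz_norm \<alpha> p q f"
  unfolding mixed_herz_norm_eq h using f by (auto simp: ennreal_mult intro!: mixed_norm_cmult_le[OF p q])

lemma mixed_herz_space_scale:
  fixes f :: "_ \<Rightarrow> 'b::euclidean_space" and h :: "_ \<Rightarrow> 'c::real_normed_vector"
  assumes p: "\<And>i. 1 \<le> p $ i" and q: "\<And>i. 1 \<le> q $ i" and f: "f \<in> mixed_herz_space \<alpha> p q"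
    and "h \<in> borel_measurable lebesgue" and "\<And>x. norm (h x) = \<bar>c\<bar> * norm (f x)"
  shows "h \<in> mixed_herz_space \<alpha> p q"
  using mixed_herz_norm_scale[OF p q mixed_herz_spaceD(1)[OF f] assms(5), of \<alpha>] assms(4) f
  by (auto simp: mixed_herz_space_def ennreal_mult_less_top intro: le_less_trans)

lemma integrable_product:
  fixes f g :: "_ \<Rightarrow> 'b::{real_normed_field,euclidean_space}"
  assumes p: "\<And>i. conjugate (p $ i) (p' $ i)" and q: "\<And>i. conjugate (q $ i) (q' $ i)"
    and f: "f \<in> mixed_herz_space \<alpha> p q" and g: "g \<in> mixed_herz_space (- \<alpha>) p' q'"
  shows "integrable lebesgue (\<lambda>x. f x * g x)"
    and "ennreal (norm (LINT x|lebesgue. f x * g x)) \<le> mixed_herz_norm \<alpha> p q f * mixed_herz_norm (- \<alpha>) p' q' g"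
proof -
  note [measurable] = mixed_herz_spaceD(1)[OF f] mixed_herz_spaceD(1)[OF g]
  have le: "(\<integral>\<^sup>+x. ennreal (norm (f x * g x)) \<partial>lebesgue) \<le> mixed_herz_norm \<alpha> p q f * mixed_herz_norm (- \<alpha>) p' q' g"
    unfolding mixed_herz_norm_eq norm_mult ennreal_mult[OF norm_ge_zero norm_ge_zero]
    by (intro mixed_Holder[OF p q]) measurable
  also have "\<dots> < \<infinity>"
    using f g by (auto simp: mixed_herz_space_def ennreal_mult_less_top)
  finally show I: "integrable lebesgue (\<lambda>x. f x * g x)"
    by (intro integrableI_bounded) measurable
  show "ennreal (norm (LINT x|lebesgue. f x * g x)) \<le> mixed_herz_norm \<alpha> p q f * mixed_herz_norm (- \<alpha>) p' q' g"
    using integral_norm_bound_ennreal[OF I] le by (rule order_trans)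
qed

section \<open>A Radon--Nikodym theorem for bounded signed measures\<close>

lemma countably_additive_imp_additive:
  fixes t :: "'a set \<Rightarrow> real"
  assumes sums: "\<And>A :: nat \<Rightarrow> 'a set. range A \<subseteq> sets M \<Longrightarrow> disjoint_family A \<Longrightarrow> (\<lambda>n. t (A n)) sums t (\<Union>n. A n)"
  shows "t {} = 0" "\<And>S T. S \<in> sets M \<Longrightarrow> T \<in> sets M \<Longrightarrow> S \<inter> T = {} \<Longrightarrow> t (S \<union> T) = t S + t T"
proof -
  have "(\<lambda>n::nat. t {}) sums t {}" using sums[of "\<lambda>_. {}"] by (simp add: disjoint_family_on_def)
  then show t_empty: "t {} = 0" by (metis sums_summable summable_const_iff)
  fix S T assume "S \<in> sets M" "T \<in> sets M" "S \<inter> T = {}"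
  then have "(\<lambda>n. t (binaryset S T n)) sums t (\<Union>n. binaryset S T n)"
    by (intro sums) (auto simp: binaryset_def disjoint_family_on_def)
  moreover have "(\<lambda>n. t (binaryset S T n)) sums (t S + t T)"
    by (rule binaryset_sums) (rule t_empty)
  ultimately show "t (S \<union> T) = t S + t T" by (simp add: UN_binaryset_eq sums_unique2)
qed

text \<open>
  The positive part of the Jordan decomposition. Truncation of negative values by \<open>ennreal\<close> is
  harmless, because the empty set competes in the supremum with the value 0.
\<close>

lemma positive_variation_measure:
  fixes t :: "'a set \<Rightarrow> real"
  assumes sums: "\<And>A :: nat \<Rightarrow> 'a set. range A \<subseteq> sets M \<Longrightarrow> disjoint_family A \<Longrightarrow> (\<lambda>n. t (A n)) sums t (\<Union>n. A n)"
  obtains \<nu> where "sets \<nu> = sets M"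
    and "\<And>A. A \<in> sets M \<Longrightarrow> emeasure \<nu> A = (SUP S\<in>{S \<in> sets M. S \<subseteq> A}. ennreal (t S))"
proof -
  define \<mu> where "\<mu> = (\<lambda>A. SUP S\<in>{S \<in> sets M. S \<subseteq> A}. ennreal (t S))"
  have mu_eq: "\<mu> A = (SUP S\<in>{S \<in> sets M. S \<subseteq> A}. ennreal (t S))" for A
    by (simp add: \<mu>_def)
  note t_empty = countably_additive_imp_additive(1)[of M t, OF sums]
    and t_Un = countably_additive_imp_additive(2)[of M t, OF sums]
  have mu_mono: "\<mu> A \<le> \<mu> B" if "A \<subseteq> B" for A B
    unfolding \<mu>_def using that by (intro SUP_subset_mono) auto
  have mu_add: "\<mu> A + \<mu> B \<le> \<mu> (A \<union> B)" if AB: "A \<in> sets M" "B \<in> sets M" "A \<inter> B = {}" for A B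
  proof -
    have nonneg: "\<exists>S'\<in>sets M. S' \<subseteq> S \<and> 0 \<le> t S' \<and> ennreal (t S) = ennreal (t S')" if "S \<in> sets M" for S
    proof (cases "0 \<le> t S")
      case True with that show ?thesis by blast
    next
      case False then show ?thesis by (intro bexI[of _ "{}"]) (simp_all add: t_empty ennreal_neg)
    qed
    have *: "ennreal (t S) + ennreal (t T) \<le> \<mu> (A \<union> B)"
      if S: "S \<in> {S \<in> sets M. S \<subseteq> A}" and T: "T \<in> {S \<in> sets M. S \<subseteq> B}" for S T
    proof -
      obtain S' T' where S': "S' \<in> sets M" "S' \<subseteq> S" "0 \<le> t S'" "ennreal (t S) = ennreal (t S')"
        and T': "T' \<in> sets M" "T' \<subseteq> T" "0 \<le> t T'" "ennreal (t T) = ennreal (t T')"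
        using nonneg[of S] nonneg[of T] S T by auto
      have "S' \<inter> T' = {}" using S T S'(2) T'(2) AB(3) by blast
      then have "t (S' \<union> T') = t S' + t T'" using S' T' by (intro t_Un) auto
      then have "ennreal (t S) + ennreal (t T) = ennreal (t (S' \<union> T'))" using S' T' by (simp add: ennreal_plus)
      also have "\<dots> \<le> \<mu> (A \<union> B)" unfolding \<mu>_def using S T S' T' by (intro SUP_upper) auto
      finally show ?thesis .
    qed
    have ne: "{S \<in> sets M. S \<subseteq> C} \<noteq> {}" for C by blast
    have "\<mu> A + \<mu> B = (SUP T\<in>{S \<in> sets M. S \<subseteq> B}. SUP S\<in>{S \<in> sets M. S \<subseteq> A}. ennreal (t S) + ennreal (t T))"
      unfolding \<mu>_def by (simp only: ennreal_SUP_add_left[OF ne, symmetric] ennreal_SUP_add_right[OF ne])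
    also have "\<dots> \<le> \<mu> (A \<union> B)" by (intro SUP_least *)
    finally show ?thesis .
  qed
  have mu_sum: "(\<Sum>i<n. \<mu> (A i)) \<le> \<mu> (\<Union>i<n. A i)"
    if "range A \<subseteq> sets M" "disjoint_family A" for A :: "nat \<Rightarrow> 'a set" and n
  proof (induction n)
    case (Suc n)
    have "(\<Sum>i<Suc n. \<mu> (A i)) \<le> \<mu> (\<Union>i<n. A i) + \<mu> (A n)" using Suc by (simp add: add_right_mono)
    also have "\<dots> \<le> \<mu> ((\<Union>i<n. A i) \<union> A n)"
    proof (rule mu_add)
      have "A i \<inter> A n = {}" if "i < n" for i
        using that \<open>disjoint_family A\<close> by (simp add: disjoint_family_on_def)
      then show "(\<Union>i<n. A i) \<inter> A n = {}" by blast
    qed (use that in auto)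
    also have "(\<Union>i<n. A i) \<union> A n = (\<Union>i<Suc n. A i)" by (auto simp: less_Suc_eq)
    finally show ?case .
  qed simp
  have "countably_additive (sets M) \<mu>"
  proof (rule countably_additiveI)
    fix A :: "nat \<Rightarrow> 'a set" assume A: "range A \<subseteq> sets M" "disjoint_family A" "(\<Union>i. A i) \<in> sets M"
    show "(\<Sum>i. \<mu> (A i)) = \<mu> (\<Union>i. A i)"
    proof (rule antisym)
      have "(\<Sum>i<n. \<mu> (A i)) \<le> \<mu> (\<Union>i. A i)" for n
        using mu_sum[OF A(1,2), of n] mu_mono[of "\<Union>i<n. A i" "\<Union>i. A i"] by (auto intro: order_trans)
      then show "(\<Sum>i. \<mu> (A i)) \<le> \<mu> (\<Union>i. A i)" by (simp add: suminf_eq_SUP SUP_least)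
      show "\<mu> (\<Union>i. A i) \<le> (\<Sum>i. \<mu> (A i))"
        unfolding mu_eq[of "\<Union>i. A i"]
      proof (rule SUP_least)
        fix S assume S: "S \<in> {S \<in> sets M. S \<subseteq> (\<Union>i. A i)}"
        then have "(\<lambda>n. t (S \<inter> A n)) sums t (\<Union>n. S \<inter> A n)"
          using A by (intro sums) (auto simp: disjoint_family_on_def)
        also have "(\<Union>n. S \<inter> A n) = S" using S by auto
        finally have "(\<lambda>n. ennreal (\<Sum>i<n. t (S \<inter> A i))) \<longlonglongrightarrow> ennreal (t S)"
          unfolding sums_def by (rule tendsto_ennrealI)
        moreover have "ennreal (\<Sum>i<n. t (S \<inter> A i)) \<le> (\<Sum>i. \<mu> (A i))" for n
        proof -
          have "ennreal (\<Sum>i<n. t (S \<inter> A i)) \<le> ennreal (\<Sum>i<n. max 0 (t (S \<inter> A i)))"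
            by (intro ennreal_leI sum_mono) auto
          also have "\<dots> = (\<Sum>i<n. ennreal (max 0 (t (S \<inter> A i))))"
            by (rule sum_ennreal[symmetric]) simp
          also have "\<dots> = (\<Sum>i<n. ennreal (t (S \<inter> A i)))"
            by (intro sum.cong refl) (auto simp: max_def ennreal_neg)
          also have "\<dots> \<le> (\<Sum>i<n. \<mu> (A i))"
            unfolding \<mu>_def using S A by (intro sum_mono SUP_upper) auto
          also have "\<dots> \<le> (\<Sum>i. \<mu> (A i))" by (intro sum_le_suminf) auto
          finally show ?thesis .
        qed
        ultimately show "ennreal (t S) \<le> (\<Sum>i. \<mu> (A i))" by (intro LIMSEQ_le_const2) auto
      qed
    qed
  qed
  moreover have "positive (sets M) \<mu>"
  proof -
    have "{S \<in> sets M. S \<subseteq> {}} = {{}}" by auto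
    then show ?thesis by (simp add: positive_def \<mu>_def t_empty)
  qed
  ultimately have "emeasure (measure_of (space M) (sets M) \<mu>) A = \<mu> A" if "A \<in> sets M" for A
    using that by (intro emeasure_measure_of_sigma) (auto simp: sets.sigma_algebra_axioms)
  moreover have "sets (measure_of (space M) (sets M) \<mu>) = sets M" by simp
  ultimately show thesis using that unfolding \<mu>_def by blast
qed

lemma positive_variation_density:
  fixes t :: "'a set \<Rightarrow> real"
  assumes M: "sigma_finite_measure M"
    and sums: "\<And>A :: nat \<Rightarrow> 'a set. range A \<subseteq> sets M \<Longrightarrow> disjoint_family A \<Longrightarrow> (\<lambda>n. t (A n)) sums t (\<Union>n. A n)"
    and bounded: "\<And>A. A \<in> sets M \<Longrightarrow> \<bar>t A\<bar> \<le> B"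
    and null: "\<And>A. A \<in> null_sets M \<Longrightarrow> t A = 0"
  obtains f where "integrable M f"
    "\<And>A S. A \<in> sets M \<Longrightarrow> S \<in> sets M \<Longrightarrow> S \<subseteq> A \<Longrightarrow> t S \<le> (LINT x|M. f x * indicator A x)"
    "\<And>A c. A \<in> sets M \<Longrightarrow> 0 \<le> c \<Longrightarrow> (\<forall>S\<in>sets M. S \<subseteq> A \<longrightarrow> t S \<le> c) \<Longrightarrow>
      (LINT x|M. f x * indicator A x) \<le> c"
proof -
  interpret sigma_finite_measure M by (rule M)
  obtain \<nu> where \<nu>: "sets \<nu> = sets M"
    "\<And>A. A \<in> sets M \<Longrightarrow> emeasure \<nu> A = (SUP S\<in>{S \<in> sets M. S \<subseteq> A}. ennreal (t S))"
    by (rule positive_variation_measure[where M = M and t = t]) ((rule sums; assumption), rule that)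
  have "absolutely_continuous M \<nu>"
    unfolding absolutely_continuous_def
  proof
    fix A assume A: "A \<in> null_sets M"
    then have A': "A \<in> sets M" by auto
    have "emeasure \<nu> A \<le> 0"
      unfolding \<nu>(2)[OF A']
    proof (rule SUP_least)
      fix S assume "S \<in> {S \<in> sets M. S \<subseteq> A}"
      then have "S \<in> null_sets M" using null_sets_subset[OF A] by auto
      then show "ennreal (t S) \<le> 0" by (simp add: null)
    qed
    then show "A \<in> null_sets \<nu>" using A' \<nu>(1) by (auto simp: null_sets_def)
  qed
  then obtain f where f [measurable]: "f \<in> borel_measurable M" and dens: "density M f = \<nu>"
    using Radon_Nikodym \<nu>(1) by blast
  have f_int: "(\<integral>\<^sup>+x. f x * indicator A x \<partial>M) = emeasure \<nu> A" if "A \<in> sets M" for A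
    using that dens emeasure_density[OF f that] by simp
  have "emeasure \<nu> (space M) \<le> ennreal B"
    unfolding \<nu>(2)[OF sets.top] by (intro SUP_least ennreal_leI) (use bounded abs_le_D1 in blast)
  also have "\<dots> < \<infinity>" by simp
  also have "emeasure \<nu> (space M) = (\<integral>\<^sup>+x. f x \<partial>M)"
    unfolding f_int[OF sets.top, symmetric] by (intro nn_integral_cong) simp
  finally have fin: "(\<integral>\<^sup>+x. f x \<partial>M) < \<infinity>" .
  then have fin_AE: "AE x in M. f x \<noteq> \<infinity>" by (intro nn_integral_PInf_AE) auto
  have int: "integrable M (\<lambda>x. enn2real (f x))"
  proof (rule integrableI_bounded)
    have "(\<integral>\<^sup>+x. ennreal (norm (enn2real (f x))) \<partial>M) = (\<integral>\<^sup>+x. f x \<partial>M)"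
      using fin_AE by (intro nn_integral_cong_AE) (auto simp: less_top)
    then show "(\<integral>\<^sup>+x. ennreal (norm (enn2real (f x))) \<partial>M) < \<infinity>" using fin by simp
  qed measurable
  have var: "(SUP S\<in>{S \<in> sets M. S \<subseteq> A}. ennreal (t S)) = ennreal (LINT x|M. enn2real (f x) * indicator A x)"
    if A: "A \<in> sets M" for A
  proof -
    have "emeasure \<nu> A = (\<integral>\<^sup>+x. ennreal (enn2real (f x) * indicator A x) \<partial>M)"
      unfolding f_int[OF A, symmetric] using fin_AE
      by (intro nn_integral_cong_AE) (auto simp: less_top indicator_def elim!: eventually_mono)
    also have "\<dots> = ennreal (LINT x|M. enn2real (f x) * indicator A x)"
      by (intro nn_integral_eq_integral integrable_real_mult_indicator int A) auto
    finally show ?thesis using \<nu>(2)[OF A] by simp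
  qed
  show thesis
  proof (rule that[OF int])
    fix A assume A: "A \<in> sets M"
    have "ennreal (t S) \<le> ennreal (LINT x|M. enn2real (f x) * indicator A x)" if "S \<in> sets M" "S \<subseteq> A" for S
      unfolding var[OF A, symmetric] using that by (intro SUP_upper) auto
    then show "t S \<le> (LINT x|M. enn2real (f x) * indicator A x)" if "S \<in> sets M" "S \<subseteq> A" for S
      using that by (simp add: ennreal_le_iff)
    fix c :: real assume c: "0 \<le> c" "\<forall>S\<in>sets M. S \<subseteq> A \<longrightarrow> t S \<le> c"
    have "ennreal (LINT x|M. enn2real (f x) * indicator A x) \<le> ennreal c"
      unfolding var[OF A, symmetric] using c by (intro SUP_least ennreal_leI) auto
    then show "(LINT x|M. enn2real (f x) * indicator A x) \<le> c" using c(1) by (simp add: ennreal_le_iff)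
  qed
qed

text \<open>
  For \<open>S \<subseteq> A\<close>, the identity \<open>s S = s A - s (A - S)\<close> bounds the positive variation of \<open>s\<close> on \<open>A\<close> by \<open>s A\<close> plus the
  negative variation, and conversely. Hence \<open>s\<close> is the difference of its two variations, which have
  densities by the theorem for positive measures.
\<close>

lemma signed_Radon_Nikodym:
  fixes s :: "'a set \<Rightarrow> real"
  assumes M: "sigma_finite_measure M"
    and sums: "\<And>A :: nat \<Rightarrow> 'a set. range A \<subseteq> sets M \<Longrightarrow> disjoint_family A \<Longrightarrow> (\<lambda>n. s (A n)) sums s (\<Union>n. A n)"
    and bounded: "\<And>A. A \<in> sets M \<Longrightarrow> \<bar>s A\<bar> \<le> B"
    and null: "\<And>A. A \<in> null_sets M \<Longrightarrow> s A = 0"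
  obtains h where "integrable M h" "\<And>A. A \<in> sets M \<Longrightarrow> s A = (LINT x|M. h x * indicator A x)"
proof -
  obtain f where f: "integrable M f"
    and f_upper: "\<And>A S. A \<in> sets M \<Longrightarrow> S \<in> sets M \<Longrightarrow> S \<subseteq> A \<Longrightarrow> s S \<le> (LINT x|M. f x * indicator A x)"
    and f_least: "\<And>A c. A \<in> sets M \<Longrightarrow> 0 \<le> c \<Longrightarrow> (\<forall>S\<in>sets M. S \<subseteq> A \<longrightarrow> s S \<le> c) \<Longrightarrow>
      (LINT x|M. f x * indicator A x) \<le> c"
    by (rule positive_variation_density[of M s B];
      (rule M | rule sums; assumption | rule bounded; assumption | rule null; assumption | rule that))
  obtain g where g: "integrable M g"
    and g_upper: "\<And>A S. A \<in> sets M \<Longrightarrow> S \<in> sets M \<Longrightarrow> S \<subseteq> A \<Longrightarrow> - s S \<le> (LINT x|M. g x * indicator A x)"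
    and g_least: "\<And>A c. A \<in> sets M \<Longrightarrow> 0 \<le> c \<Longrightarrow> (\<forall>S\<in>sets M. S \<subseteq> A \<longrightarrow> - s S \<le> c) \<Longrightarrow>
      (LINT x|M. g x * indicator A x) \<le> c"
  proof (rule positive_variation_density[of M "\<lambda>A. - s A" B])
    show "(\<lambda>n. - s (A n)) sums - s (\<Union>n. A n)" if "range A \<subseteq> sets M" "disjoint_family A" for A :: "nat \<Rightarrow> 'a set"
      using sums[OF that] by (rule sums_minus)
  qed (use M bounded null that in auto)
  have split: "s A = s S + s (A - S)" if "A \<in> sets M" "S \<in> sets M" "S \<subseteq> A" for A S
    using countably_additive_imp_additive(2)[of M s, OF sums, of S "A - S"] that by (simp add: Un_absorb1)
  show thesis
  proof (rule that[of "\<lambda>x. f x - g x"])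
    show "integrable M (\<lambda>x. f x - g x)" using f g by simp
    fix A assume A: "A \<in> sets M"
    let ?a = "LINT x|M. f x * indicator A x" and ?b = "LINT x|M. g x * indicator A x"
    have "s S \<le> s A + ?b" "- s S \<le> - s A + ?a" if S: "S \<in> sets M" "S \<subseteq> A" for S
      using split[OF A S] f_upper[OF A, of "A - S"] g_upper[OF A, of "A - S"] A S by auto
    moreover have "0 \<le> s A + ?b" "0 \<le> - s A + ?a" using f_upper[OF A A] g_upper[OF A A] by auto
    ultimately have "?a \<le> s A + ?b" "?b \<le> - s A + ?a"
      by (auto intro!: f_least[OF A] g_least[OF A])
    moreover have "(LINT x|M. (f x - g x) * indicator A x) = ?a - ?b"
      using f g A by (simp add: left_diff_distrib integrable_real_mult_indicator)
    ultimately show "s A = (LINT x|M. (f x - g x) * indicator A x)" by simp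
  qed
qed

section \<open>A strictly positive function of finite mixed norm\<close>

lemma Lp_indicator_shell_finite:
  assumes "1 \<le> q" shows "Lp lborel q (indicator (dyadic_shell k)) < \<infinity>"
  using assms
proof (cases rule: ge_1_cases)
  case 1
  have "esssup lborel (indicator (dyadic_shell k) :: real \<Rightarrow> ennreal) \<le> 1"
    by (intro esssup_I) (auto simp: indicator_def)
  then show ?thesis unfolding 1 Lp_top by (rule le_less_trans) simp
next
  case (2 a)
  have "emeasure lborel (dyadic_shell k) \<le> emeasure lborel {- ((2::real) powi k)..2 powi k}"
    by (intro emeasure_mono) (auto simp: dyadic_shell_def)
  also have "\<dots> < \<infinity>" by simp
  finally have "emeasure lborel (dyadic_shell k) < \<infinity>" .
  moreover have "(\<integral>\<^sup>+t. epowr (indicator (dyadic_shell k) t) a \<partial>lborel) = (\<integral>\<^sup>+t. indicator (dyadic_shell k) t \<partial>lborel)"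
    by (intro nn_integral_cong) (auto simp: indicator_def)
  ultimately show ?thesis using 2 by (simp add: Lp_ennreal)
qed

lemma positive_function_herz_finite:
  assumes p: "1 \<le> p" "p < \<infinity>" and q: "1 \<le> q"
  obtains u :: "real \<Rightarrow> real" where "u \<in> borel_measurable borel" "\<And>t. 0 < u t" "herz a p q (\<lambda>t. ennreal (u t)) < \<infinity>"
proof -
  let ?L = "\<lambda>k. Lp lborel q (indicator (dyadic_shell k))"
  define c where "c = (\<lambda>k::int. (1 / 2) ^ int_encode k / (2 powr (of_int k * a) * (1 + enn2real (?L k))) :: real)"
  have c: "0 < c k" for k
    unfolding c_def by (intro divide_pos_pos mult_pos_pos) (auto intro: add_pos_nonneg)
  \<comment> \<open>The value \<open>c k\<close> on the \<open>k\<close>-th shell is chosen to make the sum over the shells geometric.\<close>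
  have c_le: "shell_weight a k * (ennreal (c k) * ?L k) \<le> ennreal ((1 / 2) ^ int_encode k)" for k
  proof -
    have "?L k = ennreal (enn2real (?L k))" using Lp_indicator_shell_finite[OF q, of k] by (simp add: less_top)
    then have "shell_weight a k * (ennreal (c k) * ?L k) = ennreal (2 powr (of_int k * a) * (c k * enn2real (?L k)))"
      using c[of k] by (simp add: shell_weight_def ennreal_mult less_imp_le)
    also have "2 powr (of_int k * a) * (c k * enn2real (?L k)) = (1 / 2) ^ int_encode k * (enn2real (?L k) / (1 + enn2real (?L k)))"
      by (simp add: c_def)
    also have "ennreal \<dots> \<le> ennreal ((1 / 2) ^ int_encode k * 1)"
      by (intro ennreal_leI mult_left_mono) (auto simp: divide_le_eq_1 add_pos_nonneg)
    finally show ?thesis by simp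
  qed
  define U where "U = (\<lambda>t. \<integral>\<^sup>+k. indicator (dyadic_shell k) t * ennreal (c k) \<partial>count_space UNIV)"
  define u where "u = (\<lambda>t. if t = 0 then 1 else enn2real (U t))"
  interpret count: sigma_finite_measure "count_space (UNIV :: int set)"
    by (rule sigma_finite_measure_count_space)
  have [measurable]: "U \<in> borel_measurable borel"
    unfolding U_def indicator_dyadic_shell by measurable
  have u_meas [measurable]: "u \<in> borel_measurable borel" unfolding u_def by measurable
  have U_eq: "U t = ennreal (c k)" if "t \<in> dyadic_shell k" for t k
    unfolding U_def by (rule nn_integral_dyadic_shell[OF that])
  have nz: "t \<noteq> 0" if "t \<in> dyadic_shell k" for t k
  proof
    assume "t = 0"
    then have "2 powi (k - 1) \<le> (0::real)" using that by (simp only: mem_dyadic_shell abs_zero)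
    moreover have "(0::real) < 2 powi (k - 1)" by simp
    ultimately show False by linarith
  qed
  have u_eq: "u t = c k" if "t \<in> dyadic_shell k" for t k
    using U_eq[OF that] nz[OF that] c[of k] by (simp add: u_def)
  have u_pos: "0 < u t" for t
  proof (cases "t = 0")
    case False
    then obtain k where "t \<in> dyadic_shell k" using dyadic_shell_exists by blast
    then show ?thesis using u_eq c by simp
  qed (simp add: u_def)
  have "herz a p q (\<lambda>t. ennreal (u t)) \<le> Lp (count_space UNIV) p (\<lambda>k. ennreal ((1 / 2) ^ int_encode k))"
    unfolding herz_def
  proof (intro Lp_mono p)
    fix k
    have "Lp lborel q (\<lambda>t. ennreal (u t) * indicator (dyadic_shell k) t)
        = Lp lborel q (\<lambda>t. ennreal (c k) * indicator (dyadic_shell k) t)"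
      by (intro arg_cong[where f = "Lp lborel q"] ext) (auto simp: indicator_def u_eq)
    also have "\<dots> \<le> ennreal (c k) * ?L k" by (intro Lp_cmult_le q) simp
    finally have "shell_weight a k * Lp lborel q (\<lambda>t. ennreal (u t) * indicator (dyadic_shell k) t)
        \<le> shell_weight a k * (ennreal (c k) * ?L k)" by (rule mult_left_mono) simp
    then show "shell_weight a k * Lp lborel q (\<lambda>t. ennreal (u t) * indicator (dyadic_shell k) t)
        \<le> ennreal ((1 / 2) ^ int_encode k)" using c_le by (rule order_trans)
  qed simp
  also have "\<dots> < \<infinity>"
  proof -
    obtain b where b: "p = ennreal b" "1 \<le> b" using p by (auto elim: ge_1_cases)
    have "(\<integral>\<^sup>+k. epowr (ennreal ((1 / 2) ^ int_encode k)) b \<partial>count_space UNIV)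
        \<le> (\<integral>\<^sup>+k. ennreal ((1 / 2) ^ int_encode k) \<partial>count_space UNIV)"
    proof (intro nn_integral_mono)
      fix k
      have "((1 / 2) ^ int_encode k :: real) powr b \<le> ((1 / 2) ^ int_encode k) powr 1"
        using b by (intro powr_mono') (auto simp: power_le_one)
      then show "epowr (ennreal ((1 / 2) ^ int_encode k)) b \<le> ennreal ((1 / 2) ^ int_encode k)"
        by (simp add: ennreal_leI)
    qed
    also have "\<dots> = (\<integral>\<^sup>+n. ennreal ((1 / 2) ^ n) \<partial>count_space UNIV)"
      by (rule nn_integral_bij_count_space) (rule bij_int_encode)
    also have "\<dots> = ennreal (\<Sum>n. (1 / 2) ^ n)"
      by (subst nn_integral_count_space_nat) (intro suminf_ennreal2, auto)
    also have "\<dots> < \<infinity>" by simp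
    finally show ?thesis using b by (simp add: Lp_ennreal)
  qed
  finally show thesis using that u_meas u_pos by blast
qed

text \<open>
  A product of functions of single coordinates; its norm is at most the product of their norms.
\<close>

lemma positive_function_mixed_norm_finite:
  fixes \<alpha> :: "real^'n::{finite,linorder}"
  assumes p: "\<And>i. 1 \<le> p $ i \<and> p $ i < \<infinity>" and q: "\<And>i. 1 \<le> q $ i"
  obtains w :: "(real, 'n) vec \<Rightarrow> real" where "w \<in> borel_measurable borel" "\<And>x. 0 < w x" "mixed_norm \<alpha> p q (\<lambda>x. ennreal (w x)) < \<infinity>"
proof -
  have p1: "\<And>i. 1 \<le> p $ i" using p by auto
  have "\<exists>u :: real \<Rightarrow> real. u \<in> borel_measurable borel \<and> (\<forall>t. 0 < u t) \<and> herz (\<alpha> $ i) (p $ i) (q $ i) (\<lambda>t. ennreal (u t)) < \<infinity>" for i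
  proof -
    obtain u :: "real \<Rightarrow> real" where "u \<in> borel_measurable borel" "\<And>t. 0 < u t" "herz (\<alpha> $ i) (p $ i) (q $ i) (\<lambda>t. ennreal (u t)) < \<infinity>"
      by (rule positive_function_herz_finite[OF p1[of i] conjunct2[OF p[of i]] q[of i], of "\<alpha> $ i"]) (rule that)
    then show ?thesis by blast
  qed
  then obtain u :: "'n \<Rightarrow> real \<Rightarrow> real" where u [measurable]: "\<And>i. u i \<in> borel_measurable borel"
    and u_pos: "\<And>i t. 0 < u i t"
    and u_fin: "\<And>i. herz (\<alpha> $ i) (p $ i) (q $ i) (\<lambda>t. ennreal (u i t)) < \<infinity>"
    by metis
  define W where "W = (\<lambda>xs x. \<Prod>i\<leftarrow>xs. ennreal (u i (x $ i)))"
  have coord [measurable]: "(\<lambda>y::(real, 'n) vec. y $ i) \<in> borel_measurable borel" for i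
    by (intro borel_measurable_continuous_onI continuous_intros)
  have W_meas [measurable]: "W xs \<in> borel_measurable borel" for xs
    unfolding W_def by (induction xs) auto
  have fin: "fold (partial_herz_norm \<alpha> p q) xs (W xs) x < \<infinity>" if "distinct xs" for xs x
    using that
  proof (induction xs)
    case Nil then show ?case by (simp add: W_def)
  next
    case (Cons i xs)
    have F [measurable]: "(\<lambda>x. ennreal (u i (x $ i))) \<in> borel_measurable borel" by measurable
    let ?c = "herz (\<alpha> $ i) (p $ i) (q $ i) (\<lambda>t. ennreal (u i t))"
    have W_indep: "W xs (coord_upd x i t) = W xs x" for x t
      unfolding W_def using Cons.prems by (intro arg_cong[where f=prod_list] map_cong) auto
    have W_eq: "W (i # xs) = (\<lambda>x. W xs x * ennreal (u i (x $ i)))"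
      by (simp add: W_def fun_eq_iff mult.commute)
    have "partial_herz_norm \<alpha> p q i (W (i # xs)) x \<le> ?c * W xs x" for x
    proof -
      have "partial_herz_norm \<alpha> p q i (W (i # xs)) x \<le> W xs x * partial_herz_norm \<alpha> p q i (\<lambda>x. ennreal (u i (x $ i))) x"
        unfolding W_eq by (intro partial_herz_norm_mult_indep_le[OF p1 q F W_meas] W_indep)
      also have "partial_herz_norm \<alpha> p q i (\<lambda>x. ennreal (u i (x $ i))) x = ?c"
        by (simp add: partial_herz_norm_eq[OF p1 F])
      finally show ?thesis by (simp add: mult.commute)
    qed
    then have "fold (partial_herz_norm \<alpha> p q) (i # xs) (W (i # xs)) x \<le> fold (partial_herz_norm \<alpha> p q) xs (\<lambda>x. ?c * W xs x) x"
      by (simp, intro fold_partial_herz_norm_mono[OF p1 q, THEN le_funD] partial_herz_norm_measurable[OF p1 q])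
         (auto simp: le_fun_def)
    also have "\<dots> \<le> ?c * fold (partial_herz_norm \<alpha> p q) xs (W xs) x"
      by (rule fold_partial_herz_norm_cmult_le[OF p1 q W_meas])
    also have "\<dots> < \<infinity>" using u_fin Cons by (simp add: ennreal_mult_less_top)
    finally show ?case .
  qed
  let ?xs = "sorted_list_of_set (UNIV :: 'n set)"
  have W_real: "W xs x = ennreal (\<Prod>i\<leftarrow>xs. u i (x $ i))" "0 < (\<Prod>i\<leftarrow>xs. u i (x $ i))" for xs x
    by (induction xs) (auto simp: W_def ennreal_mult u_pos less_imp_le)
  show thesis
  proof (rule that[of "\<lambda>x. enn2real (W ?xs x)"])
    show "(\<lambda>x. enn2real (W ?xs x)) \<in> borel_measurable borel" by measurable
    show "0 < enn2real (W ?xs x)" for x using W_real[where xs = ?xs and x = x] by simp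
    have "ennreal (enn2real (W ?xs x)) = W ?xs x" for x using W_real[where xs = ?xs and x = x] by simp
    then show "mixed_norm \<alpha> p q (\<lambda>x. ennreal (enn2real (W ?xs x))) < \<infinity>"
      using fin[OF coordinates_list(1), of 0] by (simp add: mixed_norm_def)
  qed
qed

section \<open>Representation of bounded real functionals\<close>

lemma borel_lebesgue:
  fixes f :: "real^'n::{finite,linorder} \<Rightarrow> real"
  shows "f \<in> borel_measurable borel \<Longrightarrow> f \<in> borel_measurable lebesgue"
  by (intro measurable_completion) simp

text \<open>
  The place where finiteness of the exponents enters. It reduces to the decreasing case by passing
  to the suprema of the tails.
\<close>

lemma mixed_herz_norm_dominated_convergence:
  fixes f :: "real^'n::{finite,linorder} \<Rightarrow> real" and h :: "nat \<Rightarrow> (real, 'n) vec \<Rightarrow> real"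
  assumes p: "\<And>i. 1 \<le> p $ i \<and> p $ i < \<infinity>" and q: "\<And>i. 1 \<le> q $ i \<and> q $ i < \<infinity>"
    and f: "f \<in> mixed_herz_space \<alpha> p q" and h [measurable]: "\<And>n. h n \<in> borel_measurable borel"
    and le: "\<And>n x. \<bar>h n x\<bar> \<le> c * \<bar>f x\<bar>" and lim: "\<And>x. (\<lambda>n. h n x) \<longlonglongrightarrow> 0"
  shows "(\<lambda>n. enn2real (mixed_herz_norm \<alpha> p q (h n))) \<longlonglongrightarrow> 0"
proof -
  have p1: "\<And>i. 1 \<le> p $ i" and q1: "\<And>i. 1 \<le> q $ i" using p q by auto
  define F where "F = (\<lambda>n x. SUP m\<in>{n..}. ennreal \<bar>h m x\<bar>)"
  have F [measurable]: "F n \<in> borel_measurable borel" for n unfolding F_def by measurable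
  have F_leb: "F n \<in> borel_measurable lebesgue" for n using F by (intro measurable_completion) simp
  have "mixed_norm \<alpha> p q (F 0) \<le> mixed_norm \<alpha> p q (\<lambda>x. ennreal c * ennreal (norm (f x)))"
  proof (intro mixed_norm_mono[OF p1 q1 F_leb] AE_I2)
    show "(\<lambda>x. ennreal c * ennreal (norm (f x))) \<in> borel_measurable lebesgue"
      using mixed_herz_spaceD(1)[OF f] by measurable
    fix x
    have "ennreal \<bar>h m x\<bar> \<le> ennreal c * ennreal (norm (f x))" for m
      using le[of m x] by (simp add: ennreal_mult''[symmetric] ennreal_leI)
    then show "F 0 x \<le> ennreal c * ennreal (norm (f x))" unfolding F_def by (intro SUP_least)
  qed
  also have "\<dots> \<le> ennreal c * mixed_norm \<alpha> p q (\<lambda>x. ennreal (norm (f x)))"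
    using mixed_herz_spaceD(1)[OF f] by (intro mixed_norm_cmult_le[OF p1 q1]) measurable
  also have "\<dots> < \<infinity>" using mixed_herz_spaceD(2)[OF f] by (simp add: ennreal_mult_less_top)
  finally have fin: "mixed_norm \<alpha> p q (F 0) < \<infinity>" .
  have lim0: "(\<lambda>n. mixed_norm \<alpha> p q (F n)) \<longlonglongrightarrow> 0"
  proof (rule mixed_norm_decreasing_to_0[OF p q])
    show "F n \<in> borel_measurable borel" for n by (rule F)
    show "mixed_norm \<alpha> p q (F 0) < \<infinity>" by (rule fin)
    show "decseq F" by (intro decseq_SucI le_funI) (auto simp: F_def intro!: SUP_subset_mono)
    fix x
    have "(\<lambda>n. ennreal \<bar>h n x\<bar>) \<longlonglongrightarrow> ennreal 0"
      using tendsto_rabs[OF lim[of x]] by (intro tendsto_ennrealI) simp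
    from lim_imp_Limsup[OF sequentially_bot this] show "(INF n. F n x) = 0"
      by (simp add: limsup_INF_SUP F_def)
  qed
  have le_F: "mixed_norm \<alpha> p q (\<lambda>x. ennreal (norm (h n x))) \<le> mixed_norm \<alpha> p q (F n)" for n
  proof (intro mixed_norm_mono[OF p1 q1 _ F_leb] AE_I2)
    show "(\<lambda>x. ennreal (norm (h n x))) \<in> borel_measurable lebesgue"
      using borel_lebesgue[OF h] by measurable
    show "ennreal (norm (h n x)) \<le> F n x" for x unfolding F_def by (intro SUP_upper2[of n]) auto
  qed
  have "(\<lambda>n. mixed_norm \<alpha> p q (\<lambda>x. ennreal (norm (h n x)))) \<longlonglongrightarrow> 0"
    by (rule tendsto_sandwich[OF always_eventually[OF allI] always_eventually[OF allI] tendsto_const lim0])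
      (rule zero_le, rule le_F)
  then show ?thesis unfolding mixed_herz_norm_eq by (intro tendsto_enn2real) simp_all
qed

text \<open>
  A bounded real functional together with a strictly positive function of finite norm. The latter
  turns the functional into a finite signed measure on the whole space.
\<close>

locale weighted_functional =
  fixes \<alpha> :: "real^'n::{finite,linorder}" and p q p' q' :: "ennreal^'n::{finite,linorder}"
    and \<Lambda> :: "(real^'n::{finite,linorder} \<Rightarrow> real) \<Rightarrow> real" and C :: real
    and w :: "real^'n::{finite,linorder} \<Rightarrow> real"
  assumes p: "\<And>i. 1 \<le> p $ i \<and> p $ i < \<infinity>" and q: "\<And>i. 1 \<le> q $ i \<and> q $ i < \<infinity>"
    and p': "\<And>i. conjugate (p $ i) (p' $ i)" and q': "\<And>i. conjugate (q $ i) (q' $ i)"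
    and add: "\<And>f h. f \<in> mixed_herz_space \<alpha> p q \<Longrightarrow> h \<in> mixed_herz_space \<alpha> p q \<Longrightarrow> \<Lambda> (\<lambda>x. f x + h x) = \<Lambda> f + \<Lambda> h"
    and scale: "\<And>c f. f \<in> mixed_herz_space \<alpha> p q \<Longrightarrow> \<Lambda> (\<lambda>x. c * f x) = c * \<Lambda> f"
    and bound: "\<And>f. f \<in> mixed_herz_space \<alpha> p q \<Longrightarrow> \<bar>\<Lambda> f\<bar> \<le> C * enn2real (mixed_herz_norm \<alpha> p q f)"
    and C: "0 \<le> C"
    and w [measurable]: "w \<in> borel_measurable borel" and w_pos: "\<And>x. 0 < w x"
    and w_fin: "mixed_norm \<alpha> p q (\<lambda>x. ennreal (w x)) < \<infinity>"
begin

abbreviation N :: "((real, 'n) vec \<Rightarrow> real) \<Rightarrow> ennreal" where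
  "N \<equiv> mixed_herz_norm \<alpha> p q"

abbreviation E :: "((real, 'n) vec \<Rightarrow> real) set" where
  "E \<equiv> mixed_herz_space \<alpha> p q"

lemma p1: "1 \<le> p $ i" and q1: "1 \<le> q $ i"
  using p q by auto

lemma functional_diff:
  assumes f: "f \<in> E" and h: "h \<in> E"
  shows "\<Lambda> (\<lambda>x. f x - h x) = \<Lambda> f - \<Lambda> h" "(\<lambda>x. f x - h x) \<in> E"
proof -
  have m: "(\<lambda>x. (- 1) * h x) \<in> E"
    using mixed_herz_spaceD(1)[OF h] by (intro mixed_herz_space_mono(1)[OF p1 q1 _ h]) auto
  then show "(\<lambda>x. f x - h x) \<in> E" using mixed_herz_space_add[OF p' q' f m] by simp
  show "\<Lambda> (\<lambda>x. f x - h x) = \<Lambda> f - \<Lambda> h" using add[OF f m] scale[OF h, of "- 1"] by simp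
qed

lemma bound_diff:
  "f \<in> E \<Longrightarrow> h \<in> E \<Longrightarrow> \<bar>\<Lambda> f - \<Lambda> h\<bar> \<le> C * enn2real (N (\<lambda>x. f x - h x))"
  using bound[OF functional_diff(2)] functional_diff(1) by simp

lemma functional_zero_AE:
  assumes f: "f \<in> E" and ae: "AE x in lebesgue. f x = 0"
  shows "\<Lambda> f = 0"
proof -
  have "N f = mixed_norm \<alpha> p q (\<lambda>x. 0)"
    unfolding mixed_herz_norm_eq using ae by (intro mixed_norm_cong_AE[OF p1]) (auto elim: eventually_mono)
  then have "N f = 0" by (simp add: mixed_norm_zero[OF p1 q1])
  then show ?thesis using bound[OF f] by simp
qed

lemma w_abs: "\<bar>w x\<bar> = w x"
  using w_pos[of x] by simp

lemma w_mem: "w \<in> E"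
  using w_fin borel_lebesgue[OF w] by (intro mixed_herz_spaceI) (auto simp: w_abs)

lemma dominated:
  assumes [measurable]: "f \<in> borel_measurable borel" and le: "\<And>x. \<bar>f x\<bar> \<le> c * w x" and c: "0 \<le> c"
  shows "f \<in> E" "enn2real (N f) \<le> c * enn2real (N w)"
proof -
  have cw: "(\<lambda>x. c * w x) \<in> E"
    using borel_lebesgue[of "\<lambda>x. c * w x"] c by (intro mixed_herz_space_scale[OF p1 q1 w_mem, of _ c]) (auto simp: abs_mult)
  have le': "norm (f x) \<le> norm (c * w x)" for x using le[of x] c w_abs[of x] by (simp add: abs_mult)
  show "f \<in> E" by (rule mixed_herz_space_mono(1)[OF p1 q1 borel_lebesgue cw le']) measurable
  have "N f \<le> N (\<lambda>x. c * w x)" by (rule mixed_herz_space_mono(2)[OF p1 q1 borel_lebesgue cw le']) measurable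
  also have "\<dots> \<le> ennreal \<bar>c\<bar> * N w"
    by (intro mixed_herz_norm_scale[OF p1 q1 borel_lebesgue[OF w]]) (simp add: abs_mult)
  finally have "N f \<le> ennreal c * N w" using c by simp
  then have "enn2real (N f) \<le> enn2real (ennreal c * N w)"
    using w_mem by (intro enn2real_mono) (auto simp: ennreal_mult_less_top mixed_herz_space_def)
  then show "enn2real (N f) \<le> c * enn2real (N w)" using c by (simp add: enn2real_mult)
qed

definition charge :: "(real, 'n) vec set \<Rightarrow> real" where
  "charge A = \<Lambda> (\<lambda>x. w x * indicator A x)"

lemma w_indicator:
  assumes [measurable]: "A \<in> sets borel"
  shows "(\<lambda>x. w x * indicator A x) \<in> E"
    "enn2real (N (\<lambda>x. w x * indicator A x)) \<le> enn2real (N w)"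
proof -
  have "\<bar>w x * indicator A x\<bar> \<le> 1 * w x" for x using w_abs[of x] by (auto simp: indicator_def)
  from dominated[OF _ this] show "(\<lambda>x. w x * indicator A x) \<in> E"
    "enn2real (N (\<lambda>x. w x * indicator A x)) \<le> enn2real (N w)" by auto
qed

lemma charge_Un:
  assumes AB: "A \<in> sets borel" "B \<in> sets borel" "A \<inter> B = {}"
  shows "charge (A \<union> B) = charge A + charge B"
proof -
  have "(\<lambda>x. w x * indicator (A \<union> B) x) = (\<lambda>x. w x * indicator A x + w x * indicator B x)"
    using AB(3) by (auto simp: indicator_def fun_eq_iff)
  then show ?thesis using add[OF w_indicator(1)[OF AB(1)] w_indicator(1)[OF AB(2)]] by (simp add: charge_def)
qed

lemma charge_sums:
  fixes A :: "nat \<Rightarrow> (real, 'n) vec set"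
  assumes A: "range A \<subseteq> sets lborel" "disjoint_family A"
  shows "(\<lambda>n. charge (A n)) sums charge (\<Union>n. A n)"
proof -
  have s_empty: "charge {} = 0" using charge_Un[of "{}" "{}"] by simp
  have [measurable]: "A n \<in> sets borel" for n using A(1) by auto
  let ?U = "\<Union>n. A n" and ?P = "\<lambda>n. \<Union>i<n. A i"
  have fin_sum: "(\<Sum>i<n. charge (A i)) = charge (\<Union>i<n. A i)" for n
  proof (induction n)
    case (Suc n)
    have "A i \<inter> A n = {}" if "i < n" for i
      using that A(2) by (simp add: disjoint_family_on_def)
    then have "charge ((\<Union>i<n. A i) \<union> A n) = charge (\<Union>i<n. A i) + charge (A n)" by (intro charge_Un) auto
    also have "(\<Union>i<n. A i) \<union> A n = (\<Union>i<Suc n. A i)" by (auto simp: less_Suc_eq)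
    finally show ?case using Suc by simp
  qed (simp add: s_empty)
  have "(\<lambda>n. C * enn2real (N (\<lambda>x. w x * indicator (?P n) x - w x * indicator ?U x))) \<longlonglongrightarrow> C * 0"
  proof (intro tendsto_mult tendsto_const mixed_herz_norm_dominated_convergence[OF p q w_mem, where c = 1])
    fix x
    have "eventually (\<lambda>n. w x * indicator (?P n) x - w x * indicator ?U x = 0) sequentially"
    proof (cases "\<exists>i. x \<in> A i")
      case True
      then obtain i where "x \<in> A i" ..
      then show ?thesis
        by (intro eventually_sequentiallyI[of "Suc i"]) (auto simp: indicator_def Suc_le_eq)
    qed (simp add: indicator_def)
    then show "(\<lambda>n. w x * indicator (?P n) x - w x * indicator ?U x) \<longlonglongrightarrow> 0" by (rule tendsto_eventually)
  qed (auto simp: indicator_def)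
  moreover have "\<bar>charge (?P n) - charge ?U\<bar> \<le> C * enn2real (N (\<lambda>x. w x * indicator (?P n) x - w x * indicator ?U x))" for n
    unfolding charge_def by (intro bound_diff w_indicator) measurable
  ultimately have "(\<lambda>n. charge (?P n) - charge ?U) \<longlonglongrightarrow> 0"
    by (intro Lim_null_comparison[of "\<lambda>n. charge (?P n) - charge ?U"]) auto
  then show ?thesis by (simp add: sums_def fin_sum LIM_zero_iff)
qed

lemma charge_bounded:
  assumes A: "A \<in> sets lborel" shows "\<bar>charge A\<bar> \<le> C * enn2real (N w)"
proof -
  have "\<bar>charge A\<bar> \<le> C * enn2real (N (\<lambda>x. w x * indicator A x))" unfolding charge_def using A by (intro bound w_indicator) simp
  also have "\<dots> \<le> C * enn2real (N w)" using A C by (intro mult_left_mono w_indicator) auto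
  finally show ?thesis .
qed

lemma charge_null:
  assumes A: "A \<in> null_sets lborel" shows "charge A = 0"
proof -
  have "A \<in> sets borel" using A by auto
  moreover have "AE x in lebesgue. w x * indicator A x = 0"
    using AE_not_in[OF A] by (auto simp: AE_completion_iff elim: eventually_mono)
  ultimately show ?thesis unfolding charge_def by (intro functional_zero_AE w_indicator)
qed

text \<open>
  Once the charge has a density \<open>h\<close>, the functional is integration against \<open>h / w\<close>: this is linearity
  for simple multiples of \<open>w\<close>, and the pointwise approximation of \<open>f / w\<close> by simple functions passes
  to the limit by dominated convergence, both in the norm and in the integral.
\<close>

lemma representation_integrable:
  assumes h: "integrable lborel h" and s_h: "\<And>A. A \<in> sets lborel \<Longrightarrow> charge A = (LINT x|lborel. h x * indicator A x)"
    and fE: "f \<in> E" and f [measurable]: "f \<in> borel_measurable borel" and I: "integrable lborel (\<lambda>x. f x * (h x / w x))"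
  shows "\<Lambda> f = (LINT x|lborel. f x * (h x / w x))"
proof -
  have h_meas [measurable]: "h \<in> borel_measurable borel" using h by auto
  obtain \<sigma> where simple: "\<And>i. simple_function lborel (\<sigma> i)" and lim: "\<And>x. (\<lambda>i. \<sigma> i x) \<longlonglongrightarrow> f x / w x"
    and \<sigma>_le: "\<And>i x. \<bar>\<sigma> i x\<bar> \<le> 2 * \<bar>f x / w x\<bar>"
    using borel_measurable_implies_sequence_metric[of "\<lambda>x. f x / w x" lborel 0] by auto
  have \<sigma>_meas [measurable]: "\<sigma> i \<in> borel_measurable borel" for i
    using borel_measurable_simple_function[OF simple[of i]] by simp
  have w\<sigma>_le: "\<bar>w x * \<sigma> i x\<bar> \<le> 2 * \<bar>f x\<bar>" for i x
    using mult_left_mono[OF \<sigma>_le[of i x], of "w x"] w_pos[of x] by (simp add: abs_mult)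
  have w\<sigma>_lim: "(\<lambda>i. w x * \<sigma> i x) \<longlonglongrightarrow> f x" for x
    using tendsto_mult[OF tendsto_const[of "w x"] lim[of x]] w_pos[of x] by simp
  have fin_sum: "(\<lambda>x. \<Sum>y\<in>Y. y * (w x * indicator (A y) x)) \<in> E \<and>
      \<Lambda> (\<lambda>x. \<Sum>y\<in>Y. y * (w x * indicator (A y) x)) = (\<Sum>y\<in>Y. y * charge (A y))"
    if "finite Y" and A: "\<And>y. A y \<in> sets borel" for Y :: "real set" and A
    using that(1)
  proof induction
    case empty
    have "(\<lambda>x. 0) \<in> E" by (rule dominated(1)[where c = 0]) auto
    then show ?case using functional_zero_AE[of "\<lambda>x. 0"] by simp
  next
    case (insert y Y)
    note wA = w_indicator(1)[OF A[of y]]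
    have cE: "(\<lambda>x. y * (w x * indicator (A y) x)) \<in> E"
      using mixed_herz_spaceD(1)[OF wA] by (intro mixed_herz_space_scale[OF p1 q1 wA, of _ y]) (auto simp: abs_mult)
    show ?case
      using insert mixed_herz_space_add[OF p' q' cE, of "\<lambda>x. \<Sum>y\<in>Y. y * (w x * indicator (A y) x)"]
        add[OF cE, of "\<lambda>x. \<Sum>y\<in>Y. y * (w x * indicator (A y) x)"] scale[OF wA, of y]
      by (simp add: charge_def)
  qed
  have rep: "(\<lambda>x. w x * \<sigma> i x) \<in> E \<and> \<Lambda> (\<lambda>x. w x * \<sigma> i x) = (LINT x|lborel. \<sigma> i x * h x)" for i
  proof -
    let ?Y = "range (\<sigma> i)" and ?A = "\<lambda>y. \<sigma> i -` {y}"
    have Y: "finite ?Y" using simple_functionD(1)[OF simple[of i]] by simp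
    have A: "?A y \<in> sets borel" for y using measurable_sets[OF \<sigma>_meas, of "{y}"] by simp
    have \<sigma>_eq: "\<sigma> i x = (\<Sum>y\<in>?Y. y * indicator (?A y) x)" for x
    proof -
      have "(\<Sum>y\<in>?Y. y * indicator (?A y) x) = (\<Sum>y\<in>{\<sigma> i x}. y * indicator (?A y) x)"
        using Y by (intro sum.mono_neutral_right) auto
      then show ?thesis by simp
    qed
    have w\<sigma>: "w x * \<sigma> i x = (\<Sum>y\<in>?Y. y * (w x * indicator (?A y) x))" for x
      by (subst \<sigma>_eq) (simp only: sum_distrib_left mult_ac)
    have "(\<Sum>y\<in>?Y. y * charge (?A y)) = (\<Sum>y\<in>?Y. LINT x|lborel. y * (h x * indicator (?A y) x))"
      using A by (simp add: s_h)
    also have "\<dots> = (LINT x|lborel. (\<Sum>y\<in>?Y. y * (h x * indicator (?A y) x)))"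
      using h A by (intro Bochner_Integration.integral_sum[symmetric] integrable_mult_right integrable_real_mult_indicator) auto
    also have "\<dots> = (LINT x|lborel. \<sigma> i x * h x)"
      by (subst \<sigma>_eq) (simp only: sum_distrib_left sum_distrib_right mult_ac)
    finally show ?thesis using fin_sum[OF Y A] unfolding w\<sigma> by simp
  qed
  have "(\<lambda>i. C * enn2real (N (\<lambda>x. w x * \<sigma> i x - f x))) \<longlonglongrightarrow> C * 0"
  proof (intro tendsto_mult tendsto_const mixed_herz_norm_dominated_convergence[OF p q fE, where c = 3])
    show "\<bar>w x * \<sigma> i x - f x\<bar> \<le> 3 * \<bar>f x\<bar>" for i x using w\<sigma>_le[of x i] by linarith
    show "(\<lambda>i. w x * \<sigma> i x - f x) \<longlonglongrightarrow> 0" for x using w\<sigma>_lim by (rule LIM_zero)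
  qed measurable
  moreover have "\<bar>\<Lambda> (\<lambda>x. w x * \<sigma> i x) - \<Lambda> f\<bar> \<le> C * enn2real (N (\<lambda>x. w x * \<sigma> i x - f x))" for i
    using bound_diff[OF _ fE] rep by blast
  ultimately have "(\<lambda>i. \<Lambda> (\<lambda>x. w x * \<sigma> i x) - \<Lambda> f) \<longlonglongrightarrow> 0"
    by (intro Lim_null_comparison[of "\<lambda>i. \<Lambda> (\<lambda>x. w x * \<sigma> i x) - \<Lambda> f"]) auto
  then have lim1: "(\<lambda>i. LINT x|lborel. \<sigma> i x * h x) \<longlonglongrightarrow> \<Lambda> f" using rep by (simp add: LIM_zero_iff)
  have "(\<lambda>i. LINT x|lborel. \<sigma> i x * h x) \<longlonglongrightarrow> (LINT x|lborel. f x * (h x / w x))"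
  proof (rule integral_dominated_convergence[where w = "\<lambda>x. 2 * \<bar>f x * (h x / w x)\<bar>"])
    show "integrable lborel (\<lambda>x. 2 * \<bar>f x * (h x / w x)\<bar>)" by (intro integrable_mult_right integrable_abs I)
    show "AE x in lborel. (\<lambda>i. \<sigma> i x * h x) \<longlonglongrightarrow> f x * (h x / w x)"
      using tendsto_mult[OF lim tendsto_const] by simp
    show "AE x in lborel. norm (\<sigma> i x * h x) \<le> 2 * \<bar>f x * (h x / w x)\<bar>" for i
    proof (rule AE_I2)
      show "norm (\<sigma> i x * h x) \<le> 2 * \<bar>f x * (h x / w x)\<bar>" for x
        using mult_right_mono[OF \<sigma>_le[of i x] abs_ge_zero[of "h x"]] by (simp add: abs_mult mult.assoc)
    qed
  qed measurable
  with lim1 show ?thesis by (rule LIMSEQ_unique)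
qed

text \<open>
  By duality it suffices to test \<open>g\<close> against functions of norm at most 1 that are dominated by a
  multiple of \<open>w\<close>, and against these the integral is a value of \<open>\<Lambda>\<close>.
\<close>

lemma density_norm_le:
  assumes g [measurable]: "g \<in> borel_measurable borel" and int_gw: "integrable lborel (\<lambda>x. w x * g x)"
    and rep: "\<And>f. f \<in> E \<Longrightarrow> f \<in> borel_measurable borel \<Longrightarrow>
      integrable lborel (\<lambda>x. f x * g x) \<Longrightarrow> \<Lambda> f = (LINT x|lborel. f x * g x)"
  shows "mixed_norm (- \<alpha>) p' q' (\<lambda>x. ennreal \<bar>g x\<bar>) \<le> ennreal C"
proof (rule mixed_duality_le_truncated[OF p' q' _ w w_pos])
  show "(\<lambda>x. ennreal \<bar>g x\<bar>) \<in> borel_measurable lebesgue"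
    using borel_lebesgue[OF g] by measurable
  fix K :: "(real, 'n) vec \<Rightarrow> real" and m :: nat
  assume K [measurable]: "K \<in> borel_measurable borel" and K_nn: "\<And>x. 0 \<le> K x" and K_le: "\<And>x. K x \<le> real m * w x"
    and K1: "mixed_norm \<alpha> p q (\<lambda>x. ennreal (K x)) \<le> 1"
  define f where "f = (\<lambda>x. K x * sgn (g x))"
  have f [measurable]: "f \<in> borel_measurable borel" unfolding f_def by measurable
  have f_abs: "\<bar>f x\<bar> \<le> K x" for x using K_nn[of x] by (simp add: f_def abs_mult abs_sgn_eq)
  have f_le: "\<bar>f x\<bar> \<le> real m * w x" for x using f_abs[of x] K_le[of x] by linarith
  have fE: "f \<in> E" by (rule dominated(1)[OF f f_le]) simp
  have fg: "f x * g x = K x * \<bar>g x\<bar>" for x by (simp add: f_def abs_sgn mult.assoc)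
  have "N f \<le> mixed_norm \<alpha> p q (\<lambda>x. ennreal (K x))"
    unfolding mixed_herz_norm_eq
    using borel_lebesgue[OF f] borel_lebesgue[OF K] f_abs
    by (intro mixed_norm_mono[OF p1 q1] AE_I2) (auto intro: ennreal_leI)
  then have N1: "enn2real (N f) \<le> 1" using K1 enn2real_mono[of "N f" 1] by simp
  have int: "integrable lborel (\<lambda>x. K x * \<bar>g x\<bar>)"
  proof (rule Bochner_Integration.integrable_bound)
    show "integrable lborel (\<lambda>x. real m * (w x * g x))" using int_gw by simp
    show "AE x in lborel. norm (K x * \<bar>g x\<bar>) \<le> norm (real m * (w x * g x))"
      using K_le K_nn w_abs by (intro AE_I2) (simp add: abs_mult mult.assoc[symmetric] mult_right_mono)
  qed measurable
  have "(\<integral>\<^sup>+x. ennreal (K x) * ennreal \<bar>g x\<bar> \<partial>lebesgue) = (\<integral>\<^sup>+x. ennreal (K x * \<bar>g x\<bar>) \<partial>lborel)"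
    using K_nn by (simp add: ennreal_mult nn_integral_completion)
  also have "\<dots> = ennreal (LINT x|lborel. K x * \<bar>g x\<bar>)"
    using int K_nn by (intro nn_integral_eq_integral) auto
  also have "(LINT x|lborel. K x * \<bar>g x\<bar>) = \<Lambda> f"
    using rep[OF fE f] int by (simp add: fg)
  also have "\<Lambda> f \<le> C * enn2real (N f)" using bound[OF fE] by simp
  also have "\<dots> \<le> C" using N1 C mult_left_mono[of _ 1 C] by simp
  finally show "(\<integral>\<^sup>+x. ennreal (K x) * ennreal \<bar>g x\<bar> \<partial>lebesgue) \<le> ennreal C" by (simp add: ennreal_leI)
qed

lemma representation:
  obtains g where "g \<in> mixed_herz_space (- \<alpha>) p' q'"
    "\<And>f. f \<in> E \<Longrightarrow> \<Lambda> f = (LINT x|lebesgue. f x * g x)"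
proof -
  obtain h where h: "integrable lborel h"
    and s_h: "\<And>A. A \<in> sets lborel \<Longrightarrow> charge A = (LINT x|lborel. h x * indicator A x)"
    using signed_Radon_Nikodym[OF lborel.sigma_finite_measure_axioms charge_sums charge_bounded charge_null] by blast
  define g where "g = (\<lambda>x. h x / w x)"
  have g_meas: "g \<in> borel_measurable borel" unfolding g_def using h by measurable
  have g_leb: "g \<in> borel_measurable lebesgue" by (rule borel_lebesgue[OF g_meas])
  have wg: "w x * g x = h x" for x using w_pos[of x] by (simp add: g_def)
  have rep: "\<Lambda> f = (LINT x|lborel. f x * g x)"
    if "f \<in> E" "f \<in> borel_measurable borel" "integrable lborel (\<lambda>x. f x * g x)" for f
    unfolding g_def using that by (intro representation_integrable[OF h] s_h) (simp_all add: g_def)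
  have "mixed_norm (- \<alpha>) p' q' (\<lambda>x. ennreal \<bar>g x\<bar>) \<le> ennreal C"
    using h by (intro density_norm_le g_meas rep) (simp_all add: wg)
  then have gE: "g \<in> mixed_herz_space (- \<alpha>) p' q'"
    by (intro mixed_herz_spaceI g_leb) (auto intro: le_less_trans)
  show thesis
  proof (rule that[OF gE])
    fix f :: "(real, 'n) vec \<Rightarrow> real" assume f: "f \<in> E"
    obtain f' where f' [measurable]: "f' \<in> borel_measurable borel" and ae: "AE x in lborel. f x = f' x"
      using completion_ex_borel_measurable_real[OF mixed_herz_spaceD(1)[OF f]] by auto
    have ae': "AE x in lebesgue. f x = f' x" using ae by (simp add: AE_completion_iff)
    have "N f' = N f"
      unfolding mixed_herz_norm_eq using ae' by (intro mixed_norm_cong_AE[OF p1]) (auto elim: eventually_mono)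
    then have f'E: "f' \<in> E" using f borel_lebesgue[OF f'] by (simp add: mixed_herz_space_def)
    have "\<Lambda> f - \<Lambda> f' = 0"
      unfolding functional_diff(1)[OF f f'E, symmetric]
      using ae' by (intro functional_zero_AE functional_diff(2)[OF f f'E]) (auto elim: eventually_mono)
    moreover have "\<Lambda> f' = (LINT x|lebesgue. f' x * g x)"
    proof -
      have "integrable lborel (\<lambda>x. f' x * g x)"
        using integrable_product(1)[OF p' q' f'E gE] f' g_meas by (subst (asm) integrable_completion) auto
      then show ?thesis using rep[OF f'E f'] f' g_meas by (simp add: integral_completion)
    qed
    ultimately have "\<Lambda> f = (LINT x|lebesgue. f' x * g x)" by simp
    also have "\<dots> = (LINT x|lebesgue. f x * g x)"
      using ae' g_leb borel_lebesgue[OF f'] mixed_herz_spaceD(1)[OF f]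
      by (intro integral_cong_AE) (auto elim: eventually_mono)
    finally show "\<Lambda> f = (LINT x|lebesgue. f x * g x)" .
  qed
qed

end

lemma real_representation:
  fixes \<alpha> :: "real^'n::{finite,linorder}" and \<Lambda> :: "((real, 'n) vec \<Rightarrow> real) \<Rightarrow> real"
  assumes p: "\<And>i. 1 \<le> p $ i \<and> p $ i < \<infinity>" and q: "\<And>i. 1 \<le> q $ i \<and> q $ i < \<infinity>"
    and p': "\<And>i. conjugate (p $ i) (p' $ i)" and q': "\<And>i. conjugate (q $ i) (q' $ i)"
    and add: "\<And>f h. f \<in> mixed_herz_space \<alpha> p q \<Longrightarrow> h \<in> mixed_herz_space \<alpha> p q \<Longrightarrow> \<Lambda> (\<lambda>x. f x + h x) = \<Lambda> f + \<Lambda> h"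
    and scale: "\<And>c f. f \<in> mixed_herz_space \<alpha> p q \<Longrightarrow> \<Lambda> (\<lambda>x. c * f x) = c * \<Lambda> f"
    and bound: "\<And>f. f \<in> mixed_herz_space \<alpha> p q \<Longrightarrow> \<bar>\<Lambda> f\<bar> \<le> C * enn2real (mixed_herz_norm \<alpha> p q f)"
    and C: "0 \<le> C"
  obtains g :: "(real, 'n) vec \<Rightarrow> real" where "g \<in> mixed_herz_space (- \<alpha>) p' q'"
    "\<And>f. f \<in> mixed_herz_space \<alpha> p q \<Longrightarrow> \<Lambda> f = (LINT x|lebesgue. f x * g x)"
proof -
  have q1: "1 \<le> q $ i" for i using q by simp
  obtain w :: "(real, 'n) vec \<Rightarrow> real" where "w \<in> borel_measurable borel" "\<And>x. 0 < w x"
    "mixed_norm \<alpha> p q (\<lambda>x. ennreal (w x)) < \<infinity>"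
    by (rule positive_function_mixed_norm_finite[OF p q1, of \<alpha>]) (rule that)
  then interpret weighted_functional \<alpha> p q p' q' \<Lambda> C w
    using assms by unfold_locales
  show thesis by (rule representation) (rule that)
qed

section \<open>The dual space\<close>

text \<open>
  The factor that rotates \<open>z\<close> to its modulus. Its value at 0 is 0.
\<close>

definition conj_sgn :: "'a::real_normed_field \<Rightarrow> 'a" where
  "conj_sgn z = of_real (norm z) / z"

lemma conj_sgn_mult: "conj_sgn z * z = of_real (norm z)"
  by (simp add: conj_sgn_def)

lemma norm_conj_sgn_le: "norm (conj_sgn z) \<le> 1"
  by (simp add: conj_sgn_def norm_divide)

lemma conj_sgn_measurable [measurable (raw)]:
  fixes f :: "_ \<Rightarrow> 'a::{real_normed_field,euclidean_space}"
  assumes [measurable]: "f \<in> borel_measurable M"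
  shows "(\<lambda>x. conj_sgn (f x)) \<in> borel_measurable M"
  unfolding conj_sgn_def by measurable

lemma mixed_norm_le_dual_norm:
  fixes \<alpha> :: "real^'n::{finite,linorder}" and g :: "(real, 'n) vec \<Rightarrow> 'a::{real_normed_field,euclidean_space}"
  assumes p: "\<And>i. conjugate (p $ i) (p' $ i)" and q: "\<And>i. conjugate (q $ i) (q' $ i)"
    and g: "g \<in> mixed_herz_space (- \<alpha>) p' q'"
  shows "mixed_herz_norm (- \<alpha>) p' q' g \<le> herz_dual_norm \<alpha> p q (pairing g)"
  unfolding mixed_herz_norm_eq
proof (rule mixed_duality_le_truncated[OF p q, where w = "\<lambda>_. 1"])
  have p1: "\<And>i. 1 \<le> p $ i" and q1: "\<And>i. 1 \<le> q $ i"
    using p q conjugate_ge_1 by blast+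
  note [measurable] = mixed_herz_spaceD(1)[OF g]
  show "(\<lambda>x. ennreal (norm (g x))) \<in> borel_measurable lebesgue" by measurable
  fix K :: "(real, 'n) vec \<Rightarrow> real"
  assume K: "K \<in> borel_measurable borel" and K_nn: "\<And>x. 0 \<le> K x"
    and K1: "mixed_norm \<alpha> p q (\<lambda>x. ennreal (K x)) \<le> 1"
  have [measurable]: "K \<in> borel_measurable lebesgue" by (rule borel_lebesgue[OF K])
  define f where "f = (\<lambda>x. of_real (K x) * conj_sgn (g x))"
  have [measurable]: "f \<in> borel_measurable lebesgue" unfolding f_def by measurable
  have f_le: "norm (f x) \<le> K x" for x
    using mult_left_mono[OF norm_conj_sgn_le[of "g x"] K_nn[of x]] K_nn[of x]
    by (simp add: f_def norm_mult)
  have "mixed_herz_norm \<alpha> p q f \<le> mixed_norm \<alpha> p q (\<lambda>x. ennreal (K x))"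
    unfolding mixed_herz_norm_eq by (intro mixed_norm_mono[OF p1 q1] AE_I2 ennreal_leI f_le) measurable
  then have N1: "mixed_herz_norm \<alpha> p q f \<le> 1" using K1 by (rule order_trans)
  then have fE: "f \<in> mixed_herz_space \<alpha> p q"
    unfolding mixed_herz_space_def by (auto intro: le_less_trans)
  have fg: "f x * g x = of_real (K x * norm (g x))" for x
    by (simp add: f_def mult.assoc conj_sgn_mult)
  have I: "integrable lebesgue (\<lambda>x. f x * g x)" by (rule integrable_product(1)[OF p q fE g])
  have J: "integrable lebesgue (\<lambda>x. K x * norm (g x))"
    using integrable_norm[OF I] K_nn by (simp add: fg norm_mult)
  have "(\<integral>\<^sup>+x. ennreal (K x) * ennreal (norm (g x)) \<partial>lebesgue) = (\<integral>\<^sup>+x. ennreal (K x * norm (g x)) \<partial>lebesgue)"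
    using K_nn by (simp add: ennreal_mult)
  also have "\<dots> = ennreal (LINT x|lebesgue. K x * norm (g x))"
    using J K_nn by (intro nn_integral_eq_integral) auto
  also have "(LINT x|lebesgue. K x * norm (g x)) = norm (pairing g f)"
    unfolding pairing_def fg integral_of_real[OF J] norm_of_real using K_nn by simp
  also have "ennreal (norm (pairing g f)) \<le> herz_dual_norm \<alpha> p q (pairing g)"
    unfolding herz_dual_norm_def using fE N1 by (intro SUP_upper) simp
  finally show "(\<integral>\<^sup>+x. ennreal (K x) * ennreal (norm (g x)) \<partial>lebesgue) \<le> herz_dual_norm \<alpha> p q (pairing g)" .
qed auto

lemma dual_norm_le_mixed_norm:
  fixes \<alpha> :: "real^'n::{finite,linorder}" and g :: "(real, 'n) vec \<Rightarrow> 'a::{real_normed_field,euclidean_space}"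
  assumes p: "\<And>i. conjugate (p $ i) (p' $ i)" and q: "\<And>i. conjugate (q $ i) (q' $ i)"
    and g: "g \<in> mixed_herz_space (- \<alpha>) p' q'"
  shows "herz_dual_norm \<alpha> p q (pairing g) \<le> mixed_herz_norm (- \<alpha>) p' q' g"
  unfolding herz_dual_norm_def
proof (rule SUP_least)
  fix f :: "(real, 'n) vec \<Rightarrow> 'a" assume f: "f \<in> {f \<in> mixed_herz_space \<alpha> p q. mixed_herz_norm \<alpha> p q f \<le> 1}"
  have "ennreal (norm (pairing g f)) \<le> mixed_herz_norm \<alpha> p q f * mixed_herz_norm (- \<alpha>) p' q' g"
    unfolding pairing_def using f g by (intro integrable_product(2)[OF p q]) auto
  also have "\<dots> \<le> 1 * mixed_herz_norm (- \<alpha>) p' q' g" using f by (intro mult_right_mono) auto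
  finally show "ennreal (norm (pairing g f)) \<le> mixed_herz_norm (- \<alpha>) p' q' g" by simp
qed

text \<open>
  The test function \<open>w * conj_sgn (g - h)\<close>, with \<open>w\<close> strictly positive of finite norm, detects every
  difference of \<open>g\<close> and \<open>h\<close>.
\<close>

lemma pairing_unique:
  fixes \<alpha> :: "real^'n::{finite,linorder}" and g h :: "(real, 'n) vec \<Rightarrow> 'a::{real_normed_field,euclidean_space}"
  assumes pf: "\<And>i. p $ i < \<infinity>"
    and p: "\<And>i. conjugate (p $ i) (p' $ i)" and q: "\<And>i. conjugate (q $ i) (q' $ i)"
    and g: "g \<in> mixed_herz_space (- \<alpha>) p' q'" and h: "h \<in> mixed_herz_space (- \<alpha>) p' q'"
    and eq: "\<And>f. f \<in> mixed_herz_space \<alpha> p q \<Longrightarrow> pairing g f = pairing h f"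
  shows "AE x in lebesgue. h x = g x"
proof -
  have p1: "\<And>i. 1 \<le> p $ i" and q1: "\<And>i. 1 \<le> q $ i"
    using p q conjugate_ge_1 by blast+
  have p2: "1 \<le> p $ i \<and> p $ i < \<infinity>" for i using p1 pf by simp
  obtain w :: "(real, 'n) vec \<Rightarrow> real" where w: "w \<in> borel_measurable borel" and w_pos: "\<And>x. 0 < w x"
    and w_fin: "mixed_norm \<alpha> p q (\<lambda>x. ennreal (w x)) < \<infinity>"
    by (rule positive_function_mixed_norm_finite[OF p2 q1, of \<alpha>]) (rule that)
  have [measurable]: "w \<in> borel_measurable lebesgue" using w by (intro measurable_completion) simp
  note [measurable] = mixed_herz_spaceD(1)[OF g] mixed_herz_spaceD(1)[OF h]
  have w_abs: "\<bar>w x\<bar> = w x" for x using w_pos[of x] by simp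
  have wE: "w \<in> mixed_herz_space \<alpha> p q" using w_fin by (intro mixed_herz_spaceI) (simp_all add: w_abs)
  define f where "f = (\<lambda>x. of_real (w x) * conj_sgn (g x - h x))"
  have f_meas: "f \<in> borel_measurable lebesgue" unfolding f_def by measurable
  have f_le: "norm (f x) \<le> norm (w x)" for x
    using mult_left_mono[OF norm_conj_sgn_le[of "g x - h x"], of "w x"] w_pos[of x]
    by (simp add: f_def norm_mult)
  have fE: "f \<in> mixed_herz_space \<alpha> p q" by (rule mixed_herz_space_mono(1)[OF p1 q1 f_meas wE f_le])
  have I: "integrable lebesgue (\<lambda>x. f x * g x)" "integrable lebesgue (\<lambda>x. f x * h x)"
    using integrable_product(1)[OF p q fE g] integrable_product(1)[OF p q fE h] by auto
  have fgh: "f x * g x - f x * h x = of_real (w x * norm (g x - h x))" for x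
    unfolding right_diff_distrib[symmetric] by (simp add: f_def mult.assoc conj_sgn_mult)
  have D: "integrable lebesgue (\<lambda>x. f x * g x - f x * h x)" using I by (rule Bochner_Integration.integrable_diff)
  have "integrable lebesgue (\<lambda>x. norm (f x * g x - f x * h x))" using D by (rule integrable_norm)
  then have J: "integrable lebesgue (\<lambda>x. w x * norm (g x - h x))" by (simp add: fgh norm_mult w_abs)
  have "(LINT x|lebesgue. f x * g x - f x * h x) = pairing g f - pairing h f"
    unfolding pairing_def using I by (rule Bochner_Integration.integral_diff)
  then have "(LINT x|lebesgue. of_real (w x * norm (g x - h x)) :: 'a) = 0"
    using eq[OF fE] by (simp only: fgh) simp
  then have 0: "(LINT x|lebesgue. w x * norm (g x - h x)) = 0"
    unfolding integral_of_real[OF J] by (simp only: of_real_eq_0_iff)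
  have "AE x in lebesgue. w x * norm (g x - h x) = 0"
    using 0 by (subst (asm) integral_nonneg_eq_0_iff_AE[OF J]) (auto simp: less_imp_le[OF w_pos])
  then show ?thesis using w_pos by (auto elim!: eventually_mono simp: less_le)
qed

lemma continuous_imp_bounded:
  fixes \<Lambda> :: "(real^'n::{finite,linorder} \<Rightarrow> 'a::{real_normed_field,euclidean_space}) \<Rightarrow> 'a"
  assumes p: "\<And>i. 1 \<le> p $ i" and q: "\<And>i. 1 \<le> q $ i"
    and lin: "linear_functional_on (mixed_herz_space \<alpha> p q) \<Lambda>" and cont: "herz_continuous \<alpha> p q \<Lambda>"
  obtains C where "0 \<le> C" "\<And>f. f \<in> mixed_herz_space \<alpha> p q \<Longrightarrow> norm (\<Lambda> f) \<le> C * enn2real (mixed_herz_norm \<alpha> p q f)"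
proof -
  let ?E = "mixed_herz_space \<alpha> p q :: ((real, 'n) vec \<Rightarrow> 'a) set" and ?N = "mixed_herz_norm \<alpha> p q :: ((real, 'n) vec \<Rightarrow> 'a) \<Rightarrow> _"
  have zE: "(\<lambda>x. 0) \<in> ?E" by (rule mixed_herz_space_zero[OF p q])
  have scale: "\<Lambda> (\<lambda>x. c * f x) = c * \<Lambda> f" if "f \<in> ?E" for c f
    using lin that by (simp add: linear_functional_on_def)
  have \<Lambda>0: "\<Lambda> (\<lambda>x. 0) = 0" using scale[OF zE, of 0] by simp
  obtain \<delta> where \<delta>: "0 < \<delta>" "\<And>h. h \<in> ?E \<Longrightarrow> ?N h < ennreal \<delta> \<Longrightarrow> norm (\<Lambda> h) < 1"
    using cont zE \<Lambda>0 unfolding herz_continuous_def by (metis (no_types, lifting) diff_zero zero_less_one ext)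
  \<comment> \<open>Rescaling \<open>f\<close> to have norm below \<open>\<delta>\<close>; the factor \<open>t\<close> may be arbitrarily large if \<open>f\<close> has norm 0.\<close>
  have key: "t * norm (\<Lambda> f) \<le> 1" if f: "f \<in> ?E" and t: "0 < t" "t * enn2real (?N f) < \<delta>" for f t
  proof -
    have fin: "?N f < \<infinity>" using f by (simp add: mixed_herz_space_def)
    have n: "norm (of_real t * f x) = \<bar>t\<bar> * norm (f x)" for x by (simp add: norm_mult)
    have m: "(\<lambda>x. of_real t * f x) \<in> borel_measurable lebesgue" using mixed_herz_spaceD(1)[OF f] by measurable
    have tE: "(\<lambda>x. of_real t * f x) \<in> ?E" by (rule mixed_herz_space_scale[OF p q f m n])
    have "?N (\<lambda>x. of_real t * f x) \<le> ennreal \<bar>t\<bar> * ?N f"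
      by (rule mixed_herz_norm_scale[OF p q mixed_herz_spaceD(1)[OF f] n])
    also have "\<dots> = ennreal (t * enn2real (?N f))" using fin t by (simp add: ennreal_mult)
    also have "\<dots> < ennreal \<delta>" using t \<delta>(1) by (simp add: ennreal_less_iff)
    finally have "norm (\<Lambda> (\<lambda>x. of_real t * f x)) < 1" by (rule \<delta>(2)[OF tE])
    then show ?thesis using t by (simp add: scale[OF f] norm_mult)
  qed
  show thesis
  proof (rule that[of "2 / \<delta>"])
    show "0 \<le> 2 / \<delta>" using \<delta> by simp
    fix f assume f: "f \<in> ?E"
    show "norm (\<Lambda> f) \<le> 2 / \<delta> * enn2real (?N f)"
    proof (cases "enn2real (?N f) = 0")
      case True
      have "norm (\<Lambda> f) = 0"
      proof (rule ccontr)
        assume nz: "norm (\<Lambda> f) \<noteq> 0"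
        then have "2 / norm (\<Lambda> f) * norm (\<Lambda> f) \<le> 1" using True \<delta>(1) by (intro key[OF f]) auto
        then show False using nz by simp
      qed
      then show ?thesis using True by simp
    next
      case False
      then have pos: "0 < enn2real (?N f)" by (simp add: less_le)
      have "\<delta> / (2 * enn2real (?N f)) * norm (\<Lambda> f) \<le> 1" using pos \<delta>(1) by (intro key[OF f]) auto
      then show ?thesis using pos \<delta>(1) by (simp add: field_simps)
    qed
  qed
qed

text \<open>
  Linearity over the field reduces the claim to real-valued functions, where the coordinates of
  the functional with respect to the basis can be represented separately.
\<close>

lemma functional_representation:
  fixes \<alpha> :: "real^'n::{finite,linorder}"
    and \<Lambda> :: "(real^'n::{finite,linorder} \<Rightarrow> 'a::{real_normed_field,euclidean_space}) \<Rightarrow> 'a"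
  assumes p: "\<And>i. 1 \<le> p $ i \<and> p $ i < \<infinity>" and q: "\<And>i. 1 \<le> q $ i \<and> q $ i < \<infinity>"
    and p': "\<And>i. conjugate (p $ i) (p' $ i)" and q': "\<And>i. conjugate (q $ i) (q' $ i)"
    and lin: "linear_functional_on (mixed_herz_space \<alpha> p q) \<Lambda>" and cont: "herz_continuous \<alpha> p q \<Lambda>"
  obtains g where "g \<in> mixed_herz_space (- \<alpha>) p' q'" "\<And>f. f \<in> mixed_herz_space \<alpha> p q \<Longrightarrow> \<Lambda> f = pairing g f"
proof -
  let ?E = "mixed_herz_space \<alpha> p q :: ((real, 'n) vec \<Rightarrow> 'a) set"
  let ?R = "mixed_herz_space \<alpha> p q :: ((real, 'n) vec \<Rightarrow> real) set"
  have p1: "\<And>i. 1 \<le> p $ i" and q1: "\<And>i. 1 \<le> q $ i" using p q by auto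
  have p1': "\<And>i. 1 \<le> p' $ i" and q1': "\<And>i. 1 \<le> q' $ i"
    using p' q' conjugate_ge_1 conjugate_sym by blast+
  have add: "\<Lambda> (\<lambda>x. f x + h x) = \<Lambda> f + \<Lambda> h" if "f \<in> ?E" "h \<in> ?E" for f h
    using lin that by (simp add: linear_functional_on_def)
  have scale: "\<Lambda> (\<lambda>x. c * f x) = c * \<Lambda> f" if "f \<in> ?E" for c f
    using lin that by (simp add: linear_functional_on_def)
  obtain C where C: "0 \<le> C" "\<And>f. f \<in> ?E \<Longrightarrow> norm (\<Lambda> f) \<le> C * enn2real (mixed_herz_norm \<alpha> p q f)"
    by (rule continuous_imp_bounded[OF p1 q1 lin cont]) (rule that)
  have ofE: "(\<lambda>x. of_real (f x)) \<in> ?E" and of_norm: "mixed_herz_norm \<alpha> p q (\<lambda>x. of_real (f x) :: 'a) = mixed_herz_norm \<alpha> p q f"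
    if f: "f \<in> ?R" for f
  proof -
    note [measurable] = mixed_herz_spaceD(1)[OF f]
    show "mixed_herz_norm \<alpha> p q (\<lambda>x. of_real (f x) :: 'a) = mixed_herz_norm \<alpha> p q f"
      by (simp add: mixed_herz_norm_eq)
    then show "(\<lambda>x. of_real (f x)) \<in> ?E" using f by (auto simp: mixed_herz_space_def)
  qed
  \<comment> \<open>Each coordinate of \<open>\<Lambda>\<close> on real-valued functions is a bounded real functional.\<close>
  have "\<exists>G :: (real, 'n) vec \<Rightarrow> real. G \<in> mixed_herz_space (- \<alpha>) p' q' \<and>
      (\<forall>f\<in>?R. inner (\<Lambda> (\<lambda>x. of_real (f x))) b = (LINT x|lebesgue. f x * G x))" if b: "b \<in> Basis" for b
  proof -
    obtain G :: "(real, 'n) vec \<Rightarrow> real" where "G \<in> mixed_herz_space (- \<alpha>) p' q'"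
      "\<And>f. f \<in> ?R \<Longrightarrow> inner (\<Lambda> (\<lambda>x. of_real (f x))) b = (LINT x|lebesgue. f x * G x)"
    proof (rule real_representation[OF p q p' q', where \<Lambda> = "\<lambda>f. inner (\<Lambda> (\<lambda>x. of_real (f x))) b" and C = C])
      fix f h assume f: "f \<in> ?R" and h: "h \<in> ?R"
      show "inner (\<Lambda> (\<lambda>x. of_real (f x + h x))) b = inner (\<Lambda> (\<lambda>x. of_real (f x))) b + inner (\<Lambda> (\<lambda>x. of_real (h x))) b"
        using add[OF ofE[OF f] ofE[OF h]] by (simp add: inner_add_left)
    next
      fix c f assume f: "f \<in> ?R"
      show "inner (\<Lambda> (\<lambda>x. of_real (c * f x))) b = c * inner (\<Lambda> (\<lambda>x. of_real (f x))) b"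
        using scale[OF ofE[OF f], of "of_real c"] by (simp add: scaleR_conv_of_real[symmetric])
    next
      fix f assume f: "f \<in> ?R"
      have "\<bar>inner (\<Lambda> (\<lambda>x. of_real (f x))) b\<bar> \<le> norm (\<Lambda> (\<lambda>x. of_real (f x)))"
        using b by (rule Basis_le_norm)
      also have "\<dots> \<le> C * enn2real (mixed_herz_norm \<alpha> p q f)" using C(2)[OF ofE[OF f]] by (simp add: of_norm[OF f])
      finally show "\<bar>inner (\<Lambda> (\<lambda>x. of_real (f x))) b\<bar> \<le> C * enn2real (mixed_herz_norm \<alpha> p q f)" .
    qed (use C in auto)
    then show ?thesis by blast
  qed
  then have "\<exists>G. \<forall>b\<in>Basis. G b \<in> mixed_herz_space (- \<alpha>) p' q' \<and>
      (\<forall>f\<in>?R. inner (\<Lambda> (\<lambda>x. of_real (f x))) b = (LINT x|lebesgue. f x * G b x))"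
    by (intro bchoice) blast
  then obtain G :: "'a \<Rightarrow> (real, 'n) vec \<Rightarrow> real" where GE: "\<And>b. b \<in> Basis \<Longrightarrow> G b \<in> mixed_herz_space (- \<alpha>) p' q'"
    and G: "\<And>b f. b \<in> Basis \<Longrightarrow> f \<in> ?R \<Longrightarrow> inner (\<Lambda> (\<lambda>x. of_real (f x))) b = (LINT x|lebesgue. f x * G b x)"
    by blast
  define g where "g = (\<lambda>x. \<Sum>b\<in>Basis. G b x *\<^sub>R b)"
  have "(\<lambda>x. \<Sum>b\<in>B. G b x *\<^sub>R b) \<in> mixed_herz_space (- \<alpha>) p' q'" if "finite B" "B \<subseteq> Basis" for B
    using that
  proof induction
    case empty
    then show ?case using mixed_herz_space_zero[OF p1' q1'] by simp
  next
    case (insert b B)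
    then have b: "b \<in> Basis" by simp
    have n: "norm (G b x *\<^sub>R b) = \<bar>1\<bar> * norm (G b x)" for x using b by simp
    have m: "(\<lambda>x. G b x *\<^sub>R b) \<in> borel_measurable lebesgue"
      using mixed_herz_spaceD(1)[OF GE[OF b]] by measurable
    have "(\<lambda>x. G b x *\<^sub>R b) \<in> mixed_herz_space (- \<alpha>) p' q'"
      by (rule mixed_herz_space_scale[OF p1' q1' GE[OF b] m n])
    then show ?case using insert mixed_herz_space_add[OF conjugate_sym[OF p'] conjugate_sym[OF q']] by simp
  qed
  then have gE: "g \<in> mixed_herz_space (- \<alpha>) p' q'" by (simp add: g_def)
  have rep_real: "\<Lambda> (\<lambda>x. of_real (f x)) = pairing g (\<lambda>x. of_real (f x))" if f: "f \<in> ?R" for f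
  proof -
    have I: "integrable lebesgue (\<lambda>x. f x * G b x)" if "b \<in> Basis" for b
      by (rule integrable_product(1)[OF p' q' f GE[OF that]])
    have "pairing g (\<lambda>x. of_real (f x)) = (LINT x|lebesgue. (\<Sum>b\<in>Basis. (f x * G b x) *\<^sub>R b))"
      by (simp add: pairing_def g_def scaleR_conv_of_real[symmetric] scaleR_sum_right)
    also have "\<dots> = (\<Sum>b\<in>Basis. LINT x|lebesgue. (f x * G b x) *\<^sub>R b)"
      using I by (intro Bochner_Integration.integral_sum) auto
    also have "\<dots> = (\<Sum>b\<in>Basis. inner (\<Lambda> (\<lambda>x. of_real (f x))) b *\<^sub>R b)"
      using I by (intro sum.cong refl) (simp add: G[OF _ f])
    also have "\<dots> = \<Lambda> (\<lambda>x. of_real (f x))" by (rule euclidean_representation)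
    finally show ?thesis ..
  qed
  show thesis
  proof (rule that[OF gE])
    fix f assume f: "f \<in> ?E"
    note [measurable] = mixed_herz_spaceD(1)[OF f]
    have fb: "(\<lambda>x. inner (f x) b) \<in> ?R" if "b \<in> Basis" for b
      using that by (intro mixed_herz_space_mono(1)[OF p1 q1 _ f]) (auto intro: Basis_le_norm)
    have f_eq: "f x = (\<Sum>b\<in>Basis. b * of_real (inner (f x) b))" for x
      using euclidean_representation[of "f x"] by (simp add: scaleR_conv_of_real mult.commute)
    have lin_sum: "(\<lambda>x. \<Sum>b\<in>B. b * of_real (inner (f x) b)) \<in> ?E \<and>
        \<Lambda> (\<lambda>x. \<Sum>b\<in>B. b * of_real (inner (f x) b)) = (\<Sum>b\<in>B. b * \<Lambda> (\<lambda>x. of_real (inner (f x) b)))"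
      if "finite B" "B \<subseteq> Basis" for B
      using that
    proof induction
      case empty
      have zE: "(\<lambda>x. 0) \<in> ?E" by (rule mixed_herz_space_zero[OF p1 q1])
      then show ?case using scale[OF zE, of 0] by simp
    next
      case (insert b B)
      then have b: "b \<in> Basis" by simp
      have n: "norm (b * of_real (inner (f x) b)) = \<bar>1\<bar> * norm (inner (f x) b)" for x
        using b by (simp add: norm_mult)
      have m: "(\<lambda>x. b * of_real (inner (f x) b)) \<in> borel_measurable lebesgue" by measurable
      have "(\<lambda>x. b * of_real (inner (f x) b)) \<in> ?E"
        by (rule mixed_herz_space_scale[OF p1 q1 fb[OF b] m n])
      then show ?case
        using insert add[of "\<lambda>x. b * of_real (inner (f x) b)" "\<lambda>x. \<Sum>b\<in>B. b * of_real (inner (f x) b)"]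
          mixed_herz_space_add[OF p' q', of "\<lambda>x. b * of_real (inner (f x) b)" \<alpha> "\<lambda>x. \<Sum>b\<in>B. b * of_real (inner (f x) b)"]
          scale[OF ofE[OF fb[OF b]], of b]
        by simp
    qed
    have I: "integrable lebesgue (\<lambda>x. of_real (inner (f x) b) * g x)" if "b \<in> Basis" for b
      by (rule integrable_product(1)[OF p' q' ofE[OF fb[OF that]] gE])
    have "\<Lambda> f = \<Lambda> (\<lambda>x. \<Sum>b\<in>Basis. b * of_real (inner (f x) b))" by (simp only: f_eq[symmetric])
    also have "\<dots> = (\<Sum>b\<in>Basis. b * \<Lambda> (\<lambda>x. of_real (inner (f x) b)))"
      using lin_sum[of Basis] by simp
    also have "\<dots> = (\<Sum>b\<in>Basis. b * (LINT x|lebesgue. of_real (inner (f x) b) * g x))"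
      by (intro sum.cong refl) (simp add: rep_real[OF fb] pairing_def)
    also have "\<dots> = (\<Sum>b\<in>Basis. LINT x|lebesgue. b * (of_real (inner (f x) b) * g x))"
      by simp
    also have "\<dots> = (LINT x|lebesgue. (\<Sum>b\<in>Basis. b * (of_real (inner (f x) b) * g x)))"
      using I by (intro Bochner_Integration.integral_sum[symmetric]) auto
    also have "\<dots> = (LINT x|lebesgue. f x * g x)"
      by (subst (2) f_eq) (simp add: sum_distrib_right mult.assoc)
    finally show "\<Lambda> f = pairing g f" by (simp add: pairing_def)
  qed
qed

theorem theorem2p10:
  fixes \<alpha> :: "real ^ 'n::{finite,linorder}"
    and p q p' q' :: "ennreal ^ 'n::{finite,linorder}"
  assumes p: "\<And>i. 1 \<le> p $ i \<and> p $ i < \<infinity>"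
    and q: "\<And>i. 1 \<le> q $ i \<and> q $ i < \<infinity>"
    and p': "\<And>i. 1 / p $ i + 1 / p' $ i = 1"
    and q': "\<And>i. 1 / q $ i + 1 / q' $ i = 1"
  defines "E \<equiv> mixed_herz_space \<alpha> p q ::
      (real ^ 'n::{finite,linorder} \<Rightarrow> 'a::{real_normed_field,euclidean_space}) set"
    and "E' \<equiv> mixed_herz_space (- \<alpha>) p' q' :: (real ^ 'n::{finite,linorder} \<Rightarrow> 'a) set"
  shows
    "(\<forall>g\<in>E'.
        (\<forall>f\<in>E. integrable lebesgue (\<lambda>x. f x * g x)) \<and>
        linear_functional_on E (pairing g) \<and>
        herz_bounded \<alpha> p q (pairing g)) \<and>
     (\<forall>\<Lambda>. linear_functional_on E \<Lambda> \<and> herz_continuous \<alpha> p q \<Lambda> \<longrightarrow>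
        (\<exists>g\<in>E'. (\<forall>f\<in>E. \<Lambda> f = pairing g f) \<and>
           (\<forall>h\<in>E'. (\<forall>f\<in>E. \<Lambda> f = pairing h f) \<longrightarrow> (AE x in lebesgue. h x = g x)))) \<and>
     (\<forall>g\<in>E'. mixed_herz_norm (- \<alpha>) p' q' g = herz_dual_norm \<alpha> p q (pairing g))"
proof (intro conjI ballI allI impI)
  have cp: "conjugate (p $ i) (p' $ i)" and cq: "conjugate (q $ i) (q' $ i)" for i
    using p' q' by (simp_all add: conjugate_def)
  {
    fix g f assume g: "g \<in> E'" and f: "f \<in> E"
    show "integrable lebesgue (\<lambda>x. f x * g x)"
      using f g unfolding E_def E'_def by (rule integrable_product(1)[OF cp cq])
  }
  note I = this
  {
    fix g assume g: "g \<in> E'"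
    show "linear_functional_on E (pairing g)"
      unfolding linear_functional_on_def pairing_def
      using I[OF g] by (simp add: distrib_right mult.assoc)
    show "herz_bounded \<alpha> p q (pairing g)"
      unfolding herz_bounded_def
    proof (intro exI ballI)
      fix f :: "(real, 'n) vec \<Rightarrow> 'a" assume f: "f \<in> mixed_herz_space \<alpha> p q"
      have fin: "mixed_herz_norm \<alpha> p q f < \<infinity>" "mixed_herz_norm (- \<alpha>) p' q' g < \<infinity>"
        using f g by (simp_all add: E'_def mixed_herz_space_def)
      have "ennreal (norm (pairing g f)) \<le> mixed_herz_norm \<alpha> p q f * mixed_herz_norm (- \<alpha>) p' q' g"
        unfolding pairing_def using f g unfolding E'_def by (rule integrable_product(2)[OF cp cq])
      also have "\<dots> = ennreal (enn2real (mixed_herz_norm (- \<alpha>) p' q' g) * enn2real (mixed_herz_norm \<alpha> p q f))"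
        using fin by (simp add: ennreal_mult mult.commute)
      finally show "norm (pairing g f) \<le> enn2real (mixed_herz_norm (- \<alpha>) p' q' g) * enn2real (mixed_herz_norm \<alpha> p q f)"
        by (simp add: ennreal_le_iff)
    qed
    show "mixed_herz_norm (- \<alpha>) p' q' g = herz_dual_norm \<alpha> p q (pairing g)"
      using g unfolding E'_def by (intro antisym mixed_norm_le_dual_norm[OF cp cq] dual_norm_le_mixed_norm[OF cp cq])
  }
  fix \<Lambda> :: "((real, 'n) vec \<Rightarrow> 'a) \<Rightarrow> 'a" assume \<Lambda>: "linear_functional_on E \<Lambda> \<and> herz_continuous \<alpha> p q \<Lambda>"
  obtain g where g: "g \<in> E'" and rep: "\<And>f. f \<in> E \<Longrightarrow> \<Lambda> f = pairing g f"
    using functional_representation[OF p q cp cq] \<Lambda> unfolding E_def E'_def by metis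
  show "\<exists>g\<in>E'. (\<forall>f\<in>E. \<Lambda> f = pairing g f) \<and>
      (\<forall>h\<in>E'. (\<forall>f\<in>E. \<Lambda> f = pairing h f) \<longrightarrow> (AE x in lebesgue. h x = g x))"
  proof (intro bexI[OF _ g] conjI ballI impI)
    fix h assume h: "h \<in> E'" and rep_h: "\<forall>f\<in>E. \<Lambda> f = pairing h f"
    show "AE x in lebesgue. h x = g x"
    proof (rule pairing_unique[OF _ cp cq])
      show "p $ i < \<infinity>" for i using p by simp
      show "pairing g f = pairing h f" if "f \<in> mixed_herz_space \<alpha> p q" for f
        using that rep rep_h by (simp add: E_def)
    qed (use g h in \<open>simp_all add: E'_def\<close>)
  qed (use rep in auto)
qed

end
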